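(* Let $\mathfrak g$ be a simple complex Lie algebra, $V=V_1\otimes\cdots\otimes V_n$ a tensor product of highest weight $\mathfrak g$-modules and $\kappa$ a non-zero complex parameter. The equations $$\kappa\,\partial_{\mu'}u=\sum_{i=1}^{n}z_i(\mu')^{(i)}u+\sum_{\alpha>0}\frac{\langle\alpha,\mu'\rangle}{\langle\alpha,\mu\rangle}\,e_{-\alpha}e_{\alpha}u,\qquad \mu'\in\mathfrak h,$$ form, together with the Knizhnik--Zamolodchikov equations $$\kappa\frac{\partial u}{\partial z_i}=\mu^{(i)}u+\sum_{j:\,j\ne i}\frac{\Omega^{(ij)}}{z_i-z_j}u,\qquad i=1,\dots,n,$$ a compatible system of equations for a function $u(z,\mu)$ of $z\in\mathbb C^n$, $\mu\in\mathfrak h$, taking values in $V$.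
   Context: $\mathfrak g$ is equipped with a non-degenerate invariant symmetric bilinear form $(\,,)$ and a root space decomposition $\mathfrak g=\mathfrak h\oplus\bigoplus_{\alpha\in\Delta}\mathbb C e_\alpha$, with root vectors normalized by $(e_\alpha,e_{-\alpha})=1$. A system of simple roots is fixed; $\alpha>0$ means that $\alpha\in\Delta$ is a positive root. $\langle\,,\rangle$ is the pairing of $\mathfrak h^*$ with $\mathfrak h$. $\Omega=\sum_s h_s\otimes h_s+\sum_{\alpha\in\Delta}e_\alpha\otimes e_{-\alpha}$, where $(h_s)$ is an orthonormal basis of $\mathfrak h$. $\Omega^{(ij)}$ acts on $V$ as $\Omega$ on the $i$th and $j$th tensor factors and as the identity on the others; for $x\in\mathfrak g$, $x^{(i)}$ acts as $x$ on the $i$th factor and as the identity on the others; $e_{-\alpha}e_\alpha$ acts on $V$ through the usual action $x\mapsto\sum_i x^{(i)}$ of $\mathfrak g$ on the tensor product. $\partial_{\mu'}$ is the partial derivative with respect to $\mu$ in the direction $\mu'$. The equations are considered where $z_i\neq z_j$ for $i\ne j$ and $\langle\alpha,\mu\rangle\neq0$ for all $\alpha\in\Delta$. Writing the equations as $(\kappa\partial_{z_i}-A_i)u=0$ and $(\kappa\partial_{\mu'}-B_{\mu'})u=0$, compatible means that the differential operators $\kappa\partial_{z_i}-A_i$ ($1\le i\le n$), $\kappa\partial_{\mu'}-B_{\mu'}$ ($\mu'\in\mathfrak h$) pairwise commute. *)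

theory Defs
  imports "HOL-Analysis.Analysis" "HOL-Library.Function_Algebras"
begin

text \<open>Linear maps and subspaces are relative to carriers inside ambient vector spaces, because
  the Cartan subalgebra is a subspace of the Lie algebra and the tensor factors may be spaces of
  different dimensions.\<close>

definition linear_on ::
  "(complex \<Rightarrow> 'a::ab_group_add \<Rightarrow> 'a) \<Rightarrow> (complex \<Rightarrow> 'b::ab_group_add \<Rightarrow> 'b) \<Rightarrow> 'a set \<Rightarrow> ('a \<Rightarrow> 'b) \<Rightarrow> bool"
  where "linear_on s1 s2 A f \<longleftrightarrow>
    (\<forall>x\<in>A. \<forall>y\<in>A. f (x + y) = f x + f y) \<and> (\<forall>c. \<forall>x\<in>A. f (s1 c x) = s2 c (f x))"

definition fscale :: "complex \<Rightarrow> ('a \<Rightarrow> complex) \<Rightarrow> ('a \<Rightarrow> complex)"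
  where "fscale c f = (\<lambda>x. c * f x)"


section \<open>Simple Lie algebras and root data\<close>

locale lie_algebra = vector_space scale
  for scale :: "complex \<Rightarrow> 'g::ab_group_add \<Rightarrow> 'g" +
  fixes bracket :: "'g \<Rightarrow> 'g \<Rightarrow> 'g"
  assumes bracket_linear_left: "linear_on scale scale UNIV (\<lambda>x. bracket x y)"
    and bracket_linear_right: "linear_on scale scale UNIV (bracket x)"
    and bracket_self: "bracket x x = 0"
    and jacobi: "bracket x (bracket y z) + bracket y (bracket z x) + bracket z (bracket x y) = 0"
begin

definition ideal :: "'g set \<Rightarrow> bool"
  where "ideal I \<longleftrightarrow> subspace I \<and> (\<forall>x. \<forall>y\<in>I. bracket x y \<in> I)"

end

locale simple_lie_algebra = lie_algebra +
  assumes finite_dimensional: "\<exists>B. finite B \<and> span B = UNIV"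
    and not_abelian: "\<exists>x y. bracket x y \<noteq> 0"
    and ideal_trivial: "ideal I \<Longrightarrow> I = {0} \<or> I = UNIV"

definition invariant_form ::
  "(complex \<Rightarrow> 'g::ab_group_add \<Rightarrow> 'g) \<Rightarrow> ('g \<Rightarrow> 'g \<Rightarrow> 'g) \<Rightarrow> ('g \<Rightarrow> 'g \<Rightarrow> complex) \<Rightarrow> bool"
  where "invariant_form sg br form \<longleftrightarrow>
    (\<forall>x. linear_on sg (*) UNIV (form x)) \<and>
    (\<forall>x y. form x y = form y x) \<and>
    (\<forall>x y z. form (br x y) z = form x (br y z)) \<and>
    (\<forall>x. (\<forall>y. form x y = 0) \<longrightarrow> x = 0)"

text \<open>An element of the dual of \<open>H\<close> is represented by the function that is extended by zero
  outside \<open>H\<close>. Equality, negation and linear combinations of such functions are then those of the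
  dual space.\<close>

definition dual :: "(complex \<Rightarrow> 'g::ab_group_add \<Rightarrow> 'g) \<Rightarrow> 'g set \<Rightarrow> ('g \<Rightarrow> complex) set"
  where "dual sg H = {\<alpha>. linear_on sg (*) H \<alpha> \<and> (\<forall>x. x \<notin> H \<longrightarrow> \<alpha> x = 0)}"

definition root_space :: "(complex \<Rightarrow> 'g::ab_group_add \<Rightarrow> 'g) \<Rightarrow> ('g \<Rightarrow> 'g \<Rightarrow> 'g) \<Rightarrow> 'g set
    \<Rightarrow> ('g \<Rightarrow> complex) \<Rightarrow> 'g set"
  where "root_space sg br H \<alpha> = {x. \<forall>h\<in>H. br h x = sg (\<alpha> h) x}"

definition roots :: "(complex \<Rightarrow> 'g::ab_group_add \<Rightarrow> 'g) \<Rightarrow> ('g \<Rightarrow> 'g \<Rightarrow> 'g) \<Rightarrow> 'g set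
    \<Rightarrow> ('g \<Rightarrow> complex) set"
  where "roots sg br H = {\<alpha> \<in> dual sg H. \<alpha> \<noteq> 0 \<and> root_space sg br H \<alpha> \<noteq> {0}}"

text \<open>The decomposition of the Lie algebra as the direct sum of \<open>H\<close> and the lines spanned by the
  root vectors \<open>e \<alpha>\<close>. It forces the abelian subalgebra \<open>H\<close> to be its own centralizer, hence a
  Cartan subalgebra.\<close>

definition root_decomposition :: "(complex \<Rightarrow> 'g::ab_group_add \<Rightarrow> 'g) \<Rightarrow> ('g \<Rightarrow> 'g \<Rightarrow> 'g) \<Rightarrow> 'g set
    \<Rightarrow> (('g \<Rightarrow> complex) \<Rightarrow> 'g) \<Rightarrow> bool"
  where "root_decomposition sg br H e \<longleftrightarrow>
    module.subspace sg H \<and>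
    (\<forall>x\<in>H. \<forall>y\<in>H. br x y = 0) \<and>
    finite (roots sg br H) \<and>
    (\<forall>\<alpha>\<in>roots sg br H. e \<alpha> \<noteq> 0 \<and> e \<alpha> \<in> root_space sg br H \<alpha>) \<and>
    (\<forall>x. \<exists>h\<in>H. \<exists>c. x = h + (\<Sum>\<alpha>\<in>roots sg br H. sg (c \<alpha>) (e \<alpha>))) \<and>
    (\<forall>h\<in>H. \<forall>c. h + (\<Sum>\<alpha>\<in>roots sg br H. sg (c \<alpha>) (e \<alpha>)) = 0 \<longrightarrow>
       h = 0 \<and> (\<forall>\<alpha>\<in>roots sg br H. c \<alpha> = 0))"

definition positive_roots :: "('g \<Rightarrow> complex) set \<Rightarrow> ('g \<Rightarrow> complex) set \<Rightarrow> ('g \<Rightarrow> complex) set"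
  where "positive_roots \<Delta> S = {\<alpha>\<in>\<Delta>. \<exists>c::('g \<Rightarrow> complex) \<Rightarrow> nat. \<alpha> = (\<Sum>\<beta>\<in>S. fscale (of_nat (c \<beta>)) \<beta>)}"

definition simple_root_system :: "('g \<Rightarrow> complex) set \<Rightarrow> ('g \<Rightarrow> complex) set \<Rightarrow> bool"
  where "simple_root_system \<Delta> S \<longleftrightarrow>
    S \<subseteq> \<Delta> \<and> \<not> module.dependent fscale S \<and>
    (\<forall>\<alpha>\<in>\<Delta>. \<alpha> \<in> positive_roots \<Delta> S \<or> - \<alpha> \<in> positive_roots \<Delta> S)"

definition orthonormal_basis :: "(complex \<Rightarrow> 'g::ab_group_add \<Rightarrow> 'g) \<Rightarrow> ('g \<Rightarrow> 'g \<Rightarrow> complex) \<Rightarrow> 'g set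
    \<Rightarrow> ('r \<Rightarrow> 'g) \<Rightarrow> bool"
  where "orthonormal_basis sg form H hs \<longleftrightarrow>
    module.span sg (range hs) = H \<and> (\<forall>s t. form (hs s) (hs t) = (if s = t then 1 else 0))"


section \<open>Highest weight modules\<close>

definition lie_module :: "(complex \<Rightarrow> 'g::ab_group_add \<Rightarrow> 'g) \<Rightarrow> ('g \<Rightarrow> 'g \<Rightarrow> 'g)
    \<Rightarrow> (complex \<Rightarrow> 'v::ab_group_add \<Rightarrow> 'v) \<Rightarrow> 'v set \<Rightarrow> ('g \<Rightarrow> 'v \<Rightarrow> 'v) \<Rightarrow> bool"
  where "lie_module sg br sv M \<rho> \<longleftrightarrow>
    module.subspace sv M \<and>
    (\<forall>x. \<forall>v\<in>M. \<rho> x v \<in> M) \<and>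
    (\<forall>x. linear_on sv sv M (\<rho> x)) \<and>
    (\<forall>v\<in>M. linear_on sg sv UNIV (\<lambda>x. \<rho> x v)) \<and>
    (\<forall>x y. \<forall>v\<in>M. \<rho> (br x y) v = \<rho> x (\<rho> y v) - \<rho> y (\<rho> x v))"

definition highest_weight_module :: "(complex \<Rightarrow> 'g::ab_group_add \<Rightarrow> 'g) \<Rightarrow> ('g \<Rightarrow> 'g \<Rightarrow> 'g) \<Rightarrow> 'g set
    \<Rightarrow> (('g \<Rightarrow> complex) \<Rightarrow> 'g) \<Rightarrow> ('g \<Rightarrow> complex) set
    \<Rightarrow> (complex \<Rightarrow> 'v::ab_group_add \<Rightarrow> 'v) \<Rightarrow> 'v set \<Rightarrow> ('g \<Rightarrow> 'v \<Rightarrow> 'v) \<Rightarrow> bool"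
  where "highest_weight_module sg br H e \<Delta>pos sv M \<rho> \<longleftrightarrow>
    lie_module sg br sv M \<rho> \<and>
    (\<exists>v\<in>M. \<exists>wt\<in>dual sg H. v \<noteq> 0 \<and>
       (\<forall>\<alpha>\<in>\<Delta>pos. \<rho> (e \<alpha>) v = 0) \<and>
       (\<forall>h\<in>H. \<rho> h v = sv (wt h) v) \<and>
       (\<forall>W. module.subspace sv W \<and> W \<subseteq> M \<and> v \<in> W \<and> (\<forall>x. \<forall>w\<in>W. \<rho> x w \<in> W) \<longrightarrow> W = M))"


section \<open>Tensor products\<close>

definition multilinear_on :: "(complex \<Rightarrow> 'v::ab_group_add \<Rightarrow> 'v) \<Rightarrow> (complex \<Rightarrow> 'w::ab_group_add \<Rightarrow> 'w)
    \<Rightarrow> ('n \<Rightarrow> 'v set) \<Rightarrow> (('n \<Rightarrow> 'v) \<Rightarrow> 'w) \<Rightarrow> bool"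
  where "multilinear_on sv sw V f \<longleftrightarrow>
    (\<forall>v\<in>Pi UNIV V. \<forall>i. linear_on sv sw (V i) (\<lambda>x. f (v(i := x))))"

text \<open>The tensor product of the spaces \<open>V i\<close> is realized inside the dual of the space of
  multilinear forms on them: a pure tensor is evaluation of multilinear forms, and the tensor
  product is the span of the pure tensors. The universal property is proved below
  (\<open>tensor_universal\<close>).\<close>

type_synonym ('n, 'v) tensor = "(('n \<Rightarrow> 'v) \<Rightarrow> complex) \<Rightarrow> complex"

definition pure_tensor :: "(complex \<Rightarrow> 'v::ab_group_add \<Rightarrow> 'v) \<Rightarrow> ('n \<Rightarrow> 'v set)
    \<Rightarrow> ('n \<Rightarrow> 'v) \<Rightarrow> ('n, 'v) tensor"
  where "pure_tensor sv V v = (\<lambda>\<phi>. if multilinear_on sv (*) V \<phi> then \<phi> v else 0)"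

definition tensor_space :: "(complex \<Rightarrow> 'v::ab_group_add \<Rightarrow> 'v) \<Rightarrow> ('n \<Rightarrow> 'v set)
    \<Rightarrow> ('n, 'v) tensor set"
  where "tensor_space sv V = module.span fscale (pure_tensor sv V ` Pi UNIV V)"

text \<open>The operator acting as \<open>f\<close> on the factor \<open>i\<close> and as the identity on the other factors; see
  \<open>on_factor_pure_tensor\<close> below.\<close>

definition on_factor :: "(complex \<Rightarrow> 'v::ab_group_add \<Rightarrow> 'v) \<Rightarrow> ('n \<Rightarrow> 'v set) \<Rightarrow> 'n \<Rightarrow> ('v \<Rightarrow> 'v)
    \<Rightarrow> ('n, 'v) tensor \<Rightarrow> ('n, 'v) tensor"
  where "on_factor sv V i f F =
    (\<lambda>\<phi>. if multilinear_on sv (*) V \<phi> then F (\<lambda>v. \<phi> (v(i := f (v i)))) else 0)"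

definition factor_action :: "(complex \<Rightarrow> 'v::ab_group_add \<Rightarrow> 'v) \<Rightarrow> ('n \<Rightarrow> 'v set)
    \<Rightarrow> ('n \<Rightarrow> 'g \<Rightarrow> 'v \<Rightarrow> 'v) \<Rightarrow> 'n \<Rightarrow> 'g \<Rightarrow> ('n, 'v) tensor \<Rightarrow> ('n, 'v) tensor"
  where "factor_action sv V \<rho> i x = on_factor sv V i (\<rho> i x)"

lemma vector_space_fscale: "vector_space fscale"
  by unfold_locales (auto simp: fscale_def algebra_simps fun_eq_iff)

interpretation fsc: vector_space fscale
  by (rule vector_space_fscale)

lemma multilinear_on_update:
  assumes "multilinear_on sv sw V \<phi>" "linear_on sv sv (V i) f" "f ` V i \<subseteq> V i"
  shows "multilinear_on sv sw V (\<lambda>v. \<phi> (v(i := f (v i))))"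
  unfolding multilinear_on_def
proof (intro ballI allI)
  fix v j assume v: "v \<in> Pi UNIV V"
  show "linear_on sv sw (V j) (\<lambda>x. \<phi> ((v(j := x))(i := f ((v(j := x)) i))))"
  proof (cases "i = j")
    case True
    have "linear_on sv sw (V i) (\<lambda>x. \<phi> (v(i := x)))"
      using assms(1) v by (auto simp: multilinear_on_def)
    then show ?thesis
      using assms(2,3) True by (auto simp: linear_on_def image_subset_iff)
  next
    case False
    have "v(i := f (v i)) \<in> Pi UNIV V"
      using v assms(3) by (auto simp: Pi_iff image_subset_iff)
    then have "linear_on sv sw (V j) (\<lambda>x. \<phi> ((v(i := f (v i)))(j := x)))"
      using assms(1) by (auto simp: multilinear_on_def)
    then show ?thesis
      using False by (simp add: fun_upd_twist)
  qed
qed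

lemma on_factor_pure_tensor:
  assumes "linear_on sv sv (V i) f" "f ` V i \<subseteq> V i"
  shows "on_factor sv V i f (pure_tensor sv V v) = pure_tensor sv V (v(i := f (v i)))"
  using multilinear_on_update[where V = V and i = i and f = f, OF _ assms]
  by (auto simp: on_factor_def pure_tensor_def fun_eq_iff)

lemma on_factor_linear: "linear_on fscale fscale UNIV (on_factor sv V i f)"
  by (auto simp: linear_on_def on_factor_def fscale_def fun_eq_iff)

lemma tensor_functional:
  assumes "linear_on fscale (*) (tensor_space sv V) l"
    and V: "\<And>i. module.subspace sv (V i)" and sv: "vector_space sv"
  obtains \<phi> where "multilinear_on sv (*) V \<phi>" "\<And>F. F \<in> tensor_space sv V \<Longrightarrow> l F = F \<phi>"
proof -
  interpret s: vector_space sv by (rule sv)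
  define \<phi> where "\<phi> = (\<lambda>v. l (pure_tensor sv V v))"
  have pt: "pure_tensor sv V v \<in> tensor_space sv V" if "v \<in> Pi UNIV V" for v
    unfolding tensor_space_def using that by (intro fsc.span_base imageI)
  have m: "multilinear_on sv (*) V \<phi>"
    unfolding multilinear_on_def linear_on_def
  proof (intro ballI allI conjI)
    fix v i x y and c :: complex
    assume v: "v \<in> Pi UNIV V" and x: "x \<in> V i"
    have *: "v(i := z) \<in> Pi UNIV V" if "z \<in> V i" for z
      using v that by (auto simp: Pi_iff)
    have "pure_tensor sv V (v(i := sv c x)) = fscale c (pure_tensor sv V (v(i := x)))"
      using v x by (auto simp: pure_tensor_def fscale_def multilinear_on_def linear_on_def fun_eq_iff)
    then show "\<phi> (v(i := sv c x)) = c * \<phi> (v(i := x))"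
      using assms(1) pt[OF *[OF x]] by (simp add: \<phi>_def linear_on_def)
    assume y: "y \<in> V i"
    have "pure_tensor sv V (v(i := x + y)) = pure_tensor sv V (v(i := x)) + pure_tensor sv V (v(i := y))"
      using v x y by (auto simp: pure_tensor_def multilinear_on_def linear_on_def fun_eq_iff)
    then show "\<phi> (v(i := x + y)) = \<phi> (v(i := x)) + \<phi> (v(i := y))"
      using assms(1) pt[OF *[OF x]] pt[OF *[OF y]] by (simp add: \<phi>_def linear_on_def)
  qed
  have l_eq: "F \<in> tensor_space sv V \<and> l F = F \<phi>" if "F \<in> fsc.span (pure_tensor sv V ` Pi UNIV V)" for F
    using that
  proof (induction rule: fsc.span_induct_alt)
    case base
    have "(0::('a, 'b) tensor) \<in> tensor_space sv V"
      by (simp add: tensor_space_def fsc.span_zero)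
    then have "l (0 + 0) = l 0 + l 0"
      using assms(1) unfolding linear_on_def by blast
    then have "l 0 = 0" by simp
    then show ?case unfolding tensor_space_def by (metis fsc.span_zero zero_fun_apply)
  next
    case (step c x y)
    then obtain v where v: "v \<in> Pi UNIV V" and x: "x = pure_tensor sv V v" by auto
    have "y \<in> tensor_space sv V"
      using step by simp
    moreover have cx: "fscale c x \<in> tensor_space sv V"
      using pt[OF v] unfolding x tensor_space_def by (rule fsc.span_scale)
    ultimately have "l (fscale c x + y) = c * l x + l y"
      using assms(1) pt[OF v] by (simp add: linear_on_def x)
    moreover have "fscale c x + y \<in> tensor_space sv V"
      using cx step unfolding tensor_space_def by (blast intro: fsc.span_add)
    moreover have "l x = x \<phi>"
      using m by (simp add: x pure_tensor_def \<phi>_def)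
    moreover have "c * x \<phi> + y \<phi> = (fscale c x + y) \<phi>"
      by (simp add: fscale_def)
    ultimately show ?case
      using step by metis
  qed
  show ?thesis
    by (rule that[OF m]) (use l_eq in \<open>simp add: tensor_space_def\<close>)
qed

theorem tensor_universal:
  fixes sv :: "complex \<Rightarrow> 'v::ab_group_add \<Rightarrow> 'v" and sw :: "complex \<Rightarrow> 'w::ab_group_add \<Rightarrow> 'w"
    and V :: "'n \<Rightarrow> 'v set"
  assumes sw: "vector_space sw" and f: "multilinear_on sv sw V f"
  shows "\<exists>g. linear_on fscale sw (tensor_space sv V) g \<and> (\<forall>v\<in>Pi UNIV V. g (pure_tensor sv V v) = f v)"
    and "\<lbrakk>linear_on fscale sw (tensor_space sv V) g; \<forall>v\<in>Pi UNIV V. g (pure_tensor sv V v) = f v;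
          linear_on fscale sw (tensor_space sv V) g'; \<forall>v\<in>Pi UNIV V. g' (pure_tensor sv V v) = f v;
          F \<in> tensor_space sv V\<rbrakk> \<Longrightarrow> g F = g' F"
proof -
  interpret w: vector_space sw by (rule sw)
  interpret p: vector_space_pair "fscale :: _ \<Rightarrow> ('n, 'v) tensor \<Rightarrow> _" sw by unfold_locales
  interpret q: vector_space_pair sw "(*) :: complex \<Rightarrow> _" 
    by unfold_locales (auto simp: algebra_simps)
  let ?P = "pure_tensor sv V ` Pi UNIV V"
  obtain B where B: "B \<subseteq> ?P" "fsc.independent B" "?P \<subseteq> fsc.span B"
    by (rule fsc.maximal_independent_subset)
  define h where "h = inv_into (Pi UNIV V) (pure_tensor sv V)"
  have h: "h b \<in> Pi UNIV V" "pure_tensor sv V (h b) = b" if "b \<in> B" for b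
    using that B(1) by (auto simp: h_def inv_into_into f_inv_into_f subset_iff)
  define g where "g = p.construct B (f \<circ> h)"
  interpret g: Vector_Spaces.linear fscale sw g
    unfolding g_def by (rule p.linear_construct[OF B(2)])
  have "g (pure_tensor sv V v) = f v" if v: "v \<in> Pi UNIV V" for v
  proof (rule ccontr)
    assume ne: "g (pure_tensor sv V v) \<noteq> f v"
    let ?d = "g (pure_tensor sv V v) - f v"
    have ind: "w.independent {?d}" using ne by simp
    define l where "l = q.construct {?d} (\<lambda>_. 1)"
    interpret l: Vector_Spaces.linear sw "(*)" l
      unfolding l_def by (rule q.linear_construct[OF ind])
    have l1: "l ?d = 1"
      unfolding l_def using q.construct_basis[OF ind] by simp
    have m: "multilinear_on sv (*) V (l \<circ> f)"
      using f by (auto simp: multilinear_on_def linear_on_def l.add l.scale)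
    have g_lin: "l (g (fscale c x + y)) = c * l (g x) + l (g y)" for c x y
      by (simp add: g.add g.scale l.add l.scale)
    have "l (g F) = F (l \<circ> f)" if "F \<in> fsc.span B" for F
      using that
    proof (induction rule: fsc.span_induct_alt)
      case base
      show ?case unfolding g.zero l.zero by simp
    next
      case (step c x y)
      have "g x = f (h x)"
        unfolding g_def using p.construct_basis[OF B(2) step(1)] by simp
      moreover have "x (l \<circ> f) = l (f (h x))"
        using h[OF step(1)] m by (metis comp_apply pure_tensor_def)
      ultimately show ?case
        using step(2) unfolding g_lin by (simp add: fscale_def comp_def)
    qed
    from this[of "pure_tensor sv V v"] have "l (g (pure_tensor sv V v)) = l (f v)"
      using B(3) v m by (auto simp: pure_tensor_def subset_iff)
    then show False using l1 by (simp add: l.diff)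
  qed
  moreover have "linear_on fscale sw (tensor_space sv V) g"
    by (auto simp: linear_on_def g.add g.scale)
  ultimately show "\<exists>g. linear_on fscale sw (tensor_space sv V) g \<and>
      (\<forall>v\<in>Pi UNIV V. g (pure_tensor sv V v) = f v)" by blast
next
  interpret w: vector_space sw by (rule sw)
  assume g: "linear_on fscale sw (tensor_space sv V) g" "\<forall>v\<in>Pi UNIV V. g (pure_tensor sv V v) = f v"
    and g': "linear_on fscale sw (tensor_space sv V) g'" "\<forall>v\<in>Pi UNIV V. g' (pure_tensor sv V v) = f v"
    and F: "F \<in> tensor_space sv V"
  have z: "k 0 = 0" if "linear_on fscale sw (tensor_space sv V) k" for k
  proof -
    have "(0::('n, 'v) tensor) \<in> tensor_space sv V"
      by (simp add: tensor_space_def fsc.span_zero)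
    then have "k (0 + 0) = k 0 + k 0"
      using that unfolding linear_on_def by blast
    then show ?thesis by simp
  qed
  have "F \<in> tensor_space sv V \<and> g F = g' F"
    using F unfolding tensor_space_def[of sv V]
  proof (induction rule: fsc.span_induct_alt)
    case base
    show ?case using z[OF g(1)] z[OF g'(1)] by (metis fsc.span_zero)
  next
    case (step c x y)
    have x: "x \<in> tensor_space sv V" and cx: "fscale c x \<in> tensor_space sv V"
      and y: "y \<in> tensor_space sv V"
      using step by (auto simp: tensor_space_def intro: fsc.span_base fsc.span_scale)
    then have "k (fscale c x + y) = sw c (k x) + k y"
      if "linear_on fscale sw (tensor_space sv V) k" for k
      using that by (simp add: linear_on_def)
    moreover have "fscale c x + y \<in> fsc.span (pure_tensor sv V ` Pi UNIV V)"
      using cx y unfolding tensor_space_def by (rule fsc.span_add)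
    moreover have "g x = g' x"
      using g(2) g'(2) step(1) by auto
    ultimately show ?case
      using g(1) g'(1) step(2) by metis
  qed
  then show "g F = g' F" by simp
qed


section \<open>Holomorphic functions of \<open>z\<close> and \<open>\<mu>\<close>\<close>

text \<open>The Cartan subalgebra carries the topology and the complex structure of the coordinate space
  of a basis \<open>hs\<close>; neither depends on the choice of the basis.\<close>

definition chart :: "(complex \<Rightarrow> 'g::ab_group_add \<Rightarrow> 'g) \<Rightarrow> ('r::finite \<Rightarrow> 'g)
    \<Rightarrow> (complex^'n) \<times> (complex^'r) \<Rightarrow> (complex^'n) \<times> 'g"
  where "chart sg hs = (\<lambda>(z, m). (z, \<Sum>s\<in>UNIV. sg (m $ s) (hs s)))"

definition open_domain :: "(complex \<Rightarrow> 'g::ab_group_add \<Rightarrow> 'g) \<Rightarrow> ('r::finite \<Rightarrow> 'g) \<Rightarrow> 'g set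
    \<Rightarrow> ((complex^'n) \<times> 'g) set \<Rightarrow> bool"
  where "open_domain sg hs H W \<longleftrightarrow> W \<subseteq> UNIV \<times> H \<and> open (chart sg hs -` W)"

definition holomorphic_scalar :: "(complex \<Rightarrow> 'g::ab_group_add \<Rightarrow> 'g) \<Rightarrow> ('r::finite \<Rightarrow> 'g)
    \<Rightarrow> ((complex^'n::finite) \<times> 'g) set \<Rightarrow> ((complex^'n) \<times> 'g \<Rightarrow> complex) \<Rightarrow> bool"
  where "holomorphic_scalar sg hs W f \<longleftrightarrow>
    (\<forall>q \<in> chart sg hs -` W. \<exists>D. (f \<circ> chart sg hs has_derivative D) (at q) \<and>
       (\<forall>c a b. D (c *s a, c *s b) = c * D (a, b)))"

text \<open>The tensor product may have infinite dimension and carries no topology. Holomorphy and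
  partial derivatives of a vector-valued function are those of its compositions with all linear
  functionals, which are the evaluations at multilinear forms (\<open>tensor_functional\<close>). For functions
  with values in a finite-dimensional subspace these are the usual notions.\<close>

definition holomorphic_tensor :: "(complex \<Rightarrow> 'g::ab_group_add \<Rightarrow> 'g) \<Rightarrow> ('r::finite \<Rightarrow> 'g)
    \<Rightarrow> (complex \<Rightarrow> 'v::ab_group_add \<Rightarrow> 'v) \<Rightarrow> ('n::finite \<Rightarrow> 'v set) \<Rightarrow> ((complex^'n) \<times> 'g) set
    \<Rightarrow> ((complex^'n) \<times> 'g \<Rightarrow> ('n, 'v) tensor) \<Rightarrow> bool"
  where "holomorphic_tensor sg hs sv V W u \<longleftrightarrow>
    (\<forall>p\<in>W. u p \<in> tensor_space sv V) \<and>
    (\<forall>\<phi>. multilinear_on sv (*) V \<phi> \<longrightarrow> holomorphic_scalar sg hs W (\<lambda>p. u p \<phi>))"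

definition partial_z :: "'n \<Rightarrow> ((complex^'n) \<times> 'g \<Rightarrow> ('n, 'v) tensor)
    \<Rightarrow> (complex^'n) \<times> 'g \<Rightarrow> ('n, 'v) tensor"
  where "partial_z i u = (\<lambda>(z, \<mu>) \<phi>. deriv (\<lambda>t. u (z + axis i t, \<mu>) \<phi>) 0)"

definition partial_mu :: "(complex \<Rightarrow> 'g::ab_group_add \<Rightarrow> 'g) \<Rightarrow> 'g
    \<Rightarrow> ((complex^'n) \<times> 'g \<Rightarrow> ('n, 'v) tensor) \<Rightarrow> (complex^'n) \<times> 'g \<Rightarrow> ('n, 'v) tensor"
  where "partial_mu sg \<mu>' u = (\<lambda>(z, \<mu>) \<phi>. deriv (\<lambda>t. u (z, \<mu> + sg t \<mu>') \<phi>) 0)"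


section \<open>The differential operators\<close>

text \<open>Below, \<open>act i x\<close> is the action of \<open>x\<close> on the factor \<open>i\<close>.\<close>

definition total_action :: "('n::finite \<Rightarrow> 'g \<Rightarrow> ('n, 'v) tensor \<Rightarrow> ('n, 'v) tensor) \<Rightarrow> 'g
    \<Rightarrow> ('n, 'v) tensor \<Rightarrow> ('n, 'v) tensor"
  where "total_action act x F = (\<Sum>i\<in>UNIV. act i x F)"

definition Omega :: "('n \<Rightarrow> 'g \<Rightarrow> ('n, 'v) tensor \<Rightarrow> ('n, 'v) tensor) \<Rightarrow> ('r::finite \<Rightarrow> 'g)
    \<Rightarrow> ('g \<Rightarrow> complex) set \<Rightarrow> (('g \<Rightarrow> complex) \<Rightarrow> 'g) \<Rightarrow> 'n \<Rightarrow> 'n \<Rightarrow> ('n, 'v) tensor \<Rightarrow> ('n, 'v) tensor"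
  where "Omega act hs \<Delta> e i j F =
    (\<Sum>s\<in>UNIV. act i (hs s) (act j (hs s) F)) + (\<Sum>\<alpha>\<in>\<Delta>. act i (e \<alpha>) (act j (e (- \<alpha>)) F))"

definition kz_operator :: "('n::finite \<Rightarrow> 'g \<Rightarrow> ('n, 'v) tensor \<Rightarrow> ('n, 'v) tensor)
    \<Rightarrow> ('r::finite \<Rightarrow> 'g) \<Rightarrow> ('g \<Rightarrow> complex) set \<Rightarrow> (('g \<Rightarrow> complex) \<Rightarrow> 'g) \<Rightarrow> complex \<Rightarrow> 'n
    \<Rightarrow> ((complex^'n) \<times> 'g \<Rightarrow> ('n, 'v) tensor) \<Rightarrow> (complex^'n) \<times> 'g \<Rightarrow> ('n, 'v) tensor"
  where "kz_operator act hs \<Delta> e \<kappa> i u = (\<lambda>(z, \<mu>).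
    fscale \<kappa> (partial_z i u (z, \<mu>)) -
    (act i \<mu> (u (z, \<mu>)) +
     (\<Sum>j\<in>UNIV - {i}. fscale (1 / (z $ i - z $ j)) (Omega act hs \<Delta> e i j (u (z, \<mu>))))))"

definition dynamical_operator :: "(complex \<Rightarrow> 'g::ab_group_add \<Rightarrow> 'g)
    \<Rightarrow> ('n::finite \<Rightarrow> 'g \<Rightarrow> ('n, 'v) tensor \<Rightarrow> ('n, 'v) tensor)
    \<Rightarrow> ('g \<Rightarrow> complex) set \<Rightarrow> (('g \<Rightarrow> complex) \<Rightarrow> 'g) \<Rightarrow> complex \<Rightarrow> 'g
    \<Rightarrow> ((complex^'n) \<times> 'g \<Rightarrow> ('n, 'v) tensor) \<Rightarrow> (complex^'n) \<times> 'g \<Rightarrow> ('n, 'v) tensor"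
  where "dynamical_operator sg act \<Delta>pos e \<kappa> \<mu>' u = (\<lambda>(z, \<mu>).
    fscale \<kappa> (partial_mu sg \<mu>' u (z, \<mu>)) -
    ((\<Sum>i\<in>UNIV. fscale (z $ i) (act i \<mu>' (u (z, \<mu>)))) +
     (\<Sum>\<alpha>\<in>\<Delta>pos. fscale (\<alpha> \<mu>' / \<alpha> \<mu>)
        (total_action act (e (- \<alpha>)) (total_action act (e \<alpha>) (u (z, \<mu>)))))))"

definition regular_domain :: "'g set \<Rightarrow> ('g \<Rightarrow> complex) set \<Rightarrow> ((complex^'n) \<times> 'g) set"
  where "regular_domain H \<Delta> =
    {(z, \<mu>). (\<forall>i j. i \<noteq> j \<longrightarrow> z $ i \<noteq> z $ j) \<and> \<mu> \<in> H \<and> (\<forall>\<alpha>\<in>\<Delta>. \<alpha> \<mu> \<noteq> 0)}"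

text \<open>Operators commute as differential operators on \<open>R\<close> if they commute on holomorphic functions
  defined on arbitrary open subsets of \<open>R\<close>.\<close>

definition compatible :: "(complex \<Rightarrow> 'g::ab_group_add \<Rightarrow> 'g) \<Rightarrow> ('r::finite \<Rightarrow> 'g) \<Rightarrow> 'g set
    \<Rightarrow> (complex \<Rightarrow> 'v::ab_group_add \<Rightarrow> 'v) \<Rightarrow> ('n::finite \<Rightarrow> 'v set) \<Rightarrow> ((complex^'n) \<times> 'g) set
    \<Rightarrow> (((complex^'n) \<times> 'g \<Rightarrow> ('n, 'v) tensor) \<Rightarrow> (complex^'n) \<times> 'g \<Rightarrow> ('n, 'v) tensor) set \<Rightarrow> bool"
  where "compatible sg hs H sv V R Ops \<longleftrightarrow>
    (\<forall>D\<in>Ops. \<forall>D'\<in>Ops. \<forall>W u. open_domain sg hs H W \<longrightarrow> W \<subseteq> R \<longrightarrow>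
       holomorphic_tensor sg hs sv V W u \<longrightarrow> (\<forall>p\<in>W. D (D' u) p = D' (D u) p))"

end

theory Submission
  imports Defs "HOL-Complex_Analysis.Cauchy_Integral_Formula"
begin

text \<open>Write the operators as \<open>\<kappa> \<partial>\<^sub>d - A\<^sub>d\<close>. Mixed partial derivatives of holomorphic functions commute, so two
  operators commute once the cross derivatives \<open>\<partial>\<^sub>d A\<^sub>d\<^sub>'\<close> and \<open>\<partial>\<^sub>d\<^sub>' A\<^sub>d\<close> agree and \<open>[A\<^sub>d, A\<^sub>d\<^sub>'] = 0\<close>. The
  commutators of two Knizhnik--Zamolodchikov coefficients vanish by the infinitesimal braid relations
  and partial fractions. For a mixed commutator, \<open>[\<mu>\<^sup>(\<^sup>i\<^sup>), \<dots>]\<close> of the dynamical sum is cancelled by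
  \<open>\<Sum>\<^sub>j [\<Omega>\<^sup>(\<^sup>i\<^sup>j\<^sup>), \<mu>'\<^sup>(\<^sup>i\<^sup>)]\<close>. For two dynamical coefficients, up to elements of the Cartan subalgebra the sum over
  positive roots is half the twisted Casimir element
  \<open>\<Sum>\<^sub>\<alpha> \<langle>\<alpha>,\<mu>'\<rangle> / \<langle>\<alpha>,\<mu>\<rangle> e\<^sub>\<alpha> e\<^sub>-\<^sub>\<alpha>\<close> over all roots. The commutator of two of these is a cubic sum over triples
  \<open>\<alpha> + \<beta> + \<gamma> = 0\<close> with totally antisymmetric structure constants. Its coefficients antisymmetrize to a
  determinant with linearly dependent columns, and the remaining linear term is odd under
  \<open>\<alpha> \<mapsto> -\<alpha>\<close>.\<close>


section \<open>Graded Lie algebras with an invariant form\<close>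

text \<open>Two points shape the proof. The quotients \<langle>\<alpha>,\<mu>'\<rangle> /
  \<langle>\<alpha>,\<mu>\<rangle> are the same for \<alpha> and -\<alpha>, so each product in the
  dynamical sum can be symmetrized at the cost of half a bracket of opposite root vectors. That
  bracket lies in the Cartan subalgebra and commutes with every other term it meets. An orthonormal
  basis of the Cartan subalgebra, with weight zero, and the root vectors are then indexed together:
  \<Omega>, the Casimir elements and the structure constants are all contractions over one pair of
  dual bases, and the cubic sums need no case distinction. The obstacle is that V may have infinite
  dimension and the Lie algebra relations hold on V only, not on the function space around it.
  Derivatives of u are computed form by form, without a claim that they stay in V. So the
  coefficients are kept linear on the whole function space, and their commutation is applied only to
  the value of u itself, which lies in V.\<close>

definition comm :: "'a::ring \<Rightarrow> 'a \<Rightarrow> 'a"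
  where "comm x y = x * y - y * x"

lemma comm_add_left: "comm (x + y) z = comm x z + comm y z"
  and comm_add_right: "comm z (x + y) = comm z x + comm z y"
  and comm_diff_left: "comm (x - y) z = comm x z - comm y z"
  and comm_diff_right: "comm z (x - y) = comm z x - comm z y"
  and comm_self: "comm z z = 0"
  and comm_sum_left: "comm (\<Sum>i\<in>A. f i) z = (\<Sum>i\<in>A. comm (f i) z)"
  and comm_sum_right: "comm z (\<Sum>i\<in>A. f i) = (\<Sum>i\<in>A. comm z (f i))"
  and comm_mult_left: "comm (x * y) z = x * comm y z + comm x z * y"
  and comm_mult_right: "comm z (x * y) = comm z x * y + x * comm z y"
  and comm_antisym: "comm x y = - comm y x"
  by (simp_all add: comm_def algebra_simps sum_distrib_left sum_distrib_right sum_subtractf)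

lemma comm_comm: "comm x y = 0 \<longleftrightarrow> comm y x = 0"
  using comm_antisym[of x y] by simp

lemma comm_eq_0_iff: "comm x y = 0 \<longleftrightarrow> x * y = y * x"
  by (simp add: comm_def)

locale complex_ring = vector_space sc
  for sc :: "complex \<Rightarrow> 'a::ring \<Rightarrow> 'a" +
  assumes sc_mult_left: "sc c x * y = sc c (x * y)"
    and sc_mult_right: "x * sc c y = sc c (x * y)"
begin

lemma comm_sc_left: "comm (sc c x) y = sc c (comm x y)"
  and comm_sc_right: "comm x (sc c y) = sc c (comm x y)"
  by (simp_all add: comm_def sc_mult_left sc_mult_right scale_right_diff_distrib)

end

locale metric_lie_algebra = lie_algebra sg br
  for sg :: "complex \<Rightarrow> 'g::ab_group_add \<Rightarrow> 'g" and br :: "'g \<Rightarrow> 'g \<Rightarrow> 'g" +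
  fixes form :: "'g \<Rightarrow> 'g \<Rightarrow> complex"
  assumes invariant: "invariant_form sg br form"
begin

lemma br_add_left: "br (y + y') z = br y z + br y' z"
  and br_scale_left: "br (sg c y) z = sg c (br y z)"
  using bracket_linear_left unfolding linear_on_def by auto

lemma br_add_right: "br z (y + y') = br z y + br z y'"
  and br_scale_right: "br z (sg c y) = sg c (br z y)"
  using bracket_linear_right unfolding linear_on_def by auto

lemma br_antisym: "br y z = - br z y"
proof -
  have "0 = br (y + z) (y + z)" by (simp add: bracket_self)
  also have "\<dots> = br y z + br z y"
    by (simp only: br_add_left br_add_right) (simp add: bracket_self)
  finally show ?thesis by (metis eq_neg_iff_add_eq_0)
qed

lemma br_zero_right: "br z 0 = 0"
  using br_add_right[of z 0 0] by simp

lemma br_sum_right: "br z (\<Sum>i\<in>A. f i) = (\<Sum>i\<in>A. br z (f i))"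
  by (induction A rule: infinite_finite_induct) (simp_all add: br_zero_right br_add_right)

lemma br_minus_right: "br z (- y) = - br z y"
  using br_add_right[of z y "- y"] by (simp add: br_zero_right eq_neg_iff_add_eq_0 add.commute)

lemma br_derivation: "br h (br y z) = br (br h y) z + br y (br h z)"
proof -
  have "br h (br y z) = - (br y (br z h) + br z (br h y))"
    using jacobi[of h y z] by (simp only: eq_neg_iff_add_eq_0 add.assoc)
  also have "br y (br z h) = - br y (br h z)"
    by (subst br_antisym) (rule br_minus_right)
  also have "br z (br h y) = - br (br h y) z"
    by (rule br_antisym)
  finally show ?thesis by (simp add: add.commute)
qed

lemma form_sym: "form y z = form z y"
  and form_inv: "form (br y z) v = form y (br z v)"
  and form_nondeg: "(\<And>z. form y z = 0) \<Longrightarrow> y = 0"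
  and form_add_right: "form y (z + z') = form y z + form y z'"
  and form_scale_right: "form y (sg c z) = c * form y z"
  using invariant unfolding invariant_form_def linear_on_def by blast+

lemma form_add_left: "form (z + z') y = form z y + form z' y"
  and form_scale_left: "form (sg c z) y = c * form z y"
  by (simp_all add: form_sym[of _ y] form_add_right form_scale_right)

lemma form_zero: "form 0 z = 0" "form z 0 = 0"
  using form_add_left[of 0 0 z] form_add_right[of z 0 0] by simp_all

lemma form_minus: "form (- y) z = - form y z" "form y (- z) = - form y z"
  using form_add_left[of y "- y" z] form_add_right[of y z "- z"]
  by (simp_all add: form_zero eq_neg_iff_add_eq_0 add.commute)

lemma form_sum_left: "form (\<Sum>i\<in>A. f i) z = (\<Sum>i\<in>A. form (f i) z)"
  by (induction A rule: infinite_finite_induct) (simp_all add: form_zero form_add_left)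

lemma form_sum_right: "form z (\<Sum>i\<in>A. f i) = (\<Sum>i\<in>A. form z (f i))"
  by (simp add: form_sym[of z] form_sum_left)

end

text \<open>\<open>x a\<close> and \<open>x (st a)\<close> model dual bases, with duality stated as
  the expansion of every element. Cartan basis vectors and root vectors will share the index set
  \<open>I\<close>, and \<open>zero_weight\<close> makes \<open>H\<close> its own
  centralizer.\<close>

locale graded_lie_algebra = metric_lie_algebra sg br form
  for sg :: "complex \<Rightarrow> 'g::ab_group_add \<Rightarrow> 'g" and br form +
  fixes H :: "'g set" and I :: "'i set" and x :: "'i \<Rightarrow> 'g" and st :: "'i \<Rightarrow> 'i" and w :: "'i \<Rightarrow> 'g \<Rightarrow> complex"
  assumes subspace_H: "subspace H"
    and abelian_H: "h \<in> H \<Longrightarrow> h' \<in> H \<Longrightarrow> br h h' = 0"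
    and finite_I: "finite I"
    and st_in: "a \<in> I \<Longrightarrow> st a \<in> I"
    and st_st: "a \<in> I \<Longrightarrow> st (st a) = a"
    and expansion: "y = (\<Sum>a\<in>I. sg (form y (x (st a))) (x a))"
    and weight: "h \<in> H \<Longrightarrow> a \<in> I \<Longrightarrow> br h (x a) = sg (w a h) (x a)"
    and w_st: "h \<in> H \<Longrightarrow> a \<in> I \<Longrightarrow> w (st a) h = - w a h"
    and zero_weight: "a \<in> I \<Longrightarrow> (\<And>h. h \<in> H \<Longrightarrow> w a h = 0) \<Longrightarrow> x a \<in> H"
begin

lemma st_reindex: "(\<Sum>a\<in>I. f (st a)) = (\<Sum>a\<in>I. f a)"
  by (rule sum.reindex_bij_witness[of _ st st]) (auto simp: st_in st_st)

lemma expansion_dual: "y = (\<Sum>a\<in>I. sg (form y (x a)) (x (st a)))"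
proof -
  have "(\<Sum>a\<in>I. sg (form y (x a)) (x (st a))) = (\<Sum>a\<in>I. sg (form y (x (st (st a)))) (x (st a)))"
    by (rule sum.cong) (auto simp: st_st)
  also have "\<dots> = y"
    using st_reindex[of "\<lambda>a. sg (form y (x (st a))) (x a)"] expansion[of y] by simp
  finally show ?thesis by simp
qed

text \<open>The structure constants with the third index lowered by the form. Invariance makes them
  totally antisymmetric, which is what lets indices be permuted in \<open>G\<close> below.\<close>

definition N :: "'i \<Rightarrow> 'i \<Rightarrow> 'i \<Rightarrow> complex"
  where "N i j k = form (br (x i) (x j)) (x k)"

lemma N_swap12: "N j i k = - N i j k"
  unfolding N_def by (subst br_antisym) (rule form_minus)

lemma N_swap23: "N i k j = - N i j k"
proof -
  have "N i k j = form (x i) (br (x k) (x j))" by (simp add: N_def form_inv)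
  also have "\<dots> = - form (x i) (br (x j) (x k))"
    by (subst br_antisym) (rule form_minus)
  finally show ?thesis by (simp add: N_def form_inv)
qed

text \<open>\<open>h\<close> acts on the bracket as a derivation and is skew for the form; pairing
  \<open>br h (br (x i) (x j))\<close> with \<open>x k\<close> in both ways gives two multiples of
  the same structure constant.\<close>

lemma N_weight:
  assumes "N i j k \<noteq> 0" "i \<in> I" "j \<in> I" "k \<in> I" "h \<in> H"
  shows "w i h + w j h + w k h = 0"
proof -
  have "form (br h (br (x i) (x j))) (x k) = (w i h + w j h) * N i j k"
    using assms by (simp add: br_derivation weight br_scale_left br_scale_right N_def
        form_add_left form_scale_left algebra_simps)
  moreover have "form (br h (br (x i) (x j))) (x k) = - form (br (x i) (x j)) (br h (x k))"
    by (subst br_antisym) (simp add: form_minus form_inv)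
  moreover have "\<dots> = - w k h * N i j k"
    using assms by (simp add: weight form_scale_right N_def)
  ultimately have "(w i h + w j h + w k h) * N i j k = 0"
    by (metis (no_types, lifting) distrib_right add.commute add.right_inverse mult_minus_left)
  then show ?thesis using assms(1) by simp
qed

lemma N_st_weight:
  assumes "N (st i) (st j) (st k) \<noteq> 0" "i \<in> I" "j \<in> I" "k \<in> I" "h \<in> H"
  shows "w i h + w j h + w k h = 0"
proof -
  have "- w i h + - w j h + - w k h = 0"
    using N_weight[OF assms(1) st_in st_in st_in assms(5)] assms(2-5) by (simp add: w_st)
  then show ?thesis by (metis add.inverse_inverse minus_add_distrib minus_zero)
qed

lemma bracket_expansion: "br (x (st i)) (x (st j)) = (\<Sum>k\<in>I. sg (N (st i) (st j) (st k)) (x k))"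
  unfolding N_def by (rule expansion)

lemma weight_triple:
  assumes "i \<in> I" "j \<in> I" "k \<in> I" "h \<in> H"
  shows "br h (br (x i) (br (x j) (x k))) = sg (w i h + w j h + w k h) (br (x i) (br (x j) (x k)))"
  using assms by (simp add: br_derivation[of h] weight br_scale_left br_scale_right br_add_right
      scale_left_distrib)

text \<open>The correction that remains after symmetrization in \<open>comm_casimirs\<close> below. It has weight zero,
  and its components in \<open>H\<close> change sign under the involution \<open>st\<close>.\<close>

lemma correction_zero:
  assumes a: "\<forall>i\<in>I. a (st i) = a i" and b: "\<forall>i\<in>I. b (st i) = b i"
  shows "(\<Sum>i\<in>I. \<Sum>j\<in>I. \<Sum>k\<in>I. sg (N (st i) (st j) (st k) * (a j * b i))
    (br (x i) (br (x j) (x k)) + br (x j) (br (x i) (x k)))) = 0" (is "?z = 0")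
proof -
  have N0: "N (st i) (st j) (st k) = 0 \<or> w i h + w j h + w k h = 0"
    if "i \<in> I" "j \<in> I" "k \<in> I" "h \<in> H" for i j k h
    using N_st_weight[of i j k h] that by blast
  have z0: "br h ?z = 0" if h: "h \<in> H" for h
  proof -
    have "br h (sg (N (st i) (st j) (st k) * (a j * b i))
        (br (x i) (br (x j) (x k)) + br (x j) (br (x i) (x k)))) = 0"
      if "i \<in> I" "j \<in> I" "k \<in> I" for i j k
      using N0[OF that h] that h by (auto simp: br_scale_right br_add_right weight_triple add.commute add.left_commute)
    then show ?thesis by (simp add: br_sum_right)
  qed
  have H0: "form ?z h = 0" if h: "h \<in> H" for h
  proof -
    have swap: "form (br (x p) y) h = w p h * form y (x p)" if "p \<in> I" for p y
    proof -
      have "form (br (x p) y) h = form (br y (- x p)) h"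
        by (subst br_antisym) (simp add: br_minus_right)
      also have "\<dots> = form y (br h (x p))"
        by (simp add: form_inv br_antisym[of h] br_minus_right form_minus)
      finally show ?thesis using that h by (simp add: weight form_scale_right)
    qed
    define t where "t = (\<lambda>i j k. N (st i) (st j) (st k) * (a j * b i) * (N i j k * (w i h - w j h)))"
    have 1: "form ?z h = (\<Sum>i\<in>I. \<Sum>j\<in>I. \<Sum>k\<in>I. t i j k)"
    proof -
      have "form (br (x i) (br (x j) (x k)) + br (x j) (br (x i) (x k))) h = N i j k * (w i h - w j h)"
        if "i \<in> I" "j \<in> I" for i j k
      proof -
        have "N j k i = N i j k" using N_swap12[of j i k] N_swap23[of j i k] by simp
        then show ?thesis using that N_swap23[of i j k]
          by (simp add: form_add_left swap) (simp add: N_def algebra_simps)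
      qed
      then show ?thesis
        by (simp add: form_sum_left form_scale_left t_def)
    qed
    \<comment> \<open>Applying \<open>st\<close> to all three indices exchanges the two structure
      constants in \<open>t\<close>, fixes \<open>a\<close> and \<open>b\<close> and negates the
      weights, so \<open>t\<close> is odd.\<close>
    have "(\<Sum>i\<in>I. \<Sum>j\<in>I. \<Sum>k\<in>I. t i j k) = (\<Sum>i\<in>I. \<Sum>j\<in>I. \<Sum>k\<in>I. t (st i) (st j) (st k))"
      by (simp only: st_reindex[of "\<lambda>i. \<Sum>j\<in>I. \<Sum>k\<in>I. t i j k"] 
          st_reindex[of "\<lambda>j. \<Sum>k\<in>I. t i j k" for i] st_reindex[of "\<lambda>k. t i j k" for i j])
    also have "\<dots> = (\<Sum>i\<in>I. \<Sum>j\<in>I. \<Sum>k\<in>I. - t i j k)"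
      by (intro sum.cong refl) (simp add: t_def st_st a b w_st h algebra_simps)
    finally have "2 * (\<Sum>i\<in>I. \<Sum>j\<in>I. \<Sum>k\<in>I. t i j k) = 0"
      by (simp add: sum_negf)
    then show ?thesis using 1 by simp
  qed
  \<comment> \<open>By \<open>expansion_dual\<close> it suffices to test against the
    \<open>x l\<close>. Those of zero weight lie in \<open>H\<close>; the others are orthogonal to
    an element of weight zero.\<close>
  have "form ?z (x l) = 0" if l: "l \<in> I" for l
  proof (cases "\<forall>h\<in>H. w l h = 0")
    case True
    then show ?thesis using H0 zero_weight[OF l] by blast
  next
    case False
    then obtain h where h: "h \<in> H" "w l h \<noteq> 0" by blast
    have "w l h * form ?z (x l) = form ?z (br h (x l))"
      using h l by (simp add: weight form_scale_right)
    also have "\<dots> = form (br ?z h) (x l)" by (simp add: form_inv)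
    also have "\<dots> = 0"
      by (subst br_antisym) (simp only: z0[OF h(1)] form_minus form_zero minus_zero)
    finally show ?thesis using h by simp
  qed
  then have "(\<Sum>a\<in>I. sg (form ?z (x a)) (x (st a))) = 0" by simp
  then show ?thesis using expansion_dual[of ?z] by simp
qed

text \<open>A component of \<open>y\<close> along a vector of non-zero weight would be detected by
  the bracket with some \<open>h\<close>. This later places the brackets of opposite root vectors in
  \<open>H\<close>.\<close>

lemma centralizer_H:
  assumes "\<And>h. h \<in> H \<Longrightarrow> br h y = 0"
  shows "y \<in> H"
proof -
  have "sg (form y (x (st a))) (x a) \<in> H" if a: "a \<in> I" for a
  proof (cases "x a \<in> H")
    case True
    then show ?thesis by (rule subspace_scale[OF subspace_H])
  next
    case False
    then obtain h where h: "h \<in> H" "w a h \<noteq> 0" using zero_weight[OF a] by blast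
    have "br y h = 0" using br_antisym[of y h] assms[OF h(1)] by simp
    then have "form y (br h (x (st a))) = 0"
      by (simp add: form_inv[symmetric] form_zero)
    then have "form y (x (st a)) = 0"
      using h a by (simp add: weight st_in w_st form_scale_right form_minus)
    then show ?thesis by (simp add: subspace_0[OF subspace_H])
  qed
  then show ?thesis
    by (subst expansion) (intro subspace_sum[OF subspace_H])
qed

text \<open>For root data: \<mu> lies on no root hyperplane. Cartan indices, whose weight vanishes
  on all of \<open>H\<close>, are exempt.\<close>

definition regular :: "'g \<Rightarrow> bool"
  where "regular \<mu> \<longleftrightarrow> \<mu> \<in> H \<and> (\<forall>a\<in>I. w a \<mu> = 0 \<longrightarrow> (\<forall>h\<in>H. w a h = 0))"

text \<open>For a Cartan index \<open>a\<close> the quotient is \<open>0 / 0 = 0\<close>.\<close>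

definition wq :: "'g \<Rightarrow> 'g \<Rightarrow> 'i \<Rightarrow> complex"
  where "wq \<mu> \<mu>' a = w a \<mu>' / w a \<mu>"

lemma wq_st: "\<mu> \<in> H \<Longrightarrow> \<mu>' \<in> H \<Longrightarrow> a \<in> I \<Longrightarrow> wq \<mu> \<mu>' (st a) = wq \<mu> \<mu>' a"
  by (simp add: wq_def w_st)

text \<open>The determinant of the three rows \<open>(1, 1, 1)\<close>, \<open>wq \<mu> \<mu>'\<close> and \<open>wq \<mu> \<mu>''\<close>: after multiplication
  of the columns by the weights at \<open>\<mu>\<close> all rows sum to zero.\<close>

lemma wq_determinant:
  assumes "regular \<mu>" "\<mu>' \<in> H" "\<mu>'' \<in> H" "i \<in> I" "j \<in> I" "k \<in> I"
    and N: "N (st i) (st j) (st k) \<noteq> 0"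
  defines "p \<equiv> wq \<mu> \<mu>'" and "q \<equiv> wq \<mu> \<mu>''"
  shows "p i * q j - p j * q i + p j * q k - p k * q j + p k * q i - p i * q k = 0"
proof -
  have det: "a' / a * (b'' / b) - b' / b * (a'' / a) + b' / b * (c'' / c) - c' / c * (b'' / b)
      + c' / c * (a'' / a) - a' / a * (c'' / c) = 0"
    if "a + b + c = 0" "a' + b' + c' = 0" "a'' + b'' + c'' = 0"
      and z: "a = 0 \<Longrightarrow> a' = 0" "a = 0 \<Longrightarrow> a'' = 0" "b = 0 \<Longrightarrow> b' = 0" "b = 0 \<Longrightarrow> b'' = 0"
        "c = 0 \<Longrightarrow> c' = 0" "c = 0 \<Longrightarrow> c'' = 0" for a b c a' b' c' a'' b'' c'' :: complex
  proof -
    have c: "c = - a - b" "c' = - a' - b'" "c'' = - a'' - b''"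
      using that(1-3) by (simp_all add: algebra_simps eq_neg_iff_add_eq_0)
    consider "a = 0" | "b = 0" | "c = 0" | "a \<noteq> 0" "b \<noteq> 0" "c \<noteq> 0" by blast
    then show ?thesis
    proof cases
      case 1
      then show ?thesis using z c by auto
    next
      case 2
      then show ?thesis using z c by auto
    next
      case 3
      \<comment> \<open>The first two columns of the determinant coincide here, and the third is (1,
        0, 0) because 0 / 0 = 0.\<close>
      then have "b = - a" "b' = - a'" "b'' = - a''" using z c
        by (auto simp: algebra_simps eq_neg_iff_add_eq_0)
      then show ?thesis using 3 z by auto
    next
      case 4
      define A B C P Q R where "A = a' / a" "B = b' / b" "C = c' / c" "P = a'' / a" "Q = b'' / b" "R = c'' / c"
      note defs = this
      \<comment> \<open>The vanishing row sums express the third column, multiplied by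
        \<open>c\<close>, through the other two; what remains is a polynomial identity.\<close>
      have "c * C = - a * A - b * B" "c * R = - a * P - b * Q"
        using 4 c by (simp_all add: defs)
      moreover have "c * (A * Q - B * P + B * R - C * Q + C * P - A * R) =
          c * (A * Q - B * P) + (B - A) * (c * R) + (P - Q) * (c * C)"
        (is "?l = ?r")
        by (simp add: algebra_simps)
      moreover have "(- a - b) * (A * Q - B * P) + (B - A) * (- a * P - b * Q) + (P - Q) * (- a * A - b * B) = 0"
        by (simp add: algebra_simps)
      ultimately have "?l = 0"
        using c(1) by metis
      then show ?thesis using 4 by (simp add: defs)
    qed
  qed
  have reg: "w a h = 0" if "w a \<mu> = 0" "a \<in> I" "h \<in> H" for a h
    using assms(1) that by (auto simp: regular_def)
  have "\<mu> \<in> H" using assms(1) by (simp add: regular_def)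
  then show ?thesis
    unfolding p_def q_def wq_def
    using assms(2-6) by (intro det) (auto intro: N_st_weight[OF N] dest: reg)
qed

end

section \<open>Commuting Casimir elements\<close>

locale lie_representation =
  graded_lie_algebra sg br form H I x st w + R: complex_ring sc
  for sg :: "complex \<Rightarrow> 'g::ab_group_add \<Rightarrow> 'g" and br form H
    and I :: "'i set" and x st w and sc :: "complex \<Rightarrow> 'a::ring \<Rightarrow> 'a" +
  fixes rep :: "'g \<Rightarrow> 'a"
  assumes rep_add: "rep (y + z) = rep y + rep z"
    and rep_scale: "rep (sg c y) = sc c (rep y)"
    and rep_bracket: "comm (rep y) (rep z) = rep (br y z)"
begin

lemma rep_zero: "rep 0 = 0"
  using rep_add[of 0 0] by simp

lemma rep_sum: "rep (\<Sum>i\<in>A. f i) = (\<Sum>i\<in>A. rep (f i))"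
  by (induction A rule: infinite_finite_induct) (simp_all add: rep_zero rep_add)

text \<open>Division by six has to pass through the complex scalars, since a \<open>ring\<close> has
  no unit and hence no numerals.\<close>

lemma sixfold_zero:
  fixes y :: 'a
  shows "y + y + (y + y) + (y + y) = 0 \<Longrightarrow> y = 0"
proof -
  have "y + y + (y + y) + (y + y) = sc 6 y"
    using R.scale_left_distrib[of 1 1 y] R.scale_left_distrib[of 2 2 y] R.scale_left_distrib[of 4 2 y]
    by simp
  then show "y + y + (y + y) + (y + y) = 0 \<Longrightarrow> y = 0" by simp
qed

definition X :: "'i \<Rightarrow> 'a"
  where "X a = rep (x a)"

text \<open>With \<open>a\<close> constantly one this is the Casimir element. For
  \<open>a = wq \<mu> \<mu>'\<close> the indices of zero weight drop out and the twisted sum over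
  all roots remains.\<close>

definition casimir :: "('i \<Rightarrow> complex) \<Rightarrow> 'a"
  where "casimir a = (\<Sum>i\<in>I. sc (a i) (X i * X (st i)))"

lemma comm_cartan_X: "h \<in> H \<Longrightarrow> i \<in> I \<Longrightarrow> comm (rep h) (X i) = sc (w i h) (X i)"
  by (simp add: X_def rep_bracket weight rep_scale)

lemma comm_cartan_cartan: "h \<in> H \<Longrightarrow> h' \<in> H \<Longrightarrow> comm (rep h) (rep h') = 0"
  by (simp add: rep_bracket abelian_H rep_zero)

lemma comm_cartan_casimir:
  assumes "h \<in> H"
  shows "comm (rep h) (casimir a) = 0"
  using assms
  by (simp add: casimir_def comm_sum_right R.comm_sc_right comm_mult_right comm_cartan_X st_in
      w_st R.sc_mult_left R.sc_mult_right R.scale_minus_left)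

text \<open>Coefficients \<open>f\<close> and operator words \<open>g\<close> are contracted with
  the structure constants. Keeping them apart allows a permutation of the letters to be moved into
  the coefficient, at the cost of its sign.\<close>

definition G :: "('i \<Rightarrow> 'i \<Rightarrow> 'i \<Rightarrow> complex) \<Rightarrow> ('i \<Rightarrow> 'i \<Rightarrow> 'i \<Rightarrow> 'a) \<Rightarrow> 'a"
  where "G f g = (\<Sum>i\<in>I. \<Sum>j\<in>I. \<Sum>k\<in>I. sc (N (st i) (st j) (st k) * f i j k) (g i j k))"

lemma G_add_left: "G (\<lambda>i j k. f i j k + f' i j k) g = G f g + G f' g"
  and G_diff_left: "G (\<lambda>i j k. f i j k - f' i j k) g = G f g - G f' g"
  and G_add_right: "G f (\<lambda>i j k. g i j k + g' i j k) = G f g + G f g'"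
  by (simp_all add: G_def algebra_simps R.scale_left_distrib R.scale_left_diff_distrib
      R.scale_right_distrib sum.distrib sum_subtractf)

lemma G_swap12: "G f g = - G (\<lambda>i j k. f j i k) (\<lambda>i j k. g j i k)"
proof -
  have "G f g = (\<Sum>j\<in>I. \<Sum>i\<in>I. \<Sum>k\<in>I. sc (N (st i) (st j) (st k) * f i j k) (g i j k))"
    unfolding G_def by (rule sum.swap)
  also have "\<dots> = - G (\<lambda>i j k. f j i k) (\<lambda>i j k. g j i k)"
    unfolding G_def sum_negf[symmetric]
    by (intro sum.cong refl) (subst N_swap12, simp)
  finally show ?thesis .
qed

lemma G_swap23: "G f g = - G (\<lambda>i j k. f i k j) (\<lambda>i j k. g i k j)"
proof -
  have "G f g = (\<Sum>i\<in>I. \<Sum>k\<in>I. \<Sum>j\<in>I. sc (N (st i) (st j) (st k) * f i j k) (g i j k))"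
    unfolding G_def by (intro sum.cong refl sum.swap)
  also have "\<dots> = - G (\<lambda>i j k. f i k j) (\<lambda>i j k. g i k j)"
    unfolding G_def sum_negf[symmetric]
    by (intro sum.cong refl) (subst N_swap23, simp)
  finally show ?thesis .
qed

lemma G_swap13: "G f g = - G (\<lambda>i j k. f k j i) (\<lambda>i j k. g k j i)"
proof -
  have "G f g = - G (\<lambda>i j k. f j i k) (\<lambda>i j k. g j i k)"
    by (rule G_swap12)
  also have "\<dots> = G (\<lambda>i j k. f k i j) (\<lambda>i j k. g k i j)"
    by (subst G_swap23) simp
  also have "\<dots> = - G (\<lambda>i j k. f k j i) (\<lambda>i j k. g k j i)"
    by (rule G_swap12)
  finally show ?thesis .
qed

lemma comm_X_st:
  assumes "i \<in> I" "j \<in> I"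
  shows "comm (X (st i)) (X (st j)) = (\<Sum>k\<in>I. sc (N (st i) (st j) (st k)) (X k))"
  unfolding X_def rep_bracket bracket_expansion rep_sum rep_scale ..

text \<open>The Leibniz rule gives four terms, each with one inner commutator. Since
  \<open>a\<close> and \<open>b\<close> are invariant under \<open>st\<close>, reindexing turns each
  inner commutator into \<open>c i j\<close>, which expands into letters \<open>X k\<close>; the
  four words record where the commutator stood.\<close>

lemma comm_casimirs_words:
  assumes a: "\<forall>i\<in>I. a (st i) = a i" and b: "\<forall>i\<in>I. b (st i) = b i"
  shows "comm (casimir a) (casimir b) = G (\<lambda>i j k. a i * b j)
    (\<lambda>i j k. X i * X j * X k + X i * X k * X j + X j * X k * X i + X k * X j * X i)"
proof -
  define c where "c = (\<lambda>i j. comm (X (st i)) (X (st j)))"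
  define t where "t = (\<lambda>f :: 'i \<Rightarrow> 'i \<Rightarrow> 'a. \<Sum>i\<in>I. \<Sum>j\<in>I. sc (a i * b j) (f i j))"
  have t_st1: "t (\<lambda>i j. f (st i) j) = t f" for f
  proof -
    have "t f = (\<Sum>i\<in>I. \<Sum>j\<in>I. sc (a (st i) * b j) (f (st i) j))"
      unfolding t_def by (simp only: st_reindex[of "\<lambda>i. \<Sum>j\<in>I. sc (a i * b j) (f i j)"])
    then show ?thesis by (simp add: t_def a)
  qed
  have t_st2: "t (\<lambda>i j. f i (st j)) = t f" for f
  proof -
    have "t f = (\<Sum>i\<in>I. \<Sum>j\<in>I. sc (a i * b (st j)) (f i (st j)))"
      unfolding t_def by (simp only: st_reindex[of "\<lambda>j. sc (a i * b j) (f i j)" for i])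
    then show ?thesis by (simp add: t_def b)
  qed
  have t_cong: "t f = t f'" if "\<And>i j. i \<in> I \<Longrightarrow> j \<in> I \<Longrightarrow> f i j = f' i j" for f f'
    using that by (simp add: t_def)
  have t_add: "t (\<lambda>i j. f i j + f' i j) = t f + t f'" for f f'
    by (simp add: t_def R.scale_right_distrib sum.distrib)
  have t_G: "t f = G (\<lambda>i j k. a i * b j) g"
    if "\<And>i j. i \<in> I \<Longrightarrow> j \<in> I \<Longrightarrow> f i j = (\<Sum>k\<in>I. sc (N (st i) (st j) (st k)) (g i j k))" for f g
    using that by (simp add: t_def G_def R.scale_sum_right mult.commute)
  have "comm (casimir a) (casimir b) = t (\<lambda>i j. comm (X i * X (st i)) (X j * X (st j)))"
    unfolding casimir_def t_def
    by (simp add: comm_sum_left comm_sum_right R.comm_sc_left R.comm_sc_right R.scale_sum_right)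
      (subst sum.swap, simp add: mult.commute)
  also have "\<dots> = t (\<lambda>i j. X i * X j * comm (X (st i)) (X (st j)))
      + t (\<lambda>i j. X i * comm (X (st i)) (X j) * X (st j))
      + t (\<lambda>i j. X j * comm (X i) (X (st j)) * X (st i))
      + t (\<lambda>i j. comm (X i) (X j) * X (st j) * X (st i))"
    unfolding t_add[symmetric]
    by (simp only: comm_mult_left) (simp add: comm_mult_right algebra_simps)
  also have "t (\<lambda>i j. X i * comm (X (st i)) (X j) * X (st j)) = t (\<lambda>i j. X i * c i j * X j)"
    unfolding c_def by (subst t_st2[symmetric]) (auto intro: t_cong simp: st_st)
  also have "t (\<lambda>i j. X j * comm (X i) (X (st j)) * X (st i)) = t (\<lambda>i j. X j * c i j * X i)"
    unfolding c_def by (subst t_st1[symmetric]) (auto intro: t_cong simp: st_st)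
  also have "t (\<lambda>i j. comm (X i) (X j) * X (st j) * X (st i)) = t (\<lambda>i j. c i j * X j * X i)"
    unfolding c_def by (subst t_st1[symmetric], subst t_st2[symmetric]) (auto intro: t_cong simp: st_st)
  also have "t (\<lambda>i j. X i * X j * comm (X (st i)) (X (st j))) = G (\<lambda>i j k. a i * b j) (\<lambda>i j k. X i * X j * X k)"
    by (rule t_G) (simp add: comm_X_st sum_distrib_left R.sc_mult_right)
  also have "t (\<lambda>i j. X i * c i j * X j) = G (\<lambda>i j k. a i * b j) (\<lambda>i j k. X i * X k * X j)"
    by (rule t_G) (simp add: c_def comm_X_st sum_distrib_left sum_distrib_right R.sc_mult_right R.sc_mult_left)
  also have "t (\<lambda>i j. X j * c i j * X i) = G (\<lambda>i j k. a i * b j) (\<lambda>i j k. X j * X k * X i)"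
    by (rule t_G) (simp add: c_def comm_X_st sum_distrib_left sum_distrib_right R.sc_mult_right R.sc_mult_left)
  also have "t (\<lambda>i j. c i j * X j * X i) = G (\<lambda>i j k. a i * b j) (\<lambda>i j k. X k * X j * X i)"
    by (rule t_G) (simp add: c_def comm_X_st sum_distrib_left sum_distrib_right R.sc_mult_right R.sc_mult_left)
  finally show ?thesis by (simp only: G_add_right)
qed

text \<open>Moving the permutations from the words to the coefficient turns the four words into four
  of the six terms of the determinant. The determinant trades them for the two terms in which
  \<open>a\<close> carries the middle index.\<close>

lemma comm_casimirs_ordered:
  assumes a: "\<forall>i\<in>I. a (st i) = a i" and b: "\<forall>i\<in>I. b (st i) = b i"
    and det: "\<And>g. G (\<lambda>i j k. a i * b j - a j * b i + a j * b k - a k * b j + a k * b i - a i * b k) g = 0"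
  shows "comm (casimir a) (casimir b) = G (\<lambda>i j k. a j * b i) (\<lambda>i j k. X i * X j * X k + X k * X j * X i)"
proof -
  define g where "g = (\<lambda>i j k. X i * X j * X k)"
  have d: "G (\<lambda>i j k. a i * b j) g - G (\<lambda>i j k. a j * b i) g + G (\<lambda>i j k. a j * b k) g
      - G (\<lambda>i j k. a k * b j) g + G (\<lambda>i j k. a k * b i) g - G (\<lambda>i j k. a i * b k) g = 0"
    using det[of g] by (simp only: G_add_left G_diff_left)
  have "comm (casimir a) (casimir b) = G (\<lambda>i j k. a i * b j) g + G (\<lambda>i j k. a i * b j) (\<lambda>i j k. g i k j)
      + G (\<lambda>i j k. a i * b j) (\<lambda>i j k. g j k i) + G (\<lambda>i j k. a i * b j) (\<lambda>i j k. g k j i)"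
    unfolding comm_casimirs_words[of a b, OF a b] by (simp add: G_add_right g_def)
  also have "G (\<lambda>i j k. a i * b j) (\<lambda>i j k. g i k j) = - G (\<lambda>i j k. a i * b k) g"
    by (rule G_swap23)
  also have "G (\<lambda>i j k. a i * b j) (\<lambda>i j k. g j k i) = G (\<lambda>i j k. a k * b i) g"
    by (subst G_swap13, subst G_swap12) simp
  also have "G (\<lambda>i j k. a i * b j) (\<lambda>i j k. g k j i) = - G (\<lambda>i j k. a k * b j) g"
    by (rule G_swap13)
  also have "G (\<lambda>i j k. a i * b j) g + - G (\<lambda>i j k. a i * b k) g + G (\<lambda>i j k. a k * b i) g + - G (\<lambda>i j k. a k * b j) g
      = G (\<lambda>i j k. a j * b i) g - G (\<lambda>i j k. a j * b k) g"
    using d by (simp add: algebra_simps)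
  also have "G (\<lambda>i j k. a j * b k) g = - G (\<lambda>i j k. a j * b i) (\<lambda>i j k. g k j i)"
    by (rule G_swap13)
  finally show ?thesis by (simp add: G_add_right g_def)
qed

text \<open>Modulo commutators the three-letter words are symmetric, and the coefficient
  \<open>a j * b i\<close> is annihilated by antisymmetrization.\<close>

lemma comm_casimirs:
  assumes a: "\<forall>i\<in>I. a (st i) = a i" and b: "\<forall>i\<in>I. b (st i) = b i"
    and det: "\<And>i j k. i \<in> I \<Longrightarrow> j \<in> I \<Longrightarrow> k \<in> I \<Longrightarrow> N (st i) (st j) (st k) \<noteq> 0 \<Longrightarrow>
      a i * b j - a j * b i + a j * b k - a k * b j + a k * b i - a i * b k = 0"
  shows "comm (casimir a) (casimir b) = 0"
proof -
  define f where "f = (\<lambda>i j k :: 'i. a j * b i)"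
  define g where "g = (\<lambda>i j k. X i * X j * X k)"
  define W where "W = (\<lambda>i j k. g i j k + g j i k + g k i j + g k j i + g i k j + g j k i)"
  define c where "c = (\<lambda>i j k. comm (X i) (comm (X j) (X k)) + comm (X j) (comm (X i) (X k)))"
  have det_ab: "G (\<lambda>i j k. a i * b j - a j * b i + a j * b k - a k * b j + a k * b i - a i * b k) g' = 0" for g'
    unfolding G_def using det by (intro sum.neutral ballI) force
  have det_ba: "G (\<lambda>i j k. b i * a j - b j * a i + b j * a k - b k * a j + b k * a i - b i * a k) g' = 0" for g'
  proof -
    have neg: "b i * a j - b j * a i + b j * a k - b k * a j + b k * a i - b i * a k
        = - (a i * b j - a j * b i + a j * b k - a k * b j + a k * b i - a i * b k)" for i j k
      by (simp add: algebra_simps)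
    then show ?thesis
      unfolding G_def neg by (intro sum.neutral ballI) (use det in force)
  qed
  have 1: "comm (casimir a) (casimir b) = G f (\<lambda>i j k. g i j k + g k j i)"
    unfolding comm_casimirs_ordered[of a b, OF a b det_ab] by (simp add: f_def g_def)
  \<comment> \<open>Exchanging the roles of \<open>a\<close> and \<open>b\<close> yields a second
    formula for the same commutator, with the other coefficient order moved back to \<open>f\<close>
    by a transposition.\<close>
  have "comm (casimir b) (casimir a) = G (\<lambda>i j k. f j i k) (\<lambda>i j k. g i j k + g k j i)"
    unfolding comm_casimirs_ordered[of b a, OF b a det_ba] by (simp add: f_def g_def mult.commute)
  also have "\<dots> = - G f (\<lambda>i j k. g j i k + g k i j)"
    by (rule G_swap12)
  finally have 2: "comm (casimir a) (casimir b) = G f (\<lambda>i j k. g j i k + g k i j)"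
    using comm_antisym[of "casimir a"] by simp
  have W: "G f' W = - G (\<lambda>i j k. f' j i k) W" "G f' W = - G (\<lambda>i j k. f' i k j) W"
      "G f' W = - G (\<lambda>i j k. f' k j i) W" for f'
    using G_swap12[of f' W] G_swap23[of f' W] G_swap13[of f' W] 
    by (simp_all add: W_def add_ac)
  \<comment> \<open>\<open>W\<close> is symmetric, so permuting the indices of \<open>f\<close>
    multiplies \<open>G f W\<close> by a sign. The determinant is the alternating sum of the six
    permuted copies of \<open>f\<close>, which makes the left side -6 times
    \<open>G f W\<close>.\<close>
  have "G (\<lambda>i j k. a i * b j - a j * b i + a j * b k - a k * b j + a k * b i - a i * b k) W =
      G (\<lambda>i j k. f j i k) W - G f W + G (\<lambda>i j k. f k j i) W - G (\<lambda>i j k. f j k i) W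
      + G (\<lambda>i j k. f i k j) W - G (\<lambda>i j k. f k i j) W"
    by (simp only: G_add_left G_diff_left f_def)
  moreover have "G (\<lambda>i j k. f k i j) W = G f W" "G (\<lambda>i j k. f j k i) W = G f W"
    using W(1)[of "\<lambda>i j k. f k i j"] W(1)[of "\<lambda>i j k. f j k i"] W(2)[of f] W(3)[of f] by simp_all
  ultimately have "- (G f W + G f W + (G f W + G f W) + (G f W + G f W)) = 0"
    using det_ab[of W] W[of f] by (simp add: algebra_simps)
  then have GW: "G f W = 0"
    unfolding neg_equal_0_iff_equal by (rule sixfold_zero)
  have "G f c = rep (\<Sum>i\<in>I. \<Sum>j\<in>I. \<Sum>k\<in>I. sg (N (st i) (st j) (st k) * (a j * b i))
    (br (x i) (br (x j) (x k)) + br (x j) (br (x i) (x k))))"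
    by (simp add: rep_sum rep_scale rep_add G_def c_def f_def X_def rep_bracket)
  then have Gc: "G f c = 0"
    unfolding correction_zero[of a b, OF a b] rep_zero .
  \<comment> \<open>Origin of the factor six: three times the four words of formulas
    \<open>1\<close> and \<open>2\<close> together are twice the six words of \<open>W\<close> plus
    the two double commutators in \<open>c\<close>.\<close>
  have *: "g i j k + g k j i + (g j i k + g k i j) + (g i j k + g k j i + (g j i k + g k i j))
      + (g i j k + g k j i + (g j i k + g k i j)) = W i j k + W i j k + c i j k" for i j k
    by (simp add: W_def c_def g_def comm_def algebra_simps)
  let ?C = "comm (casimir a) (casimir b)"
  have "?C + ?C + (?C + ?C) + (?C + ?C) = G f (\<lambda>i j k. g i j k + g k j i + (g j i k + g k i j)
      + (g i j k + g k j i + (g j i k + g k i j)) + (g i j k + g k j i + (g j i k + g k i j)))"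
    by (subst (1 3 5) 1, subst (1 2 3) 2) (simp only: G_add_right)
  also have "\<dots> = G f W + G f W + G f c"
    unfolding * by (simp only: G_add_right)
  finally have "?C + ?C + (?C + ?C) + (?C + ?C) = 0" using GW Gc by simp
  then show ?thesis by (rule sixfold_zero)
qed

lemma comm_casimir_wq:
  assumes "regular \<mu>" "\<mu>' \<in> H" "\<mu>'' \<in> H"
  shows "comm (casimir (wq \<mu> \<mu>')) (casimir (wq \<mu> \<mu>'')) = 0"
proof (rule comm_casimirs)
  have "\<mu> \<in> H" using assms(1) by (simp add: regular_def)
  then show "\<forall>i\<in>I. wq \<mu> \<mu>' (st i) = wq \<mu> \<mu>' i" "\<forall>i\<in>I. wq \<mu> \<mu>'' (st i) = wq \<mu> \<mu>'' i"
    using assms by (auto simp: wq_st)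
qed (rule wq_determinant[OF assms])

end

section \<open>Commutators of the coefficients\<close>

locale lie_actions =
  graded_lie_algebra sg br form H I x st w + R: complex_ring sc
  for sg :: "complex \<Rightarrow> 'g::ab_group_add \<Rightarrow> 'g" and br form H
    and I :: "'i set" and x st w and sc :: "complex \<Rightarrow> 'a::ring \<Rightarrow> 'a" +
  fixes act :: "'n::finite \<Rightarrow> 'g \<Rightarrow> 'a"
  assumes act_add: "act i (y + z) = act i y + act i z"
    and act_scale: "act i (sg c y) = sc c (act i y)"
    and act_bracket: "comm (act i y) (act i z) = act i (br y z)"
    and act_commute: "i \<noteq> j \<Longrightarrow> comm (act i y) (act j z) = 0"
begin

definition total :: "'g \<Rightarrow> 'a"
  where "total y = (\<Sum>i\<in>UNIV. act i y)"

lemma act_zero: "act i 0 = 0"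
  using act_add[of i 0 0] by simp

lemma act_minus: "act i (- y) = - act i y"
  using act_add[of i y "- y"] by (simp add: act_zero eq_neg_iff_add_eq_0 add.commute)

lemma act_sum: "act i (\<Sum>j\<in>A. f j) = (\<Sum>j\<in>A. act i (f j))"
  by (induction A rule: infinite_finite_induct) (simp_all add: act_zero act_add)

lemma comm_act_total: "comm (act i y) (total z) = act i (br y z)"
proof -
  have "comm (act i y) (total z) = (\<Sum>j\<in>UNIV. if j = i then act i (br y z) else 0)"
    unfolding total_def comm_sum_right by (intro sum.cong refl) (auto simp: act_bracket act_commute)
  then show ?thesis by simp
qed

sublocale tot: lie_representation sg br form H I x st w sc total
proof
  show "total (y + z) = total y + total z" for y z
    by (simp add: total_def act_add sum.distrib)
  show "total (sg c y) = sc c (total y)" for c y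
    by (simp add: total_def act_scale R.scale_sum_right)
  show "comm (total y) (total z) = total (br y z)" for y z
    by (subst (1 3) total_def) (simp add: comm_sum_left comm_act_total)
qed

section \<open>Invariance of \<Omega> and the infinitesimal braid relations\<close>

definition Om :: "'n \<Rightarrow> 'n \<Rightarrow> 'a"
  where "Om i j = (\<Sum>a\<in>I. act i (x a) * act j (x (st a)))"

lemma Om_sym: "i \<noteq> j \<Longrightarrow> Om i j = Om j i"
proof -
  assume ij: "i \<noteq> j"
  have "Om j i = (\<Sum>a\<in>I. act j (x (st a)) * act i (x (st (st a))))"
    unfolding Om_def by (rule st_reindex[symmetric])
  also have "\<dots> = Om i j"
    unfolding Om_def using act_commute[OF ij] by (intro sum.cong refl) (simp add: st_st comm_eq_0_iff)
  finally show ?thesis by simp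
qed

lemma comm_Om_other: "k \<noteq> i \<Longrightarrow> k \<noteq> j \<Longrightarrow> comm (Om i j) (act k y) = 0"
  by (simp add: Om_def comm_sum_left comm_mult_left act_commute)

text \<open>The matrix \<open>m\<close> of the bracket with \<open>y\<close> is skew for the form.
  Expanding one sum in the \<open>x b\<close> and the other in the dual vectors
  \<open>x (st a)\<close> therefore gives opposite double sums.\<close>

lemma comm_Om_pair:
  assumes ij: "i \<noteq> j"
  shows "comm (Om i j) (act i y + act j y) = 0"
proof -
  define m where "m = (\<lambda>a b. form (br (x a) y) (x (st b)))"
  have m: "form (br (x (st b)) y) (x a) = - m a b" for a b
    unfolding m_def form_inv br_antisym[of y] form_minus(2)
    by (simp add: form_sym[of "x (st b)"] form_inv br_antisym[of y "x (st b)"] form_minus)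
  have "comm (Om i j) (act i y + act j y) =
      (\<Sum>a\<in>I. act i (br (x a) y) * act j (x (st a))) + (\<Sum>b\<in>I. act i (x b) * act j (br (x (st b)) y))"
    using ij by (simp add: Om_def comm_sum_left comm_mult_left comm_add_right act_commute act_bracket sum.distrib)
  also have "(\<Sum>a\<in>I. act i (br (x a) y) * act j (x (st a))) =
      (\<Sum>a\<in>I. \<Sum>b\<in>I. sc (m a b) (act i (x b) * act j (x (st a))))"
  proof (intro sum.cong refl)
    fix a
    have "act i (br (x a) y) = (\<Sum>b\<in>I. sc (m a b) (act i (x b)))"
      by (subst expansion[of "br (x a) y"]) (simp add: act_sum act_scale m_def)
    then show "act i (br (x a) y) * act j (x (st a)) = (\<Sum>b\<in>I. sc (m a b) (act i (x b) * act j (x (st a))))"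
      by (simp add: sum_distrib_right R.sc_mult_left)
  qed
  also have "\<dots> = (\<Sum>b\<in>I. \<Sum>a\<in>I. sc (m a b) (act i (x b) * act j (x (st a))))"
    by (rule sum.swap)
  also have "(\<Sum>b\<in>I. act i (x b) * act j (br (x (st b)) y)) =
      - (\<Sum>b\<in>I. \<Sum>a\<in>I. sc (m a b) (act i (x b) * act j (x (st a))))"
    unfolding sum_negf[symmetric]
  proof (intro sum.cong refl)
    fix b
    have "act j (br (x (st b)) y) = (\<Sum>a\<in>I. - sc (m a b) (act j (x (st a))))"
      by (subst expansion_dual[of "br (x (st b)) y"]) (simp add: act_sum act_minus act_scale m)
    then show "act i (x b) * act j (br (x (st b)) y) = (\<Sum>a\<in>I. - sc (m a b) (act i (x b) * act j (x (st a))))"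
      by (simp add: sum_distrib_left R.sc_mult_right)
  qed
  finally show ?thesis by simp
qed

lemma comm_Om_act_flip: "i \<noteq> j \<Longrightarrow> comm (Om i j) (act j y) = - comm (Om i j) (act i y)"
  using comm_Om_pair[of i j y] by (simp add: comm_add_right eq_neg_iff_add_eq_0 add.commute)

lemma comm_Om_total:
  assumes "i \<noteq> j"
  shows "comm (Om i j) (total y) = 0"
proof -
  have "comm (Om i j) (total y) = (\<Sum>k\<in>UNIV. comm (Om i j) (act k y))"
    by (simp add: total_def comm_sum_right)
  also have "\<dots> = (\<Sum>k\<in>{i, j}. comm (Om i j) (act k y))"
    by (rule sum.mono_neutral_right) (auto simp: comm_Om_other)
  also have "\<dots> = 0"
    using assms comm_Om_act_flip[OF assms] by simp
  finally show ?thesis .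
qed

lemma comm_Om_casimir: "i \<noteq> j \<Longrightarrow> comm (Om i j) (tot.casimir a) = 0"
  by (simp add: tot.casimir_def tot.X_def comm_sum_right R.comm_sc_right comm_mult_right comm_Om_total)

lemma comm_Om_disjoint:
  assumes "k \<noteq> i" "k \<noteq> j" "l \<noteq> i" "l \<noteq> j"
  shows "comm (Om i j) (Om k l) = 0"
  using assms by (subst (2) Om_def) (simp add: comm_sum_right comm_mult_right comm_Om_other)

text \<open>\<open>Om i k + Om j k\<close> involves the factors \<open>i\<close> and
  \<open>j\<close> only through the sum of their actions, which commutes with
  \<open>Om i j\<close>.\<close>

lemma comm_Om_triple:
  assumes "i \<noteq> j" "k \<noteq> i" "k \<noteq> j"
  shows "comm (Om i j) (Om j k) = - comm (Om i j) (Om i k)"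
proof -
  have "Om i k + Om j k = (\<Sum>a\<in>I. (act i (x a) + act j (x a)) * act k (x (st a)))"
    by (simp add: Om_def sum.distrib algebra_simps)
  then have "comm (Om i j) (Om i k + Om j k) = 0"
    using assms by (simp add: comm_sum_right comm_mult_right comm_Om_pair comm_Om_other)
  then show ?thesis
    by (simp add: comm_add_right eq_neg_iff_add_eq_0 add.commute)
qed

section \<open>Commutators of the Knizhnik--Zamolodchikov and dynamical coefficients\<close>

definition kz :: "('n \<Rightarrow> complex) \<Rightarrow> 'g \<Rightarrow> 'n \<Rightarrow> 'a"
  where "kz z \<mu> i = act i \<mu> + (\<Sum>j\<in>UNIV - {i}. sc (1 / (z i - z j)) (Om i j))"

text \<open>The dynamical coefficient after symmetrization over all roots. The parameter
  \<open>h\<close> holds the Cartan correction; the commutators below vanish for every choice of it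
  in \<open>H\<close>.\<close>

definition dyn :: "('n \<Rightarrow> complex) \<Rightarrow> 'g \<Rightarrow> 'g \<Rightarrow> 'g \<Rightarrow> 'a"
  where "dyn z \<mu> \<mu>' h = (\<Sum>i\<in>UNIV. sc (z i) (act i \<mu>')) + sc (1 / 2) (tot.casimir (wq \<mu> \<mu>') - total h)"

text \<open>Besides the \<mu>-terms, each contribution involves a third index \<open>j\<close>, and
  the braid relations reduce all of them to multiples of the single commutator \<open>T j\<close>.
  The total coefficient vanishes by \<open>frac\<close>, the partial fraction identity 1/(pq) =
  1/(p(p+q)) + 1/(q(p+q)).\<close>

lemma comm_kz_kz:
  assumes z: "\<And>i j. i \<noteq> j \<Longrightarrow> z i \<noteq> z j"
  shows "comm (kz z \<mu> i) (kz z \<mu> k) = 0"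
proof (cases "i = k")
  case True
  then show ?thesis by (simp add: comm_self)
next
  case ik: False
  define r where "r = (\<lambda>i j. 1 / (z i - z j))"
  define A where "A = (UNIV :: 'n set) - {i, k}"
  have split: "(\<Sum>j\<in>UNIV - {p}. f j) = f q + (\<Sum>j\<in>A. f j)" if "{p, q} = {i, k}" "p \<noteq> q" for f :: "'n \<Rightarrow> 'a" and p q
  proof -
    have "UNIV - {p} = insert q A" "q \<notin> A" using that by (auto simp: A_def doubleton_eq_iff)
    then show ?thesis by simp
  qed
  have kz: "kz z \<mu> p = act p \<mu> + (\<Sum>j\<in>UNIV - {p}. sc (r p j) (Om p j))" for p
    by (simp add: kz_def r_def)
  have Pi: "kz z \<mu> i = act i \<mu> + (sc (r i k) (Om i k) + (\<Sum>j\<in>A. sc (r i j) (Om i j)))"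
    unfolding kz using ik by (subst split[of i k]) auto
  have Pk: "kz z \<mu> k = act k \<mu> + (- sc (r i k) (Om i k) + (\<Sum>j\<in>A. sc (r k j) (Om k j)))"
  proof -
    have "r k i = - r i k" using minus_divide_right[of 1 "z i - z k"] by (simp add: r_def)
    then show ?thesis
      unfolding kz using ik Om_sym[OF ik]
      by (subst split[of k i]) (auto simp: R.scale_minus_left)
  qed
  have A: "j \<noteq> i" "j \<noteq> k" if "j \<in> A" for j using that by (auto simp: A_def)
  have t1: "comm (act i \<mu>) (\<Sum>j\<in>A. sc (r k j) (Om k j)) = 0"
  proof -
    have "comm (act i \<mu>) (Om k j) = 0" if "j \<in> A" for j
      using comm_Om_other[of i k j] comm_comm ik A[OF that] by metis
    then show ?thesis by (simp add: comm_sum_right R.comm_sc_right)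
  qed
  have t2: "comm (\<Sum>j\<in>A. sc (r i j) (Om i j)) (act k \<mu>) = 0"
  proof -
    have "comm (Om i j) (act k \<mu>) = 0" if "j \<in> A" for j
      using comm_Om_other[of k i j] ik A[OF that] by metis
    then show ?thesis by (simp add: comm_sum_left R.comm_sc_left)
  qed
  \<comment> \<open>\<open>Pk\<close> carries \<open>Om i k\<close> with the opposite sign, so this
    equality cancels the two surviving \<mu>-terms.\<close>
  have t3: "comm (act i \<mu>) (Om i k) = comm (Om i k) (act k \<mu>)"
    using comm_Om_act_flip[OF ik, of \<mu>] comm_antisym[of "act i \<mu>"] by simp
  define T where "T = (\<lambda>j. comm (Om i k) (Om k j))"
  have T1: "comm (Om i k) (\<Sum>j\<in>A. sc (r k j) (Om k j)) = (\<Sum>j\<in>A. sc (r k j) (T j))"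
    by (simp add: comm_sum_right R.comm_sc_right T_def)
  have T2: "comm (\<Sum>j\<in>A. sc (r i j) (Om i j)) (Om i k) = (\<Sum>j\<in>A. sc (r i j) (T j))"
  proof -
    have "comm (Om i j) (Om i k) = T j" if "j \<in> A" for j
      using comm_Om_triple[OF ik, of j] A[OF that] comm_antisym[of "Om i j"] by (simp add: T_def)
    then show ?thesis by (simp add: comm_sum_left R.comm_sc_left)
  qed
  have T3: "comm (\<Sum>j\<in>A. sc (r i j) (Om i j)) (\<Sum>l\<in>A. sc (r k l) (Om k l)) = (\<Sum>j\<in>A. - sc (r i j * r k j) (T j))"
  proof -
    have "comm (Om i j) (Om k l) = (if l = j then - T j else 0)" if "j \<in> A" "l \<in> A" for j l
    proof (cases "l = j")
      case True
      have "comm (Om i j) (Om j k) = - comm (Om i j) (Om i k)"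
        using comm_Om_triple[of i j k] A[OF that(1)] ik by auto
      moreover have "comm (Om i j) (Om i k) = T j"
        using comm_Om_triple[OF ik, of j] A[OF that(1)] comm_antisym[of "Om i j"] by (simp add: T_def)
      ultimately show ?thesis using True Om_sym[of j k] A[OF that(1)] by simp
    next
      case False
      then show ?thesis using comm_Om_disjoint[of k i j l] A that ik by auto
    qed
    then have "comm (\<Sum>j\<in>A. sc (r i j) (Om i j)) (\<Sum>l\<in>A. sc (r k l) (Om k l)) =
        (\<Sum>j\<in>A. \<Sum>l\<in>A. if l = j then - sc (r i j * r k j) (T j) else 0)"
      unfolding comm_sum_left unfolding comm_sum_right R.comm_sc_left R.comm_sc_right
      by (intro sum.cong refl) (auto simp: R.scale_minus_right)
    then show ?thesis by (simp add: A_def)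
  qed
  have frac: "r i k * r k j - r i j * r i k - r i j * r k j = 0" if "j \<in> A" for j
  proof -
    define p q where "p = z i - z k" and "q = z k - z j"
    have "z i \<noteq> z k" "z i \<noteq> z j" "z k \<noteq> z j" using z ik A[OF that] by metis+
    then have "p \<noteq> 0" "q \<noteq> 0" "p + q \<noteq> 0" by (auto simp: p_def q_def)
    then have "1 / p * (1 / q) - 1 / (p + q) * (1 / p) - 1 / (p + q) * (1 / q) = 0"
      by (simp add: divide_simps)
    then show ?thesis by (simp add: r_def p_def q_def)
  qed
  have "comm (kz z \<mu> i) (kz z \<mu> k) = (\<Sum>j\<in>A. sc (r i k * r k j) (T j)) - (\<Sum>j\<in>A. sc (r i j * r i k) (T j))
      - (\<Sum>j\<in>A. sc (r i j * r k j) (T j))"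
    unfolding Pi Pk using act_commute[OF ik] t1 t2 t3 T1 T2 T3
    by (simp add: comm_add_left comm_add_right comm_diff_right R.comm_sc_left R.comm_sc_right comm_self
        R.scale_right_distrib R.scale_sum_right sum_negf mult.commute flip: diff_conv_add_uminus)
  also have "\<dots> = (\<Sum>j\<in>A. sc (r i k * r k j - r i j * r i k - r i j * r k j) (T j))"
    by (simp add: R.scale_left_diff_distrib sum_subtractf)
  finally show ?thesis using frac by simp
qed

lemma comm_act_casimir:
  assumes "h \<in> H"
  shows "comm (act i h) (tot.casimir a) = (\<Sum>b\<in>I. sc (a b * w b h) (act i (x b) * tot.X (st b) - tot.X b * act i (x (st b))))"
proof -
  have "comm (act i h) (tot.X b) = sc (w b h) (act i (x b))" if "b \<in> I" for b
    using assms that by (simp add: tot.X_def comm_act_total weight act_scale)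
  then show ?thesis
    using assms by (simp add: tot.casimir_def comm_sum_right R.comm_sc_right comm_mult_right st_in w_st
        R.sc_mult_left R.sc_mult_right R.scale_minus_left R.scale_right_diff_distrib)
qed

lemma comm_act_cartan: "h \<in> H \<Longrightarrow> h' \<in> H \<Longrightarrow> comm (act i h) (act j h') = 0"
  by (cases "i = j") (simp_all add: act_commute act_bracket abelian_H act_zero)

lemma comm_act_total_cartan: "h \<in> H \<Longrightarrow> h' \<in> H \<Longrightarrow> comm (act i h) (total h') = 0"
  by (simp add: comm_act_total abelian_H act_zero)

text \<open>Two ingredients join \<open>comm_casimir_wq\<close>. The commutator of the
  \<open>z\<close>-linear part at \<open>\<mu>'\<close> with the Casimir element at
  \<open>\<mu>''\<close> has coefficients proportional to
  \<open>w b \<mu>' * w b \<mu>'' / w b \<mu>\<close>, symmetric in the two directions, so the cross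
  terms cancel (\<open>Zc\<close>). The Cartan corrections commute with everything present.\<close>

lemma comm_dyn_dyn:
  assumes "regular \<mu>" "\<mu>' \<in> H" "\<mu>'' \<in> H" "h \<in> H" "h' \<in> H"
  shows "comm (dyn z \<mu> \<mu>' h) (dyn z \<mu> \<mu>'' h') = 0"
proof -
  define Z where "Z = (\<lambda>y. \<Sum>i\<in>UNIV. sc (z i) (act i y))"
  have dyn: "dyn z \<mu> y y' = Z y + sc (1 / 2) (tot.casimir (wq \<mu> y) - total y')" for y y'
    by (simp add: dyn_def Z_def)
  have ZZ: "comm (Z \<mu>') (Z \<mu>'') = 0"
    using assms by (simp add: Z_def comm_sum_left comm_sum_right R.comm_sc_left R.comm_sc_right comm_act_cartan)
  have Zt: "comm (Z y) (total y') = 0" if "y \<in> H" "y' \<in> H" for y y'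
    using that by (simp add: Z_def comm_sum_left R.comm_sc_left comm_act_total_cartan)
  have tZ: "comm (total y') (Z y) = 0" if "y \<in> H" "y' \<in> H" for y y'
    using Zt[OF that] comm_comm by blast
  have Zc: "comm (Z \<mu>') (tot.casimir (wq \<mu> \<mu>'')) = comm (Z \<mu>'') (tot.casimir (wq \<mu> \<mu>'))"
    using assms by (simp add: Z_def comm_sum_left R.comm_sc_left comm_act_casimir wq_def mult.commute)
  have cZ: "comm (tot.casimir (wq \<mu> \<mu>')) (Z \<mu>'') = - comm (Z \<mu>') (tot.casimir (wq \<mu> \<mu>''))"
    unfolding Zc by (rule comm_antisym)
  have ct: "comm (tot.casimir a) (total y) = 0" if "y \<in> H" for a y
    using tot.comm_cartan_casimir[OF that] comm_comm by blast
  show ?thesis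
    unfolding dyn
    using assms by (simp add: comm_add_left comm_add_right comm_diff_left comm_diff_right R.comm_sc_left R.comm_sc_right
        ZZ Zt tZ cZ ct tot.comm_cartan_casimir tot.comm_cartan_cartan tot.comm_casimir_wq)
qed

text \<open>Acting with \<mu> itself cancels the denominators of \<open>wq\<close>. The diagonal
  part \<open>P i\<close> is odd under \<open>st\<close> and vanishes; off the diagonal the two
  orders of the commuting factors agree, whence the factor 2.\<close>

lemma comm_act_casimir_wq:
  assumes "regular \<mu>" "\<mu>' \<in> H"
  shows "comm (act i \<mu>) (tot.casimir (wq \<mu> \<mu>')) =
    sc 2 (\<Sum>j\<in>UNIV - {i}. \<Sum>b\<in>I. sc (w b \<mu>') (act i (x b) * act j (x (st b))))"
proof -
  have \<mu>: "\<mu> \<in> H" using assms by (simp add: regular_def)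
  have w: "wq \<mu> \<mu>' b * w b \<mu> = w b \<mu>'" if "b \<in> I" for b
    using assms that by (auto simp: wq_def regular_def)
  define P where "P = (\<lambda>j. \<Sum>b\<in>I. sc (w b \<mu>') (act i (x b) * act j (x (st b)) + act j (x (st b)) * act i (x b)))"
  have "comm (act i \<mu>) (tot.casimir (wq \<mu> \<mu>')) =
      (\<Sum>b\<in>I. sc (w b \<mu>') (act i (x b) * tot.X (st b))) - (\<Sum>b\<in>I. sc (w b \<mu>') (tot.X b * act i (x (st b))))"
    unfolding comm_act_casimir[OF \<mu>] using w by (simp add: R.scale_right_diff_distrib sum_subtractf)
  also have "(\<Sum>b\<in>I. sc (w b \<mu>') (tot.X b * act i (x (st b)))) =
      (\<Sum>b\<in>I. sc (w (st b) \<mu>') (tot.X (st b) * act i (x (st (st b)))))"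
    by (rule st_reindex[symmetric])
  also have "\<dots> = - (\<Sum>b\<in>I. sc (w b \<mu>') (tot.X (st b) * act i (x b)))"
    using assms by (simp add: st_st w_st R.scale_minus_left sum_negf)
  also have "(\<Sum>b\<in>I. sc (w b \<mu>') (act i (x b) * tot.X (st b))) - - (\<Sum>b\<in>I. sc (w b \<mu>') (tot.X (st b) * act i (x b)))
      = (\<Sum>b\<in>I. sc (w b \<mu>') (act i (x b) * tot.X (st b) + tot.X (st b) * act i (x b)))"
    by (simp add: R.scale_right_distrib sum.distrib)
  also have "\<dots> = (\<Sum>j\<in>UNIV. P j)"
    unfolding P_def by (subst sum.swap)
      (simp add: tot.X_def total_def sum_distrib_left sum_distrib_right R.scale_sum_right R.scale_right_distrib sum.distrib)
  also have "\<dots> = P i + (\<Sum>j\<in>UNIV - {i}. P j)"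
    by (simp add: sum.remove)
  also have "P i = 0"
  proof -
    have "P i = (\<Sum>b\<in>I. sc (w (st b) \<mu>') (act i (x (st b)) * act i (x (st (st b))) + act i (x (st (st b))) * act i (x (st b))))"
      unfolding P_def by (rule st_reindex[symmetric])
    also have "\<dots> = - P i"
      unfolding P_def using assms by (simp add: st_st w_st R.scale_minus_left sum_negf add.commute)
    finally have "sc 2 (P i) = 0"
      using R.scale_left_distrib[of 1 1 "P i"] by (metis R.scale_one add.right_inverse one_add_one)
    then show ?thesis by simp
  qed
  also have "0 + (\<Sum>j\<in>UNIV - {i}. P j) =
      (\<Sum>j\<in>UNIV - {i}. sc 2 (\<Sum>b\<in>I. sc (w b \<mu>') (act i (x b) * act j (x (st b)))))"
    unfolding add_0_left
  proof (intro sum.cong refl)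
    fix j assume "j \<in> UNIV - {i}"
    then have "act j y' * act i y = act i y * act j y'" for y y'
      using act_commute[of i j y y'] by (auto simp: comm_eq_0_iff)
    then have "P j = (\<Sum>b\<in>I. sc (w b \<mu>') (sc 2 (act i (x b) * act j (x (st b)))))"
      unfolding P_def using R.scale_left_distrib[of 1 1] by simp
    then show "P j = sc 2 (\<Sum>b\<in>I. sc (w b \<mu>') (act i (x b) * act j (x (st b))))"
      by (simp add: R.scale_sum_right mult.commute)
  qed
  finally show ?thesis by (simp add: R.scale_sum_right)
qed

lemma comm_Om_act:
  assumes "i \<noteq> j" "h \<in> H"
  shows "comm (Om i j) (act i h) = - (\<Sum>b\<in>I. sc (w b h) (act i (x b) * act j (x (st b))))"
proof -
  have "comm (act i (x b)) (act i h) = - sc (w b h) (act i (x b))" if "b \<in> I" for b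
    using comm_antisym[of "act i (x b)" "act i h"] assms that by (simp add: act_bracket weight act_scale)
  then show ?thesis
    using assms by (simp add: Om_def comm_sum_left comm_mult_left act_commute R.sc_mult_left sum_negf)
qed

text \<open>Flipping the action from factor \<open>j\<close> to factor \<open>i\<close> produces
  \<open>z i - z j\<close>, which cancels the pole next to \<open>Om i j\<close>. The \<mu>'-terms
  that remain are exactly opposite to those of \<open>comm_act_casimir_wq\<close>, whose 2 meets the
  1/2 in \<open>dyn\<close>.\<close>

lemma comm_kz_dyn:
  assumes z: "\<And>i j. i \<noteq> j \<Longrightarrow> z i \<noteq> z j"
    and \<mu>: "regular \<mu>" "\<mu>' \<in> H" "h \<in> H"
  shows "comm (kz z \<mu> i) (dyn z \<mu> \<mu>' h) = 0"
proof -
  define Z where "Z = (\<Sum>k\<in>UNIV. sc (z k) (act k \<mu>'))"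
  have \<mu>H: "\<mu> \<in> H" using \<mu> by (simp add: regular_def)
  have 1: "comm (act i \<mu>) Z = 0"
    using \<mu> \<mu>H by (simp add: Z_def comm_sum_right R.comm_sc_right comm_act_cartan)
  have 2: "sc (1 / (z i - z j)) (comm (Om i j) Z) = comm (Om i j) (act i \<mu>')" if ij: "i \<noteq> j" for j
  proof -
    have "comm (Om i j) Z = (\<Sum>k\<in>UNIV. sc (z k) (comm (Om i j) (act k \<mu>')))"
      by (simp add: Z_def comm_sum_right R.comm_sc_right)
    also have "\<dots> = (\<Sum>k\<in>{i, j}. sc (z k) (comm (Om i j) (act k \<mu>')))"
      by (rule sum.mono_neutral_right) (auto simp: comm_Om_other)
    also have "\<dots> = sc (z i - z j) (comm (Om i j) (act i \<mu>'))"
      using ij by (simp add: comm_Om_act_flip R.scale_left_diff_distrib)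
    finally show ?thesis using z[OF ij] by simp
  qed
  have "comm (kz z \<mu> i) (dyn z \<mu> \<mu>' h) = (\<Sum>j\<in>UNIV - {i}. comm (Om i j) (act i \<mu>'))
      + sc (1 / 2) (comm (act i \<mu>) (tot.casimir (wq \<mu> \<mu>')))"
  proof -
    have "comm (\<Sum>j\<in>UNIV - {i}. sc (1 / (z i - z j)) (Om i j)) Z = (\<Sum>j\<in>UNIV - {i}. comm (Om i j) (act i \<mu>'))"
      unfolding comm_sum_left R.comm_sc_left by (intro sum.cong refl 2) auto
    then show ?thesis
      unfolding kz_def dyn_def Z_def[symmetric]
      using \<mu> \<mu>H 1
      by (simp add: comm_add_left comm_add_right comm_diff_right R.comm_sc_right comm_act_total_cartan)
        (simp add: comm_sum_left R.comm_sc_left comm_Om_casimir comm_Om_total)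
  qed
  also have "\<dots> = 0"
    using \<mu> by (simp add: comm_act_casimir_wq comm_Om_act sum_negf)
  finally show ?thesis .
qed

end

section \<open>Root decompositions\<close>

abbreviation root_index :: "('g \<Rightarrow> complex) set \<Rightarrow> ('r::finite + ('g \<Rightarrow> complex)) set"
  where "root_index \<Delta> \<equiv> UNIV <+> \<Delta>"

abbreviation root_basis :: "('r::finite \<Rightarrow> 'g) \<Rightarrow> (('g \<Rightarrow> complex) \<Rightarrow> 'g) \<Rightarrow> 'r + ('g \<Rightarrow> complex) \<Rightarrow> 'g"
  where "root_basis hs e \<equiv> case_sum hs e"

text \<open>An orthonormal basis is dual to itself, and \<open>e (- \<alpha>)\<close> is dual to
  \<open>e \<alpha>\<close> by the normalization.\<close>

abbreviation root_dual :: "'r::finite + ('g \<Rightarrow> complex) \<Rightarrow> 'r + ('g \<Rightarrow> complex)"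
  where "root_dual \<equiv> map_sum id uminus"

abbreviation root_weight :: "'r::finite + ('g \<Rightarrow> complex) \<Rightarrow> 'g \<Rightarrow> complex"
  where "root_weight \<equiv> case_sum (\<lambda>_. 0) (\<lambda>\<alpha>. \<alpha>)"

context metric_lie_algebra
begin

lemma span_orthonormal:
  fixes hs :: "'r::finite \<Rightarrow> 'g"
  assumes "orthonormal_basis sg form H hs" "h \<in> H"
  shows "h = (\<Sum>s\<in>UNIV. sg (form h (hs s)) (hs s))"
proof -
  have "h \<in> span (range hs)" using assms by (simp add: orthonormal_basis_def)
  then show ?thesis
  proof (induction rule: span_induct_alt)
    case base
    show ?case by (simp add: form_zero)
  next
    case (step c v y)
    then obtain t where v: "v = hs t" by blast
    have "(\<Sum>s\<in>UNIV. sg (form v (hs s)) (hs s)) = (\<Sum>s\<in>UNIV. if s = t then hs s else 0)"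
      using assms(1) by (intro sum.cong) (auto simp: orthonormal_basis_def v)
    then have "v = (\<Sum>s\<in>UNIV. sg (form v (hs s)) (hs s))" by (simp add: v)
    then have "sg c v + y = sg c (\<Sum>s\<in>UNIV. sg (form v (hs s)) (hs s)) + (\<Sum>s\<in>UNIV. sg (form y (hs s)) (hs s))"
      using step by simp
    also have "\<dots> = (\<Sum>s\<in>UNIV. sg (form (sg c v + y) (hs s)) (hs s))"
      by (simp add: form_add_left form_scale_left scale_left_distrib sum.distrib scale_sum_right)
    finally show ?case .
  qed
qed

section \<open>Consequences of the root decomposition\<close>

context
  fixes H :: "'g set" and e :: "('g \<Rightarrow> complex) \<Rightarrow> 'g" and \<Delta> :: "('g \<Rightarrow> complex) set"
  assumes dec: "root_decomposition sg br H e" and \<Delta>: "\<Delta> = roots sg br H"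
begin

lemma root_decomposition_facts:
  shows finite_roots: "finite \<Delta>"
    and subspace_cartan: "subspace H"
    and abelian_cartan: "h \<in> H \<Longrightarrow> h' \<in> H \<Longrightarrow> br h h' = 0"
    and root_vector: "\<alpha> \<in> \<Delta> \<Longrightarrow> h \<in> H \<Longrightarrow> br h (e \<alpha>) = sg (\<alpha> h) (e \<alpha>)"
    and root_vector_nonzero: "\<alpha> \<in> \<Delta> \<Longrightarrow> e \<alpha> \<noteq> 0"
    and root_outside: "\<alpha> \<in> \<Delta> \<Longrightarrow> h \<notin> H \<Longrightarrow> \<alpha> h = 0"
    and root_linear: "\<alpha> \<in> \<Delta> \<Longrightarrow> linear_on sg (*) H \<alpha>"
    and root_decompose: "\<exists>h\<in>H. \<exists>c. y = h + (\<Sum>\<alpha>\<in>\<Delta>. sg (c \<alpha>) (e \<alpha>))"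
    and root_nonzero: "\<alpha> \<in> \<Delta> \<Longrightarrow> \<alpha> \<noteq> 0"
  using dec unfolding root_decomposition_def \<Delta> by (auto simp: roots_def dual_def root_space_def)

lemma root_witness:
  assumes "\<alpha> \<in> \<Delta>" obtains h where "h \<in> H" "\<alpha> h \<noteq> 0"
  using root_nonzero[OF assms] root_outside[OF assms] by (auto simp: fun_eq_iff)

lemma form_weights:
  assumes "h \<in> H" "br h y = sg p y" "br h z = sg q z" "p + q \<noteq> 0"
  shows "form y z = 0"
proof -
  have "p * form y z = form (br h y) z" by (simp add: assms form_scale_left)
  also have "\<dots> = - form (br y h) z" by (subst br_antisym) (rule form_minus)
  also have "\<dots> = - q * form y z" by (simp add: form_inv assms form_scale_right)
  finally have "(p + q) * form y z = 0" by (simp add: distrib_right)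
  then show ?thesis using assms(4) by simp
qed

lemma form_root_cartan:
  assumes "\<alpha> \<in> \<Delta>" "h \<in> H"
  shows "form (e \<alpha>) h = 0"
proof -
  obtain h' where h': "h' \<in> H" "\<alpha> h' \<noteq> 0" using root_witness[OF assms(1)] .
  show ?thesis
    by (rule form_weights[OF h'(1) root_vector[OF assms(1) h'(1)], of _ 0])
      (use assms h' in \<open>simp_all add: abelian_cartan\<close>)
qed

lemma form_roots:
  assumes "\<alpha> \<in> \<Delta>" "\<beta> \<in> \<Delta>" "\<beta> \<noteq> - \<alpha>"
  shows "form (e \<alpha>) (e \<beta>) = 0"
proof -
  obtain h where h: "\<beta> h \<noteq> - \<alpha> h" using assms(3) by (auto simp: fun_eq_iff)
  then have "h \<in> H" using root_outside[OF assms(1)] root_outside[OF assms(2)] by force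
  then show ?thesis
    using assms h by (intro form_weights[OF _ root_vector root_vector])
      (auto simp: add_eq_0_iff)
qed

text \<open>Otherwise \<open>e \<alpha>\<close> would be orthogonal to \<open>H\<close> and to all
  root vectors, against non-degeneracy.\<close>

lemma neg_root:
  assumes "\<alpha> \<in> \<Delta>"
  shows "- \<alpha> \<in> \<Delta>"
proof (rule ccontr)
  assume "- \<alpha> \<notin> \<Delta>"
  then have 0: "form (e \<alpha>) (e \<beta>) = 0" if "\<beta> \<in> \<Delta>" for \<beta>
    using form_roots[OF assms that] that by blast
  have "form (e \<alpha>) y = 0" for y
  proof -
    obtain h c where "h \<in> H" "y = h + (\<Sum>\<beta>\<in>\<Delta>. sg (c \<beta>) (e \<beta>))" using root_decompose by blast
    then show ?thesis using assms 0
      by (simp add: form_add_right form_sum_right form_scale_right form_root_cartan)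
  qed
  then show False using form_nondeg root_vector_nonzero[OF assms] by blast
qed

lemma root_expansion:
  fixes hs :: "'r::finite \<Rightarrow> 'g"
  assumes norm: "\<And>\<alpha>. \<alpha> \<in> \<Delta> \<Longrightarrow> form (e \<alpha>) (e (- \<alpha>)) = 1"
    and onb: "orthonormal_basis sg form H hs"
  shows "y = (\<Sum>s\<in>UNIV. sg (form y (hs s)) (hs s)) + (\<Sum>\<alpha>\<in>\<Delta>. sg (form y (e (- \<alpha>))) (e \<alpha>))"
proof -
  obtain h c where h: "h \<in> H" and y: "y = h + (\<Sum>\<alpha>\<in>\<Delta>. sg (c \<alpha>) (e \<alpha>))" using root_decompose by blast
  have hs: "hs s \<in> H" for s
    using onb by (auto simp: orthonormal_basis_def intro: span_base)
  have 1: "form y (hs s) = form h (hs s)" for s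
    by (simp add: y form_add_left form_sum_left form_scale_left form_root_cartan hs)
  have 2: "form y (e (- \<beta>)) = c \<beta>" if \<beta>: "\<beta> \<in> \<Delta>" for \<beta>
  proof -
    have "form h (e (- \<beta>)) = 0"
      using form_root_cartan[OF neg_root[OF \<beta>] h] by (simp add: form_sym)
    moreover have "(\<Sum>\<alpha>\<in>\<Delta>. c \<alpha> * form (e \<alpha>) (e (- \<beta>))) = (\<Sum>\<alpha>\<in>\<Delta>. if \<alpha> = \<beta> then c \<alpha> else 0)"
      using \<beta> neg_root[OF \<beta>] by (intro sum.cong refl) (auto simp: norm form_roots)
    ultimately show ?thesis
      using \<beta> finite_roots by (simp add: y form_add_left form_sum_left form_scale_left)
  qed
  show ?thesis
    unfolding 1 span_orthonormal[OF onb h, symmetric] using 2 y by simp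
qed

lemma root_graded:
  fixes hs :: "'r::finite \<Rightarrow> 'g"
  assumes norm: "\<And>\<alpha>. \<alpha> \<in> \<Delta> \<Longrightarrow> form (e \<alpha>) (e (- \<alpha>)) = 1"
    and onb: "orthonormal_basis sg form H hs"
  shows "graded_lie_algebra sg br form H (root_index \<Delta>) (root_basis hs e) root_dual root_weight"
proof
  have hs: "hs s \<in> H" for s
    using onb by (auto simp: orthonormal_basis_def intro: span_base)
  show "subspace H" by (rule subspace_cartan)
  show "br h h' = 0" if "h \<in> H" "h' \<in> H" for h h' using that by (rule abelian_cartan)
  show "finite (root_index \<Delta>)" using finite_roots by simp
  show "root_dual a \<in> root_index \<Delta>" if "a \<in> root_index \<Delta>" for a :: "'r + ('g \<Rightarrow> complex)"
    using that neg_root by auto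
  show "root_dual (root_dual a) = a" if "a \<in> root_index \<Delta>" for a :: "'r + ('g \<Rightarrow> complex)"
    by (cases a) auto
  show "y = (\<Sum>a\<in>root_index \<Delta>. sg (form y (root_basis hs e (root_dual a))) (root_basis hs e a))" for y
    using root_expansion[OF norm onb, of y] finite_roots by (simp add: sum.Plus)
  show "br h (root_basis hs e a) = sg (root_weight a h) (root_basis hs e a)"
    if "h \<in> H" "a \<in> root_index \<Delta>" for h a
    using that hs by (auto simp: abelian_cartan root_vector)
  show "root_weight (root_dual a) h = - root_weight a h" if "a \<in> root_index \<Delta>" for a :: "'r + ('g \<Rightarrow> complex)" and h
    by (cases a) auto
  show "root_basis hs e a \<in> H"
    if "a \<in> root_index \<Delta>" "\<And>h. h \<in> H \<Longrightarrow> root_weight a h = 0" for a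
    using that hs by (auto elim: root_witness)
qed

end

end

text \<open>The roots are the disjoint union of the positive ones and their negatives. They are
  disjoint because the natural coefficients of \<alpha> and -\<alpha> would add up to zero over the
  independent set \<open>S\<close>.\<close>

lemma sum_positive_roots:
  fixes f :: "('g \<Rightarrow> complex) \<Rightarrow> 'a::ab_group_add"
  assumes simple: "simple_root_system \<Delta> S" and fin: "finite \<Delta>" and nz: "0 \<notin> \<Delta>"
    and neg: "\<And>\<alpha>. \<alpha> \<in> \<Delta> \<Longrightarrow> - \<alpha> \<in> \<Delta>"
  shows "(\<Sum>\<alpha>\<in>\<Delta>. f \<alpha>) = (\<Sum>\<alpha>\<in>positive_roots \<Delta> S. f \<alpha> + f (- \<alpha>))"
proof -
  let ?P = "positive_roots \<Delta> S"
  have S: "finite S" "fsc.independent S"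
    using simple fin by (auto simp: simple_root_system_def intro: finite_subset)
  have P: "?P \<subseteq> \<Delta>" by (auto simp: positive_roots_def)
  have disj: "- \<alpha> \<notin> ?P" if "\<alpha> \<in> ?P" for \<alpha>
  proof
    assume "- \<alpha> \<in> ?P"
    then obtain c d :: "('g \<Rightarrow> complex) \<Rightarrow> nat" where
      c: "\<alpha> = (\<Sum>\<beta>\<in>S. fscale (of_nat (c \<beta>)) \<beta>)" and d: "- \<alpha> = (\<Sum>\<beta>\<in>S. fscale (of_nat (d \<beta>)) \<beta>)"
      using \<open>\<alpha> \<in> ?P\<close> by (auto simp: positive_roots_def)
    have "(\<Sum>\<beta>\<in>S. fscale (of_nat (c \<beta>) + of_nat (d \<beta>)) \<beta>) = \<alpha> + - \<alpha>"
      unfolding d unfolding fsc.scale_left_distrib sum.distrib by (simp only: c[symmetric])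
    then have "of_nat (c \<beta>) + of_nat (d \<beta>) = (0 :: complex)" if "\<beta> \<in> S" for \<beta>
      using fsc.independentD[OF S(2) S(1) order_refl _ that] by simp
    then have "c \<beta> = 0" if "\<beta> \<in> S" for \<beta>
      using that by (metis add_is_0 of_nat_0 of_nat_add of_nat_eq_iff)
    then have "\<alpha> = 0" unfolding c by (simp add: fsc.scale_zero_left)
    then show False using \<open>\<alpha> \<in> ?P\<close> P nz by auto
  qed
  have "\<Delta> = ?P \<union> uminus ` ?P"
  proof (intro equalityI subsetI)
    fix \<alpha> assume "\<alpha> \<in> \<Delta>"
    then have "\<alpha> \<in> ?P \<or> - \<alpha> \<in> ?P" using simple by (auto simp: simple_root_system_def)
    then show "\<alpha> \<in> ?P \<union> uminus ` ?P" by (metis UnI1 UnI2 add.inverse_inverse imageI)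
  qed (use P neg in auto)
  then have "(\<Sum>\<alpha>\<in>\<Delta>. f \<alpha>) = (\<Sum>\<alpha>\<in>?P \<union> uminus ` ?P. f \<alpha>)" by simp
  also have "\<dots> = (\<Sum>\<alpha>\<in>?P. f \<alpha>) + (\<Sum>\<alpha>\<in>uminus ` ?P. f \<alpha>)"
    by (rule sum.union_disjoint) (use finite_subset[OF P fin] disj in auto)
  also have "(\<Sum>\<alpha>\<in>uminus ` ?P. f \<alpha>) = (\<Sum>\<alpha>\<in>?P. f (- \<alpha>))"
    by (subst sum.reindex) (auto simp: inj_on_def)
  finally show ?thesis by (simp add: sum.distrib)
qed

section \<open>Mixed partial derivatives\<close>

text \<open>The constant is the Cauchy bound for the second derivative on discs of radius r/2
  centred in \<open>ball 0 r\<close>. It depends on \<open>f\<close> only through \<open>B\<close>,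
  which makes the estimate uniform over a bounded family.\<close>

lemma second_order_Taylor_bound:
  assumes hol: "f holomorphic_on ball 0 (2 * r)" and r: "0 < r"
    and B: "\<And>z. z \<in> ball 0 (2 * r) \<Longrightarrow> cmod (f z) \<le> B" and z: "cmod z < r"
  shows "cmod (f z - f 0 - z * deriv f 0) \<le> 2 * B / (r / 2) ^ 2 * cmod z ^ 2"
proof -
  have "cmod ((deriv ^^ 0) f z - (\<Sum>i\<le>1. (deriv ^^ i) f 0 * (z - 0) ^ i / fact i))
      \<le> 2 * B / (r / 2) ^ 2 * cmod (z - 0) ^ Suc 1 / fact 1"
  proof (rule complex_Taylor[of "ball 0 r"])
    fix i w assume w: "w \<in> ball (0 :: complex) r"
    then have "w \<in> ball 0 (2 * r)" using r by simp
    then show "((deriv ^^ i) f has_field_derivative (deriv ^^ Suc i) f w) (at w within ball 0 r)"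
      using holomorphic_higher_deriv[OF hol, of i]
      by (auto intro: holomorphic_derivI[of _ "ball 0 (2 * r)"] has_field_derivative_at_within)
  next
    fix w assume w: "w \<in> ball (0 :: complex) r"
    have sub: "cball w (r / 2) \<subseteq> ball 0 (2 * r)"
    proof
      fix v assume "v \<in> cball w (r / 2)"
      then have "cmod (v - w) \<le> r / 2" "cmod w < r" using w by (auto simp: dist_norm norm_minus_commute)
      then show "v \<in> ball 0 (2 * r)" using norm_triangle_ineq[of "v - w" w] r by simp
    qed
    have "cmod ((deriv ^^ 2) f w) \<le> fact 2 * B / (r / 2) ^ 2"
    proof (rule Cauchy_inequality)
      show "f holomorphic_on ball w (r / 2)"
        using hol sub ball_subset_cball by (metis holomorphic_on_subset order_trans)
      show "continuous_on (cball w (r / 2)) f"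
        using hol sub holomorphic_on_imp_continuous_on continuous_on_subset by blast
      show "cmod (f v) \<le> B" if "cmod (w - v) = r / 2" for v
        using B sub that by (auto simp: dist_norm subset_iff)
    qed (use r in simp)
    then show "cmod ((deriv ^^ Suc 1) f w) \<le> 2 * B / (r / 2) ^ 2" by (simp add: numeral_2_eq_2 fact_numeral)
  qed (use z r in auto)
  then show ?thesis by (simp add: power2_eq_square algebra_simps)
qed

text \<open>The difference quotients of \<open>g s\<close> at \<open>0\<close> converge to its derivative locally uniformly in
  \<open>s\<close>, so by Weierstrass their derivatives in \<open>s\<close> converge as well.\<close>

lemma mixed_partials:
  fixes g :: "complex \<Rightarrow> complex \<Rightarrow> complex"
  assumes r: "0 < r"
    and B: "\<And>s t. s \<in> ball 0 (2 * r) \<Longrightarrow> t \<in> ball 0 (2 * r) \<Longrightarrow> cmod (g s t) \<le> B"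
    and hol1: "\<And>t. t \<in> ball 0 (2 * r) \<Longrightarrow> (\<lambda>s. g s t) holomorphic_on ball 0 (2 * r)"
    and hol2: "\<And>s. s \<in> ball 0 (2 * r) \<Longrightarrow> g s holomorphic_on ball 0 (2 * r)"
  obtains L where "((\<lambda>t. deriv (\<lambda>s. g s t) 0) has_field_derivative L) (at 0)"
    "((\<lambda>s. deriv (g s) 0) has_field_derivative L) (at 0)"
proof -
  define q where "q = (\<lambda>h s. (g s h - g s 0) / h)"
  define C where "C = 2 * B / (r / 2) ^ 2"
  have sub: "cball 0 r \<subseteq> ball (0 :: complex) (2 * r)" using r by auto
  have "0 \<le> B" using B[of 0 0] r order_trans[OF norm_ge_zero] by simp
  then have C: "C \<ge> 0" by (simp add: C_def)
  have near: "\<forall>\<^sub>F h in at 0. h \<in> ball 0 r \<and> h \<noteq> (0 :: complex)"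
    using r by (auto simp: eventually_at intro!: exI[of _ r])
  have q_hol: "q h holomorphic_on ball 0 (2 * r)" if "h \<in> ball 0 r" "h \<noteq> 0" for h
    using that r unfolding q_def by (intro holomorphic_intros hol1) auto
  have cont: "\<forall>\<^sub>F h in at 0. continuous_on (cball 0 r) (q h) \<and>
      (\<forall>w\<in>ball 0 r. (q h has_field_derivative deriv (q h) w) (at w))"
    using near
  proof (eventually_elim, intro conjI ballI)
    fix h :: complex assume h: "h \<in> ball 0 r \<and> h \<noteq> 0"
    show "continuous_on (cball 0 r) (q h)"
      using q_hol h sub holomorphic_on_imp_continuous_on continuous_on_subset by blast
    show "(q h has_field_derivative deriv (q h) w) (at w)" if "w \<in> ball 0 r" for w
      using q_hol[of h] h that r by (intro holomorphic_derivI[of _ "ball 0 (2 * r)"]) auto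
  qed
  have ulim: "uniform_limit (cball 0 r) q (\<lambda>s. deriv (g s) 0) (at 0)"
  proof (rule uniform_limitI)
    fix \<epsilon> :: real assume \<epsilon>: "0 < \<epsilon>"
    \<comment> \<open>\<open>C\<close> may be zero, hence the denominator
      \<open>C + 1\<close>.\<close>
    have "\<forall>\<^sub>F h in at (0 :: complex). h \<in> ball 0 (\<epsilon> / (C + 1))"
      using \<epsilon> C by (auto simp: eventually_at intro!: exI[of _ "\<epsilon> / (C + 1)"])
    with near show "\<forall>\<^sub>F h in at 0. \<forall>s\<in>cball 0 r. dist (q h s) (deriv (g s) 0) < \<epsilon>"
    proof (eventually_elim, intro ballI)
      fix h s :: complex
      assume h: "h \<in> ball 0 r \<and> h \<noteq> 0" "h \<in> ball 0 (\<epsilon> / (C + 1))" and s: "s \<in> cball 0 r"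
      then have s': "s \<in> ball 0 (2 * r)" using sub by blast
      have "cmod (g s h - g s 0 - h * deriv (g s) 0) \<le> C * cmod h ^ 2"
        unfolding C_def by (rule second_order_Taylor_bound[OF hol2[OF s'] r B[OF s']]) (use h in auto)
      moreover have "g s h - g s 0 - h * deriv (g s) 0 = (q h s - deriv (g s) 0) * h"
      proof -
        have "q h s * h = g s h - g s 0" using h by (simp add: q_def)
        then show ?thesis by (simp add: algebra_simps)
      qed
      ultimately have "cmod (q h s - deriv (g s) 0) \<le> C * cmod h"
        using h by (simp add: norm_mult power2_eq_square mult.assoc[symmetric])
      also have "\<dots> \<le> (C + 1) * cmod h" by (simp add: mult_right_mono)
      also have "\<dots> < \<epsilon>" using h C by (simp add: pos_less_divide_eq mult.commute)
      finally show "dist (q h s) (deriv (g s) 0) < \<epsilon>" by (simp add: dist_norm)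
    qed
  qed
  obtain g' where g': "\<And>w. w \<in> ball 0 r \<Longrightarrow>
      ((\<lambda>s. deriv (g s) 0) has_field_derivative g' w) (at w) \<and> ((\<lambda>h. deriv (q h) w) \<longlongrightarrow> g' w) (at 0)"
    using has_complex_derivative_uniform_limit[OF cont ulim _ r] by (metis trivial_limit_at)
  \<comment> \<open>Differentiating \<open>q h\<close> in \<open>s\<close> gives the difference
    quotient of the other first partial derivative, so the Weierstrass limit is both mixed
    derivatives at once.\<close>
  have "((\<lambda>h. (deriv (\<lambda>s. g s h) 0 - deriv (\<lambda>s. g s 0) 0) / h) \<longlongrightarrow> g' 0) (at 0)"
  proof (rule Lim_transform_eventually)
    show "((\<lambda>h. deriv (q h) 0) \<longlongrightarrow> g' 0) (at 0)" using g' r by simp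
    show "\<forall>\<^sub>F h in at 0. deriv (q h) 0 = (deriv (\<lambda>s. g s h) 0 - deriv (\<lambda>s. g s 0) 0) / h"
      using near
    proof eventually_elim
      fix h :: complex assume h: "h \<in> ball 0 r \<and> h \<noteq> 0"
      have "((\<lambda>s. g s t) has_field_derivative deriv (\<lambda>s. g s t) 0) (at 0)" if "t \<in> ball 0 (2 * r)" for t
        using hol1[OF that] r by (intro holomorphic_derivI[of _ "ball 0 (2 * r)"]) auto
      then show "deriv (q h) 0 = (deriv (\<lambda>s. g s h) 0 - deriv (\<lambda>s. g s 0) 0) / h"
        unfolding q_def using h r by (intro DERIV_imp_deriv DERIV_cdivide DERIV_diff) auto
    qed
  qed
  then have "((\<lambda>t. deriv (\<lambda>s. g s t) 0) has_field_derivative g' 0) (at 0)"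
    by (simp add: has_field_derivative_iff)
  then show ?thesis using g'[of 0] r that by simp
qed

section \<open>Operators on the tensor product\<close>

text \<open>Packaging the operators on the whole ambient function space as a type puts them into the
  class \<open>ring\<close>, so that the locales above apply to them.\<close>

typedef 'b fop = "{L :: ('b \<Rightarrow> complex) \<Rightarrow> ('b \<Rightarrow> complex). linear_on fscale fscale UNIV L}"
  morphisms app Fop
  by (rule exI[of _ "\<lambda>F. F"]) (simp add: linear_on_def)

setup_lifting type_definition_fop

instantiation fop :: (type) ring
begin

lift_definition zero_fop :: "'a fop" is "\<lambda>F. 0"
  by (simp add: linear_on_def fscale_def fun_eq_iff)

lift_definition plus_fop :: "'a fop \<Rightarrow> 'a fop \<Rightarrow> 'a fop" is "\<lambda>A B F. A F + B F"
  by (simp add: linear_on_def fsc.scale_right_distrib algebra_simps)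

lift_definition minus_fop :: "'a fop \<Rightarrow> 'a fop \<Rightarrow> 'a fop" is "\<lambda>A B F. A F - B F"
  by (simp add: linear_on_def fsc.scale_right_diff_distrib algebra_simps)

lift_definition uminus_fop :: "'a fop \<Rightarrow> 'a fop" is "\<lambda>A F. - A F"
  by (simp add: linear_on_def)

lift_definition times_fop :: "'a fop \<Rightarrow> 'a fop \<Rightarrow> 'a fop" is "\<lambda>A B F. A (B F)"
  by (simp add: linear_on_def)

instance
  by standard (transfer; simp add: linear_on_def fun_eq_iff)+

end

lift_definition sc_fop :: "complex \<Rightarrow> 'a fop \<Rightarrow> 'a fop" is "\<lambda>c A F. fscale c (A F)"
  by (simp add: linear_on_def fsc.scale_right_distrib fsc.scale_scale mult.commute)

lemma complex_ring_sc_fop: "complex_ring sc_fop"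
  by unfold_locales (transfer; simp add: linear_on_def fun_eq_iff fscale_def algebra_simps)+

lemma app_zero: "app 0 F = 0"
  and app_plus: "app (A + B) F = app A F + app B F"
  and app_times: "app (A * B) F = app A (app B F)"
  and app_sc: "app (sc_fop c A) F = fscale c (app A F)"
  by (transfer; simp)+

lemma app_sum: "app (\<Sum>i\<in>I. A i) F = (\<Sum>i\<in>I. app (A i) F)"
  by (induction I rule: infinite_finite_induct) (simp_all add: app_zero app_plus)

lemma app_eqI: "(\<And>F. app A F = app B F) \<Longrightarrow> A = B"
  by transfer (simp add: fun_eq_iff)

lemma app_add_right: "app A (F + F') = app A F + app A F'"
  and app_scale_right: "app A (fscale c F) = fscale c (app A F)"
  by (transfer; simp add: linear_on_def)+

lemma app_zero_right: "app A 0 = 0"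
  using app_add_right[of A 0 0] by simp

context
  fixes sv :: "complex \<Rightarrow> 'v::ab_group_add \<Rightarrow> 'v" and V :: "'n::finite \<Rightarrow> 'v set"
begin

lemma pure_tensor_in: "v \<in> Pi UNIV V \<Longrightarrow> pure_tensor sv V v \<in> tensor_space sv V"
  unfolding tensor_space_def by (intro fsc.span_base imageI)

lemma tensor_subspace: "fsc.subspace (tensor_space sv V)"
  unfolding tensor_space_def by (rule fsc.subspace_span)

lemma tensor_induct [consumes 1, case_names pure zero add scale]:
  assumes "F \<in> tensor_space sv V"
    and "\<And>v. v \<in> Pi UNIV V \<Longrightarrow> Q (pure_tensor sv V v)" and "Q 0"
    and "\<And>F F'. Q F \<Longrightarrow> Q F' \<Longrightarrow> Q (F + F')" and "\<And>c F. Q F \<Longrightarrow> Q (fscale c F)"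
  shows "Q F"
  using assms(1) unfolding tensor_space_def
proof (induction rule: fsc.span_induct_alt)
  case base
  show ?case by (rule assms(3))
next
  case (step c x y)
  then obtain v where "v \<in> Pi UNIV V" "x = pure_tensor sv V v" by blast
  then have "Q (fscale c x)" by (auto intro: assms(2,5))
  then show ?case using step(2) by (rule assms(4))
qed

lemma tensor_ext:
  assumes "F \<in> tensor_space sv V"
    and "\<And>v. v \<in> Pi UNIV V \<Longrightarrow> app A (pure_tensor sv V v) = app B (pure_tensor sv V v)"
  shows "app A F = app B F"
  using assms(1)
proof (induction rule: tensor_induct)
  case (add F F')
  show ?case unfolding app_add_right add ..
next
  case (scale c F)
  show ?case unfolding app_scale_right scale ..
qed (simp_all only: assms(2) app_zero_right)

lemma tensor_closed:
  assumes "F \<in> tensor_space sv V"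
    and "\<And>v. v \<in> Pi UNIV V \<Longrightarrow> app A (pure_tensor sv V v) \<in> tensor_space sv V"
  shows "app A F \<in> tensor_space sv V"
  using assms(1)
proof (induction rule: tensor_induct)
  case zero
  show ?case unfolding app_zero_right by (rule fsc.subspace_0[OF tensor_subspace])
next
  case (add F F')
  then show ?case unfolding app_add_right by (rule fsc.subspace_add[OF tensor_subspace])
next
  case (scale c F)
  then show ?case unfolding app_scale_right by (rule fsc.subspace_scale[OF tensor_subspace])
qed (rule assms(2))

text \<open>The default value 0 of \<open>pure_tensor\<close> propagates to the span. Derivatives
  can thus be taken at every \<phi>, multilinear or not.\<close>

lemma tensor_zero: "F \<in> tensor_space sv V \<Longrightarrow> \<not> multilinear_on sv (*) V \<phi> \<Longrightarrow> F \<phi> = 0"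
  by (induction rule: tensor_induct) (simp_all add: pure_tensor_def fscale_def)

lemma pure_tensor_add:
  assumes "v \<in> Pi UNIV V" "a \<in> V i" "b \<in> V i"
  shows "pure_tensor sv V (v(i := a + b)) = pure_tensor sv V (v(i := a)) + pure_tensor sv V (v(i := b))"
  using assms by (auto simp: pure_tensor_def multilinear_on_def linear_on_def fun_eq_iff)

lemma pure_tensor_scale:
  assumes "v \<in> Pi UNIV V" "a \<in> V i"
  shows "pure_tensor sv V (v(i := sv c a)) = fscale c (pure_tensor sv V (v(i := a)))"
  using assms by (auto simp: pure_tensor_def multilinear_on_def linear_on_def fscale_def fun_eq_iff)

text \<open>The relations between the operators on the factors hold only on the tensor space. Composition
  with a linear projection onto it turns them into identities in the ring of operators.\<close>

lemma tensor_projection: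
  obtains P :: "(('n \<Rightarrow> 'v) \<Rightarrow> complex) fop" where "\<And>F. app P F \<in> tensor_space sv V"
    "\<And>F. F \<in> tensor_space sv V \<Longrightarrow> app P F = F"
proof -
  interpret p: vector_space_pair "fscale :: _ \<Rightarrow> ('n, 'v) tensor \<Rightarrow> _" "fscale :: _ \<Rightarrow> ('n, 'v) tensor \<Rightarrow> _"
    by unfold_locales
  obtain B where B: "B \<subseteq> tensor_space sv V" "fsc.independent B" "tensor_space sv V \<subseteq> fsc.span B"
    by (rule fsc.maximal_independent_subset)
  define f where "f = p.construct B (\<lambda>F. F)"
  interpret f: Vector_Spaces.linear fscale fscale f
    unfolding f_def by (rule p.linear_construct[OF B(2)])
  have f: "linear_on fscale fscale UNIV f"
    by (simp add: linear_on_def f.add f.scale)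
  have span: "fsc.span B = tensor_space sv V"
    using B(1,3) fsc.span_minimal[OF B(1) tensor_subspace] by blast
  show ?thesis
  proof (rule that[of "Fop f"])
    show "app (Fop f) F \<in> tensor_space sv V" for F
      using p.construct_in_span[OF B(2), of "\<lambda>F. F" F] f by (simp add: Fop_inverse f_def span)
    show "app (Fop f) F = F" if F: "F \<in> tensor_space sv V" for F
    proof -
      have "f F = F"
        using F unfolding span[symmetric]
      proof (induction rule: fsc.span_induct_alt)
        case base
        show ?case by (rule f.zero)
      next
        case (step c x y)
        then have "f x = x"
          using p.construct_basis[OF B(2), of x "\<lambda>F. F"] by (simp add: f_def)
        with step show ?case by (simp only: f.add f.scale)
      qed
      then show ?thesis using f by (simp add: Fop_inverse)
    qed
  qed
qed

context
  fixes sg :: "complex \<Rightarrow> 'g::ab_group_add \<Rightarrow> 'g" and br :: "'g \<Rightarrow> 'g \<Rightarrow> 'g" and \<rho> :: "'n \<Rightarrow> 'g \<Rightarrow> 'v \<Rightarrow> 'v"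
  assumes modules: "\<And>i. lie_module sg br sv (V i) (\<rho> i)"
begin

lemma module_closed: "v \<in> V i \<Longrightarrow> \<rho> i y v \<in> V i"
  and module_linear: "linear_on sv sv (V i) (\<rho> i y)"
  and module_add: "v \<in> V i \<Longrightarrow> \<rho> i (y + z) v = \<rho> i y v + \<rho> i z v"
  and module_scale: "v \<in> V i \<Longrightarrow> \<rho> i (sg c y) v = sv c (\<rho> i y v)"
  and module_bracket: "v \<in> V i \<Longrightarrow> \<rho> i (br y z) v = \<rho> i y (\<rho> i z v) - \<rho> i z (\<rho> i y v)"
  using modules[of i] unfolding lie_module_def linear_on_def by auto

definition faop :: "'n \<Rightarrow> 'g \<Rightarrow> (('n \<Rightarrow> 'v) \<Rightarrow> complex) fop"
  where "faop i y = Fop (factor_action sv V \<rho> i y)"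

lemma app_faop: "app (faop i y) F = factor_action sv V \<rho> i y F"
  unfolding faop_def factor_action_def
  by (subst Fop_inverse) (simp_all add: on_factor_linear)

lemma app_faop_pure:
  "app (faop i y) (pure_tensor sv V v) = pure_tensor sv V (v(i := \<rho> i y (v i)))"
  unfolding app_faop factor_action_def
  by (rule on_factor_pure_tensor) (auto simp: module_linear module_closed)

lemma Pi_update: "v \<in> Pi UNIV V \<Longrightarrow> a \<in> V i \<Longrightarrow> v(i := a) \<in> Pi UNIV V"
  by (auto simp: Pi_iff)

lemma Pi_module: "v \<in> Pi UNIV V \<Longrightarrow> \<rho> i y (v i) \<in> V i"
  by (auto simp: Pi_iff module_closed)

lemma factor_action_closed:
  assumes "F \<in> tensor_space sv V" shows "factor_action sv V \<rho> i y F \<in> tensor_space sv V"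
  unfolding app_faop[symmetric] using assms
  by (rule tensor_closed) (simp add: app_faop_pure pure_tensor_in Pi_update Pi_module)

lemma faop_relations:
  assumes F: "F \<in> tensor_space sv V"
  shows faop_add: "app (faop i (y + z)) F = app (faop i y + faop i z) F"
    and faop_scale: "app (faop i (sg c y)) F = app (sc_fop c (faop i y)) F"
    and faop_bracket: "app (faop i y * faop i z) F = app (faop i (br y z) + faop i z * faop i y) F"
    and faop_commute: "i \<noteq> j \<Longrightarrow> app (faop i y * faop j z) F = app (faop j z * faop i y) F"
proof -
  note simps = app_plus app_sc app_times app_faop_pure Pi_update Pi_module
  show "app (faop i (y + z)) F = app (faop i y + faop i z) F"
    using F by (rule tensor_ext) (simp add: simps module_add Pi_iff pure_tensor_add[symmetric] module_closed)
  show "app (faop i (sg c y)) F = app (sc_fop c (faop i y)) F"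
    using F by (rule tensor_ext) (simp add: simps module_scale Pi_iff pure_tensor_scale[symmetric] module_closed)
  show "app (faop i y * faop i z) F = app (faop i (br y z) + faop i z * faop i y) F"
    using F
  proof (rule tensor_ext)
    fix v assume v: "v \<in> Pi UNIV V"
    then have vi: "v i \<in> V i" by auto
    have "\<rho> i y (\<rho> i z (v i)) = \<rho> i (br y z) (v i) + \<rho> i z (\<rho> i y (v i))"
      using module_bracket[OF vi] by simp
    then show "app (faop i y * faop i z) (pure_tensor sv V v) =
        app (faop i (br y z) + faop i z * faop i y) (pure_tensor sv V v)"
      using pure_tensor_add[OF v, of "\<rho> i (br y z) (v i)" i "\<rho> i z (\<rho> i y (v i))"] vi
      by (simp add: simps module_closed)
  qed
  show "app (faop i y * faop j z) F = app (faop j z * faop i y) F" if "i \<noteq> j"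
    using F by (rule tensor_ext) (use that in \<open>simp add: simps fun_upd_twist\<close>)
qed

lemma lie_actions_faop:
  assumes "graded_lie_algebra sg br form H I x st w"
    and P: "\<And>F. app P F \<in> tensor_space sv V" "\<And>F. F \<in> tensor_space sv V \<Longrightarrow> app P F = F"
  shows "lie_actions sg br form H I x st w sc_fop (\<lambda>i y. faop i y * P)"
proof -
  have PP: "app P (factor_action sv V \<rho> i y (app P F)) = factor_action sv V \<rho> i y (app P F)" for i y F
    by (intro P factor_action_closed)
  \<comment> \<open>The actions preserve the tensor space, so the inner projection is
    absorbed.\<close>
  have mult: "faop i y * P * (faop j z * P) = (faop i y * faop j z) * P" for i j y z
    by (rule app_eqI) (simp add: app_times app_faop PP)
  have eq: "A * P = B * P" if "\<And>F. F \<in> tensor_space sv V \<Longrightarrow> app A F = app B F" for A B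
    by (rule app_eqI) (simp add: app_times that P)
  interpret R: complex_ring sc_fop by (rule complex_ring_sc_fop)
  interpret G: graded_lie_algebra sg br form H I x st w by (rule assms(1))
  show ?thesis
  proof
    show "faop i (y + z) * P = faop i y * P + faop i z * P" for i y z
      unfolding distrib_right[symmetric] by (intro eq faop_add)
    show "faop i (sg c y) * P = sc_fop c (faop i y * P)" for i c y
      unfolding R.sc_mult_left[symmetric] by (intro eq faop_scale)
    show "comm (faop i y * P) (faop i z * P) = faop i (br y z) * P" for i y z
    proof -
      have "faop i y * faop i z * P = (faop i (br y z) + faop i z * faop i y) * P"
        by (intro eq faop_bracket)
      then show ?thesis by (simp add: comm_def mult distrib_right)
    qed
    show "comm (faop i y * P) (faop j z * P) = 0" if "i \<noteq> j" for i j y z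
      using eq[OF faop_commute[OF _ that]] by (simp add: comm_def mult)
  qed
qed

end

end

section \<open>Directional derivatives\<close>

text \<open>A direction has a \<open>z\<close>-part and a \<mu>-part, so that one derivative serves
  both kinds of equations.\<close>

definition shift :: "(complex \<Rightarrow> 'g::ab_group_add \<Rightarrow> 'g) \<Rightarrow> (complex^'n) \<times> 'g \<Rightarrow> (complex^'n) \<times> 'g \<Rightarrow> complex
    \<Rightarrow> (complex^'n) \<times> 'g"
  where "shift sg d p t = (fst p + t *s fst d, snd p + sg t (snd d))"

definition pd :: "(complex \<Rightarrow> 'g::ab_group_add \<Rightarrow> 'g) \<Rightarrow> (complex^'n) \<times> 'g
    \<Rightarrow> ((complex^'n) \<times> 'g \<Rightarrow> ('n, 'v) tensor) \<Rightarrow> (complex^'n) \<times> 'g \<Rightarrow> ('n, 'v) tensor"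
  where "pd sg d u p = (\<lambda>\<phi>. deriv (\<lambda>t. u (shift sg d p t) \<phi>) 0)"

text \<open>Unlike \<open>pd\<close>, which rests on the total function \<open>deriv\<close>, this
  also asserts that the derivative exists.\<close>

definition has_pd :: "(complex \<Rightarrow> 'g::ab_group_add \<Rightarrow> 'g) \<Rightarrow> (complex^'n) \<times> 'g
    \<Rightarrow> ((complex^'n) \<times> 'g \<Rightarrow> ('n, 'v) tensor) \<Rightarrow> (complex^'n) \<times> 'g \<Rightarrow> ('n, 'v) tensor \<Rightarrow> bool"
  where "has_pd sg d u p v \<longleftrightarrow> (\<forall>\<phi>. ((\<lambda>t. u (shift sg d p t) \<phi>) has_field_derivative v \<phi>) (at 0))"

lemma has_pd_imp_pd: "has_pd sg d u p v \<Longrightarrow> pd sg d u p = v"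
  by (auto simp: has_pd_def pd_def fun_eq_iff intro!: DERIV_imp_deriv)

lemma has_pd_add: "has_pd sg d u p v \<Longrightarrow> has_pd sg d u' p v' \<Longrightarrow> has_pd sg d (\<lambda>q. u q + u' q) p (v + v')"
  and has_pd_diff: "has_pd sg d u p v \<Longrightarrow> has_pd sg d u' p v' \<Longrightarrow> has_pd sg d (\<lambda>q. u q - u' q) p (v - v')"
  by (auto simp: has_pd_def intro!: DERIV_add DERIV_diff)

lemma has_pd_zero: "has_pd sg d (\<lambda>q. 0) p 0"
  by (simp add: has_pd_def)

lemma has_pd_sum:
  "(\<And>i. i \<in> A \<Longrightarrow> has_pd sg d (u i) p (v i)) \<Longrightarrow> has_pd sg d (\<lambda>q. \<Sum>i\<in>A. u i q) p (\<Sum>i\<in>A. v i)"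
  by (induction A rule: infinite_finite_induct) (auto intro: has_pd_add has_pd_zero)

lemma has_pd_scale: "has_pd sg d u p v \<Longrightarrow> has_pd sg d (\<lambda>q. fscale c (u q)) p (fscale c v)"
  by (auto simp: has_pd_def fscale_def intro!: DERIV_cmult)

text \<open>An operator on a factor only evaluates its argument at a modified form, so it commutes
  with derivatives taken form by form; no continuity enters.\<close>

lemma has_pd_on_factor:
  "has_pd sg d u p v \<Longrightarrow> has_pd sg d (\<lambda>q. on_factor sv V i f (u q)) p (on_factor sv V i f v)"
  by (auto simp: has_pd_def on_factor_def)

lemma has_pd_factor_action:
  "has_pd sg d u p v \<Longrightarrow> has_pd sg d (\<lambda>q. factor_action sv V \<rho> i y (u q)) p (factor_action sv V \<rho> i y v)"
  unfolding factor_action_def by (rule has_pd_on_factor)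

lemma bounded_linear_vector_scalar: "bounded_linear (\<lambda>c::complex. c *s (a :: complex^'n))"
  by (rule linear_conv_bounded_linear[THEN iffD1], rule linearI)
    (simp_all add: vec_eq_iff algebra_simps)

lemma has_derivative_affine_line:
  "((\<lambda>s. (fst q + s *s a, snd q + s *s b)) has_derivative (\<lambda>c. (c *s a, c *s b))) (at (s :: complex))"
  for q :: "(complex^'n) \<times> (complex^'r)"
  by (rule derivative_eq_intros
        bounded_linear.has_derivative[OF bounded_linear_vector_scalar] refl | simp)+

context metric_lie_algebra
begin

section \<open>Coordinates on the Cartan subalgebra\<close>

context
  fixes hs :: "'r::finite \<Rightarrow> 'g" and H :: "'g set"
  assumes onb: "orthonormal_basis sg form H hs"
begin

definition coord :: "'g \<Rightarrow> complex^'r"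
  where "coord h = (\<chi> s. form h (hs s))"

lemma chart_coord: "h \<in> H \<Longrightarrow> chart sg hs (z, coord h) = (z, h)"
  using span_orthonormal[OF onb, of h] by (simp add: chart_def coord_def)

lemma chart_shift:
  assumes "snd d \<in> H"
  shows "chart sg hs (fst q + t *s fst d, snd q + t *s coord (snd d)) = shift sg d (chart sg hs q) t"
proof -
  have "(\<Sum>s\<in>UNIV. sg (t * form (snd d) (hs s)) (hs s)) = sg t (snd d)"
    by (subst (2) span_orthonormal[OF onb assms]) (simp add: scale_sum_right)
  then show ?thesis
    by (simp add: chart_def shift_def coord_def case_prod_beta scale_left_distrib sum.distrib)
qed

lemma shift_shift: "shift sg d (shift sg d' p t) s = shift sg d' (shift sg d p s) t"
  by (simp add: shift_def algebra_simps)

lemma shift_0: "shift sg d p 0 = p"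
  by (simp add: shift_def)

text \<open>Openness and continuity are expressed in the coordinates of \<open>chart\<close>; this
  lifts the two-parameter family of shifts through \<open>p\<close> to them.\<close>

definition plane :: "(complex^'n) \<times> 'g \<Rightarrow> (complex^'n) \<times> 'g \<Rightarrow> (complex^'n) \<times> 'g \<Rightarrow> complex \<times> complex
    \<Rightarrow> (complex^'n) \<times> (complex^'r)"
  where "plane d d' p = (\<lambda>(s, t). (fst p + s *s fst d + t *s fst d',
    coord (snd p) + s *s coord (snd d) + t *s coord (snd d')))"

lemma chart_plane:
  assumes "snd d \<in> H" "snd d' \<in> H" "snd p \<in> H"
  shows "chart sg hs (plane d d' p (s, t)) = shift sg d' (shift sg d p s) t"
  using chart_shift[OF assms(2), of "(fst p + s *s fst d, coord (snd p) + s *s coord (snd d))" t]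
    chart_shift[OF assms(1), of "(fst p, coord (snd p))" s] chart_coord[OF assms(3), of "fst p"]
  by (simp add: plane_def)

lemma continuous_plane: "continuous_on A (plane d d' p)"
proof -
  have lin: "continuous_on A (\<lambda>x. f x *s a)" if "continuous_on A f" for f :: "complex \<times> complex \<Rightarrow> complex" and a :: "complex^'m"
    using bounded_linear.continuous_on[OF bounded_linear_vector_scalar that] .
  show ?thesis
    unfolding plane_def case_prod_beta by (intro continuous_intros lin)
qed

lemma open_domain_shift:
  assumes W: "open_domain sg hs H W" and p: "p \<in> W" and d: "snd d \<in> H" "snd d' \<in> H"
  obtains r where "0 < r" "\<And>s t. cmod s \<le> r \<Longrightarrow> cmod t \<le> r \<Longrightarrow> shift sg d' (shift sg d p s) t \<in> W"
proof -
  define k where "k = plane d d' p"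
  have "snd p \<in> H" using W p by (auto simp: open_domain_def)
  then have chart_k: "chart sg hs (k (s, t)) = shift sg d' (shift sg d p s) t" for s t
    unfolding k_def by (rule chart_plane[OF d])
  have "continuous_on UNIV k"
    unfolding k_def by (rule continuous_plane)
  then have "open (k -` (chart sg hs -` W))"
    using W unfolding open_domain_def by (simp add: continuous_on_open_vimage)
  moreover have "(0, 0) \<in> k -` (chart sg hs -` W)"
    using p by (simp add: chart_k shift_0)
  ultimately obtain A B where AB: "open A" "open B" "(0 :: complex, 0 :: complex) \<in> A \<times> B" "A \<times> B \<subseteq> k -` (chart sg hs -` W)"
    by (rule open_prod_elim)
  then have "0 \<in> A" "0 \<in> B" by auto
  with AB obtain r1 r2 where r: "0 < r1" "cball 0 r1 \<subseteq> A" "0 < r2" "cball 0 r2 \<subseteq> B"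
    using open_contains_cball by metis
  show ?thesis
  proof (rule that[of "min r1 r2"])
    fix s t assume "cmod s \<le> min r1 r2" "cmod t \<le> min r1 r2"
    then have "(s, t) \<in> A \<times> B" using r by (auto simp: subset_iff)
    then show "shift sg d' (shift sg d p s) t \<in> W" using AB(4) chart_k[of s t] by auto
  qed (use r in simp)
qed

lemma eventually_shift:
  assumes "open_domain sg hs H W" "p \<in> W" "snd d \<in> H"
  shows "\<forall>\<^sub>F t in nhds 0. shift sg d p t \<in> W"
proof -
  obtain r where "0 < r" "\<And>s t. cmod s \<le> r \<Longrightarrow> cmod t \<le> r \<Longrightarrow> shift sg d (shift sg d p s) t \<in> W"
    using open_domain_shift[OF assms(1,2,3,3)] by blast
  from this(1) this(2)[of 0] show ?thesis
    by (auto simp: eventually_nhds_metric shift_0 dist_norm intro!: exI[of _ r])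
qed

section \<open>Directional derivatives of a holomorphic tensor-valued function\<close>

context
  fixes sv :: "complex \<Rightarrow> 'v::ab_group_add \<Rightarrow> 'v" and V :: "'n::finite \<Rightarrow> 'v set" and W and u :: "(complex^'n) \<times> 'g \<Rightarrow> ('n, 'v) tensor"
  assumes W: "open_domain sg hs H W" and u: "holomorphic_tensor sg hs sv V W u"
begin

lemma holomorphic_component: "holomorphic_scalar sg hs W (\<lambda>p. u p \<phi>)"
proof (cases "multilinear_on sv (*) V \<phi>")
  case True
  then show ?thesis using u by (auto simp: holomorphic_tensor_def)
next
  case False
  have 0: "u p \<phi> = 0" if "p \<in> W" for p
  proof -
    have "u p \<in> tensor_space sv V" using u that by (simp add: holomorphic_tensor_def)
    then show ?thesis using False by (rule tensor_zero)
  qed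
  show ?thesis
    unfolding holomorphic_scalar_def
  proof
    fix q assume q: "q \<in> chart sg hs -` W"
    have "((\<lambda>_. 0) has_derivative (\<lambda>_. 0 :: complex)) (at q)" by simp
    moreover have "open (chart sg hs -` W)" using W by (simp add: open_domain_def)
    ultimately have "((\<lambda>p. u p \<phi>) \<circ> chart sg hs has_derivative (\<lambda>_. 0)) (at q)"
      using q by (rule has_derivative_transform_within_open) (simp add: 0)
    then show "\<exists>D. ((\<lambda>p. u p \<phi>) \<circ> chart sg hs has_derivative D) (at q) \<and> (\<forall>c a b. D (c *s a, c *s b) = c * D (a, b))"
      by (intro exI[of _ "\<lambda>_. 0"]) simp
  qed
qed

text \<open>The chain rule along a complex line gives a real derivative, and complex homogeneity of
  \<open>D\<close> makes it a complex one.\<close>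

lemma component_DERIV:
  assumes d: "snd d \<in> H" and W': "snd p \<in> H" "shift sg d p s \<in> W"
  shows "\<exists>D. ((\<lambda>s. u (shift sg d p s) \<phi>) has_field_derivative D) (at s)"
proof -
  define q where "q = (fst p, coord (snd p))"
  define l where "l = (\<lambda>s. (fst q + s *s fst d, snd q + s *s coord (snd d)))"
  have l: "chart sg hs (l s) = shift sg d p s" for s
    using chart_shift[OF d, of q s] chart_coord[OF W'(1), of "fst p"] by (simp add: l_def q_def)
  obtain D where D: "((\<lambda>p. u p \<phi>) \<circ> chart sg hs has_derivative D) (at (l s))"
    and lin: "\<And>c a b. D (c *s a, c *s b) = c * D (a, b)"
  proof -
    have "l s \<in> chart sg hs -` W" using W'(2) l[of s] by simp
    then show ?thesis
      using that holomorphic_component[of \<phi>] unfolding holomorphic_scalar_def by blast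
  qed
  have l': "(l has_derivative (\<lambda>c. (c *s fst d, c *s coord (snd d)))) (at s)"
    unfolding l_def by (rule has_derivative_affine_line)
  have "(((\<lambda>p. u p \<phi>) \<circ> chart sg hs) \<circ> l has_derivative D \<circ> (\<lambda>c. (c *s fst d, c *s coord (snd d)))) (at s)"
    by (rule diff_chain_at[of l _ s "(\<lambda>p. u p \<phi>) \<circ> chart sg hs"])
      (rule l', rule D)
  then have "((\<lambda>s. u (shift sg d p s) \<phi>) has_derivative (\<lambda>c. c * D (fst d, coord (snd d)))) (at s)"
    by (simp add: o_def l lin)
  then show ?thesis
    by (auto simp: has_field_derivative_def mult_commute_abs)
qed

lemma domain_H: "q \<in> W \<Longrightarrow> snd q \<in> H"
  using W by (auto simp: open_domain_def)

lemma has_pd_holomorphic: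
  assumes "p \<in> W" "snd d \<in> H"
  shows "has_pd sg d u p (pd sg d u p)"
  unfolding has_pd_def pd_def
  using component_DERIV[OF assms(2) domain_H[OF assms(1)], of 0] assms(1)
  by (auto simp: shift_0 DERIV_deriv_iff_has_field_derivative)

lemma component_continuous: "continuous_on (chart sg hs -` W) ((\<lambda>p. u p \<phi>) \<circ> chart sg hs)"
  using holomorphic_component[of \<phi>] unfolding holomorphic_scalar_def
  by (intro continuous_at_imp_continuous_on ballI) (blast intro: has_derivative_continuous)

text \<open>Compactness of a closed bidisc inside the domain supplies the bound that
  \<open>mixed_partials\<close> asks for. The mixed derivatives at the individual forms are then
  collected into one function \<open>L\<close>.\<close>

lemma pd_commute:
  assumes p: "p \<in> W" and d: "snd d \<in> H" and d': "snd d' \<in> H"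
  obtains L where "has_pd sg d' (pd sg d u) p L" "has_pd sg d (pd sg d' u) p L"
proof -
  have pH: "snd p \<in> H" by (rule domain_H[OF p])
  obtain R where R: "0 < R" "\<And>s t. cmod s \<le> R \<Longrightarrow> cmod t \<le> R \<Longrightarrow> shift sg d' (shift sg d p s) t \<in> W"
    using open_domain_shift[OF W p d d'] by blast
  define r where "r = R / 2"
  have r: "0 < r" "2 * r = R" using R by (simp_all add: r_def)
  have dH: "snd (shift sg d p s) \<in> H" "snd (shift sg d' p s) \<in> H" for s
    using R pH d d' onb by (auto simp: shift_def orthonormal_basis_def intro!: span_add span_scale)
  have "\<exists>L. ((\<lambda>t. pd sg d u (shift sg d' p t) \<phi>) has_field_derivative L) (at 0) \<and>
      ((\<lambda>s. pd sg d' u (shift sg d p s) \<phi>) has_field_derivative L) (at 0)" for \<phi>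
  proof -
    define g where "g = (\<lambda>s t. u (shift sg d' (shift sg d p s) t) \<phi>)"
    have "\<exists>B. \<forall>s\<in>cball 0 R. \<forall>t\<in>cball 0 R. cmod (g s t) \<le> B"
    proof -
      define k where "k = plane d d' p"
      have chart_k: "chart sg hs (k (s, t)) = shift sg d' (shift sg d p s) t" for s t
        unfolding k_def by (rule chart_plane[OF d d' pH])
      have "continuous_on (cball 0 R \<times> cball 0 R) k"
        unfolding k_def by (rule continuous_plane)
      moreover have "k ` (cball 0 R \<times> cball 0 R) \<subseteq> chart sg hs -` W"
        using R by (auto simp: chart_k)
      ultimately have "continuous_on (cball 0 R \<times> cball 0 R) (((\<lambda>p. u p \<phi>) \<circ> chart sg hs) \<circ> k)"
        by (rule continuous_on_compose[OF _ continuous_on_subset[OF component_continuous]])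
      then have "compact ((((\<lambda>p. u p \<phi>) \<circ> chart sg hs) \<circ> k) ` (cball 0 R \<times> cball 0 R))"
        by (rule compact_continuous_image[OF _ compact_Times[OF compact_cball compact_cball]])
      then have "bounded ((((\<lambda>p. u p \<phi>) \<circ> chart sg hs) \<circ> k) ` (cball 0 R \<times> cball 0 R))"
        by (rule compact_imp_bounded)
      then obtain B where B: "\<forall>y\<in>(((\<lambda>p. u p \<phi>) \<circ> chart sg hs) \<circ> k) ` (cball 0 R \<times> cball 0 R). cmod y \<le> B"
        unfolding bounded_iff by (rule exE)
      have "cmod (g s t) \<le> B" if "s \<in> cball 0 R" "t \<in> cball 0 R" for s t
        using bspec[OF B imageI[of "(s, t)"]] that by (simp add: chart_k g_def)
      then show ?thesis by blast
    qed
    then obtain B where B: "\<And>s t. s \<in> cball 0 R \<Longrightarrow> t \<in> cball 0 R \<Longrightarrow> cmod (g s t) \<le> B" by blast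
    have inW: "shift sg d' (shift sg d p s) t \<in> W" "shift sg d (shift sg d' p t) s \<in> W"
      if "s \<in> ball 0 R" "t \<in> ball 0 R" for s t
      using R(2)[of s t] that shift_shift[of d d' p t s] by auto
    obtain L where L: "((\<lambda>t. deriv (\<lambda>s. g s t) 0) has_field_derivative L) (at 0)"
      "((\<lambda>s. deriv (g s) 0) has_field_derivative L) (at 0)"
    proof (rule mixed_partials[of r g B])
      show "0 < r" by (rule r)
      show "cmod (g s t) \<le> B" if "s \<in> ball 0 (2 * r)" "t \<in> ball 0 (2 * r)" for s t
        using that r by (intro B) auto
      show "(\<lambda>s. g s t) holomorphic_on ball 0 (2 * r)" if "t \<in> ball 0 (2 * r)" for t
        unfolding holomorphic_on_open[OF open_ball] g_def shift_shift[of d' d p]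
        by (intro ballI component_DERIV d dH inW) (use that r in auto)
      show "g s holomorphic_on ball 0 (2 * r)" if "s \<in> ball 0 (2 * r)" for s
        unfolding holomorphic_on_open[OF open_ball] g_def
        by (intro ballI component_DERIV d' dH inW) (use that r in auto)
    qed
    show ?thesis
      using L unfolding g_def pd_def by (auto simp: shift_shift[of d' d])
  qed
  then obtain L where "\<And>\<phi>. ((\<lambda>t. pd sg d u (shift sg d' p t) \<phi>) has_field_derivative L \<phi>) (at 0) \<and>
      ((\<lambda>s. pd sg d' u (shift sg d p s) \<phi>) has_field_derivative L \<phi>) (at 0)" by metis
  then show ?thesis by (intro that[of L]) (simp_all add: has_pd_def)
qed

end

end

end

section \<open>Differential operators of first order\<close>

definition dop :: "(complex \<Rightarrow> 'g::ab_group_add \<Rightarrow> 'g) \<Rightarrow> complex \<Rightarrow> (complex^'n) \<times> 'g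
    \<Rightarrow> ((complex^'n) \<times> 'g \<Rightarrow> ('n, 'v) tensor \<Rightarrow> ('n, 'v) tensor)
    \<Rightarrow> ((complex^'n) \<times> 'g \<Rightarrow> ('n, 'v) tensor) \<Rightarrow> (complex^'n) \<times> 'g \<Rightarrow> ('n, 'v) tensor"
  where "dop sg \<kappa> d A u = (\<lambda>p. fscale \<kappa> (pd sg d u p) - A p (u p))"

definition kz_coeff :: "('n::finite \<Rightarrow> 'g \<Rightarrow> ('n, 'v) tensor \<Rightarrow> ('n, 'v) tensor)
    \<Rightarrow> ('r::finite \<Rightarrow> 'g) \<Rightarrow> ('g \<Rightarrow> complex) set \<Rightarrow> (('g \<Rightarrow> complex) \<Rightarrow> 'g) \<Rightarrow> 'n
    \<Rightarrow> (complex^'n) \<times> 'g \<Rightarrow> ('n, 'v) tensor \<Rightarrow> ('n, 'v) tensor"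
  where "kz_coeff act hs \<Delta> e i q F = act i (snd q) F +
    (\<Sum>j\<in>UNIV - {i}. fscale (1 / (fst q $ i - fst q $ j)) (Omega act hs \<Delta> e i j F))"

definition dyn_coeff :: "('n::finite \<Rightarrow> 'g \<Rightarrow> ('n, 'v) tensor \<Rightarrow> ('n, 'v) tensor)
    \<Rightarrow> ('g \<Rightarrow> complex) set \<Rightarrow> (('g \<Rightarrow> complex) \<Rightarrow> 'g) \<Rightarrow> 'g
    \<Rightarrow> (complex^'n) \<times> 'g \<Rightarrow> ('n, 'v) tensor \<Rightarrow> ('n, 'v) tensor"
  where "dyn_coeff act \<Delta>pos e \<mu>' q F = (\<Sum>i\<in>UNIV. fscale (fst q $ i) (act i \<mu>' F)) +
    (\<Sum>\<alpha>\<in>\<Delta>pos. fscale (\<alpha> \<mu>' / \<alpha> (snd q)) (total_action act (e (- \<alpha>)) (total_action act (e \<alpha>) F)))"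

lemma has_pd_Omega:
  "has_pd sg d u p v \<Longrightarrow> has_pd sg d (\<lambda>q. Omega (factor_action sv V \<rho>) hs \<Delta> e i j (u q)) p
    (Omega (factor_action sv V \<rho>) hs \<Delta> e i j v)"
  unfolding Omega_def by (intro has_pd_add has_pd_sum has_pd_factor_action)

lemma has_pd_total_action:
  "has_pd sg d u p v \<Longrightarrow> has_pd sg d (\<lambda>q. total_action (factor_action sv V \<rho>) y (u q)) p
    (total_action (factor_action sv V \<rho>) y v)"
  unfolding total_action_def by (intro has_pd_sum has_pd_factor_action)

lemma linear_on_sum:
  assumes "\<And>i. i \<in> A \<Longrightarrow> linear_on fscale fscale UNIV (f i)"
  shows "linear_on fscale fscale UNIV (\<lambda>F :: 'b \<Rightarrow> complex. \<Sum>i\<in>A. f i F)"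
  using assms by (induction A rule: infinite_finite_induct)
    (simp_all add: linear_on_def fsc.scale_right_distrib algebra_simps)

lemma linear_on_add_fscale:
  "linear_on fscale fscale UNIV f \<Longrightarrow> linear_on fscale fscale UNIV g \<Longrightarrow> linear_on fscale fscale UNIV (\<lambda>F. f F + g F)"
  "linear_on fscale fscale UNIV f \<Longrightarrow> linear_on fscale fscale UNIV (\<lambda>F. fscale c (f F))"
  "linear_on fscale fscale UNIV f \<Longrightarrow> linear_on fscale fscale UNIV g \<Longrightarrow> linear_on fscale fscale UNIV (\<lambda>F. f (g F))"
  for f g :: "('b \<Rightarrow> complex) \<Rightarrow> ('b \<Rightarrow> complex)"
  by (simp_all add: linear_on_def fsc.scale_right_distrib algebra_simps)

lemma linear_factor_action: "linear_on fscale fscale UNIV (factor_action sv V \<rho> i y)"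
  unfolding factor_action_def by (rule on_factor_linear)

lemma linear_total_action: "linear_on fscale fscale UNIV (total_action (factor_action sv V \<rho>) y)"
  unfolding total_action_def[abs_def] by (intro linear_on_sum linear_factor_action)

lemma linear_Omega: "linear_on fscale fscale UNIV (Omega (factor_action sv V \<rho>) hs \<Delta> e i j)"
  unfolding Omega_def[abs_def]
  by (intro linear_on_add_fscale(1) linear_on_sum)
    (rule linear_on_add_fscale(3)[OF linear_factor_action linear_factor_action])+

lemma linear_coeff:
  "linear_on fscale fscale UNIV (kz_coeff (factor_action sv V \<rho>) hs \<Delta> e i q)"
  "linear_on fscale fscale UNIV (dyn_coeff (factor_action sv V \<rho>) \<Delta>pos e \<mu>' q)"
  unfolding kz_coeff_def[abs_def] dyn_coeff_def[abs_def]
  by (intro linear_on_add_fscale(1,2) linear_on_sum linear_factor_action linear_Omega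
      linear_on_add_fscale(3)[OF linear_total_action linear_total_action])+

context metric_lie_algebra
begin

lemma has_pd_scale_fun:
  assumes "((\<lambda>t. c (shift sg d p t)) has_field_derivative c') (at 0)" "has_pd sg d u p v"
  shows "has_pd sg d (\<lambda>q. fscale (c q) (u q)) p (fscale (c p) v + fscale c' (u p))"
  unfolding has_pd_def fscale_def
proof
  fix \<phi>
  have "((\<lambda>t. u (shift sg d p t) \<phi>) has_field_derivative v \<phi>) (at 0)"
    using assms(2) by (simp add: has_pd_def)
  from DERIV_mult[OF assms(1) this]
  show "((\<lambda>t. c (shift sg d p t) * u (shift sg d p t) \<phi>) has_field_derivative
      ((\<lambda>x. c p * v x) + (\<lambda>x. c' * u p x)) \<phi>) (at 0)"
    by (simp add: shift_def mult.commute add.commute)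
qed

text \<open>Both cross derivatives of the coefficients equal the same \<open>R\<close>. For the
  derivatives of \<open>u\<close> only linearity of the coefficients on the whole space is invoked;
  they need to commute just at \<open>u p\<close>.\<close>

lemma dop_commute:
  fixes hs :: "'r::finite \<Rightarrow> 'g" and V :: "'n::finite \<Rightarrow> 'v::ab_group_add set"
  assumes onb: "orthonormal_basis sg form H hs" and W: "open_domain sg hs H W"
    and u: "holomorphic_tensor sg hs sv V W u"
    and p: "p \<in> W" "snd d \<in> H" "snd d' \<in> H"
    and A: "linear_on fscale fscale UNIV (A p)" and A': "linear_on fscale fscale UNIV (A' p)"
    and dA: "\<And>v. has_pd sg d' u p v \<Longrightarrow> has_pd sg d' (\<lambda>q. A q (u q)) p (A p v + R)"
    and dA': "\<And>v. has_pd sg d u p v \<Longrightarrow> has_pd sg d (\<lambda>q. A' q (u q)) p (A' p v + R)"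
    and comm: "A p (A' p (u p)) = A' p (A p (u p))"
  shows "dop sg \<kappa> d A (dop sg \<kappa> d' A' u) p = dop sg \<kappa> d' A' (dop sg \<kappa> d A u) p"
proof -
  obtain L where L: "has_pd sg d' (pd sg d u) p L" "has_pd sg d (pd sg d' u) p L"
    using pd_commute[OF onb W u p] .
  have "pd sg d (dop sg \<kappa> d' A' u) p = fscale \<kappa> L - (A' p (pd sg d u p) + R)"
    unfolding dop_def
    by (intro has_pd_imp_pd has_pd_diff has_pd_scale L dA' has_pd_holomorphic[OF onb W u p(1,2)])
  moreover have "pd sg d' (dop sg \<kappa> d A u) p = fscale \<kappa> L - (A p (pd sg d' u p) + R)"
    unfolding dop_def
    by (intro has_pd_imp_pd has_pd_diff has_pd_scale L dA has_pd_holomorphic[OF onb W u p(1,3)])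
  moreover have "A p (fscale \<kappa> F - G) = fscale \<kappa> (A p F) - A p G" "A' p (fscale \<kappa> F - G) = fscale \<kappa> (A' p F) - A' p G" for F G
  proof -
    have "f (fscale \<kappa> F - G) = fscale \<kappa> (f F) - f G" if "linear_on fscale fscale UNIV f" for f
    proof -
      have "f ((fscale \<kappa> F - G) + G) = f (fscale \<kappa> F - G) + f G"
        using that unfolding linear_on_def by blast
      then show ?thesis using that by (simp add: linear_on_def)
    qed
    then show "A p (fscale \<kappa> F - G) = fscale \<kappa> (A p F) - A p G" "A' p (fscale \<kappa> F - G) = fscale \<kappa> (A' p F) - A' p G"
      using A A' by blast+
  qed
  moreover have "dop sg \<kappa> d A f p = fscale \<kappa> (pd sg d f p) - A p (f p)"
      "dop sg \<kappa> d' A' f p = fscale \<kappa> (pd sg d' f p) - A' p (f p)" for f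
    by (simp_all only: dop_def)
  ultimately show ?thesis
    by (simp only: comm fsc.scale_right_diff_distrib fsc.scale_right_distrib) (simp add: algebra_simps)
qed

lemma kz_operator_eq_dop: "kz_operator act hs \<Delta> e \<kappa> i = dop sg \<kappa> (axis i 1, 0) (kz_coeff act hs \<Delta> e i)"
proof -
  have "t *s axis i 1 = axis i t" for t :: complex
    by (simp add: vec_eq_iff axis_def)
  then show ?thesis
    by (auto simp: kz_operator_def dop_def kz_coeff_def partial_z_def pd_def shift_def fun_eq_iff)
qed

lemma dynamical_operator_eq_dop:
  "dynamical_operator sg act \<Delta>pos e \<kappa> \<mu>' = dop sg \<kappa> (0, \<mu>') (dyn_coeff act \<Delta>pos e \<mu>')"
  by (auto simp: dynamical_operator_def dop_def dyn_coeff_def partial_mu_def pd_def shift_def fun_eq_iff)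

section \<open>Derivatives of the two kinds of coefficients\<close>

context
  fixes hs :: "'r::finite \<Rightarrow> 'g" and H :: "'g set" and sv :: "complex \<Rightarrow> 'v::ab_group_add \<Rightarrow> 'v"
    and V :: "'n::finite \<Rightarrow> 'v set" and \<rho> :: "'n \<Rightarrow> 'g \<Rightarrow> 'v \<Rightarrow> 'v" and W u p d v
  assumes onb: "orthonormal_basis sg form H hs" and W: "open_domain sg hs H W"
    and u: "holomorphic_tensor sg hs sv V W u" and p: "p \<in> W" and d: "snd d \<in> H"
    and modules: "\<And>i. lie_module sg br sv (V i) (\<rho> i)"
    and v: "has_pd sg d u p v"
begin

text \<open>The action is linear in the Lie algebra element on tensors only. Since \<open>u\<close>
  is tensor-valued on the open domain, the expansion in \<open>t\<close> holds for small
  \<open>t\<close>, which is enough for the derivative at 0.\<close>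

lemma has_pd_factor_action_moving:
  "has_pd sg d (\<lambda>q. factor_action sv V \<rho> i (snd q) (u q)) p
    (factor_action sv V \<rho> i (snd p) v + factor_action sv V \<rho> i (snd d) (u p))"
  unfolding has_pd_def
proof
  fix \<phi>
  have uT: "u q \<in> tensor_space sv V" if "q \<in> W" for q
    using u that by (simp add: holomorphic_tensor_def)
  have moving: "factor_action sv V \<rho> i (snd (shift sg d p t)) F =
      factor_action sv V \<rho> i (snd p) F + fscale t (factor_action sv V \<rho> i (snd d) F)"
    if "F \<in> tensor_space sv V" for F t
    using faop_add[OF modules that] faop_scale[OF modules that]
    by (simp add: shift_def app_plus app_sc app_faop[OF modules])
  have eq: "\<forall>\<^sub>F t in nhds 0. factor_action sv V \<rho> i (snd p) (u (shift sg d p t)) \<phi>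
      + t * factor_action sv V \<rho> i (snd d) (u (shift sg d p t)) \<phi>
      = factor_action sv V \<rho> i (snd (shift sg d p t)) (u (shift sg d p t)) \<phi>"
    by (rule eventually_mono[OF eventually_shift[OF onb W p d]]) (simp add: moving uT fscale_def)
  have D: "((\<lambda>t. factor_action sv V \<rho> i y (u (shift sg d p t)) \<phi>) has_field_derivative factor_action sv V \<rho> i y v \<phi>) (at 0)" for y
    using has_pd_factor_action[OF v, of sv V \<rho> i y] by (simp add: has_pd_def)
  have "((\<lambda>t. factor_action sv V \<rho> i (snd p) (u (shift sg d p t)) \<phi>
      + t * factor_action sv V \<rho> i (snd d) (u (shift sg d p t)) \<phi>) has_field_derivative
      factor_action sv V \<rho> i (snd p) v \<phi> + factor_action sv V \<rho> i (snd d) (u p) \<phi>) (at 0)"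
    by (rule derivative_eq_intros D refl | simp add: shift_def)+
  then show "((\<lambda>t. factor_action sv V \<rho> i (snd (shift sg d p t)) (u (shift sg d p t)) \<phi>) has_field_derivative
      (factor_action sv V \<rho> i (snd p) v + factor_action sv V \<rho> i (snd d) (u p)) \<phi>) (at 0)"
    using DERIV_cong_ev[OF refl eq refl] by simp
qed

lemma has_pd_kz_coeff:
  assumes z: "\<And>j. j \<noteq> i \<Longrightarrow> fst p $ i \<noteq> fst p $ j"
  shows "has_pd sg d (\<lambda>q. kz_coeff (factor_action sv V \<rho>) hs \<Delta> e i q (u q)) p
    (kz_coeff (factor_action sv V \<rho>) hs \<Delta> e i p v + (factor_action sv V \<rho> i (snd d) (u p) +
      (\<Sum>j\<in>UNIV - {i}. fscale (- (fst d $ i - fst d $ j) / (fst p $ i - fst p $ j) ^ 2)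
        (Omega (factor_action sv V \<rho>) hs \<Delta> e i j (u p)))))"
proof -
  have "((\<lambda>t. 1 / (fst (shift sg d p t) $ i - fst (shift sg d p t) $ j)) has_field_derivative
      - (fst d $ i - fst d $ j) / (fst p $ i - fst p $ j) ^ 2) (at 0)" if "j \<in> UNIV - {i}" for j
  proof -
    have "((\<lambda>t. 1 / ((fst p $ i + t * fst d $ i) - (fst p $ j + t * fst d $ j))) has_field_derivative
      - (fst d $ i - fst d $ j) / (fst p $ i - fst p $ j) ^ 2) (at 0)"
      using z[of j] that by (auto intro!: derivative_eq_intros simp: power2_eq_square)
    then show ?thesis by (simp add: shift_def)
  qed
  then have "has_pd sg d (\<lambda>q. \<Sum>j\<in>UNIV - {i}. fscale (1 / (fst q $ i - fst q $ j)) (Omega (factor_action sv V \<rho>) hs \<Delta> e i j (u q))) p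
      (\<Sum>j\<in>UNIV - {i}. fscale (1 / (fst p $ i - fst p $ j)) (Omega (factor_action sv V \<rho>) hs \<Delta> e i j v) +
        fscale (- (fst d $ i - fst d $ j) / (fst p $ i - fst p $ j) ^ 2) (Omega (factor_action sv V \<rho>) hs \<Delta> e i j (u p)))"
    by (intro has_pd_sum has_pd_scale_fun has_pd_Omega v)
  from has_pd_add[OF has_pd_factor_action_moving this] show ?thesis
    by (simp only: kz_coeff_def sum.distrib add_ac)
qed

lemma has_pd_dyn_coeff:
  assumes \<alpha>: "\<And>\<alpha>. \<alpha> \<in> \<Delta>pos \<Longrightarrow> \<alpha> (snd p) \<noteq> 0" "\<And>\<alpha>. \<alpha> \<in> \<Delta>pos \<Longrightarrow> linear_on sg (*) H \<alpha>"
  shows "has_pd sg d (\<lambda>q. dyn_coeff (factor_action sv V \<rho>) \<Delta>pos e \<mu>' q (u q)) p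
    (dyn_coeff (factor_action sv V \<rho>) \<Delta>pos e \<mu>' p v + ((\<Sum>i\<in>UNIV. fscale (fst d $ i) (factor_action sv V \<rho> i \<mu>' (u p))) +
      (\<Sum>\<alpha>\<in>\<Delta>pos. fscale (- (\<alpha> \<mu>' * \<alpha> (snd d)) / \<alpha> (snd p) ^ 2)
        (total_action (factor_action sv V \<rho>) (e (- \<alpha>)) (total_action (factor_action sv V \<rho>) (e \<alpha>) (u p))))))"
proof -
  have pH: "snd p \<in> H" using W p by (auto simp: open_domain_def)
  have dH: "sg t (snd d) \<in> H" for t
    using d onb by (auto simp: orthonormal_basis_def intro: span_scale)
  have "((\<lambda>t. \<alpha> \<mu>' / \<alpha> (snd (shift sg d p t))) has_field_derivative
      - (\<alpha> \<mu>' * \<alpha> (snd d)) / \<alpha> (snd p) ^ 2) (at 0)" if "\<alpha> \<in> \<Delta>pos" for \<alpha>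
  proof -
    have "\<alpha> (snd (shift sg d p t)) = \<alpha> (snd p) + t * \<alpha> (snd d)" for t
      using \<alpha>(2)[OF that] pH d dH by (simp add: shift_def linear_on_def)
    moreover have "((\<lambda>t. \<alpha> \<mu>' / (\<alpha> (snd p) + t * \<alpha> (snd d))) has_field_derivative
      - (\<alpha> \<mu>' * \<alpha> (snd d)) / \<alpha> (snd p) ^ 2) (at 0)"
      using \<alpha>(1)[OF that] by (auto intro!: derivative_eq_intros simp: power2_eq_square)
    ultimately show ?thesis by simp
  qed
  then have 1: "has_pd sg d (\<lambda>q. \<Sum>\<alpha>\<in>\<Delta>pos. fscale (\<alpha> \<mu>' / \<alpha> (snd q))
        (total_action (factor_action sv V \<rho>) (e (- \<alpha>)) (total_action (factor_action sv V \<rho>) (e \<alpha>) (u q)))) p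
      (\<Sum>\<alpha>\<in>\<Delta>pos. fscale (\<alpha> \<mu>' / \<alpha> (snd p))
        (total_action (factor_action sv V \<rho>) (e (- \<alpha>)) (total_action (factor_action sv V \<rho>) (e \<alpha>) v)) +
       fscale (- (\<alpha> \<mu>' * \<alpha> (snd d)) / \<alpha> (snd p) ^ 2)
        (total_action (factor_action sv V \<rho>) (e (- \<alpha>)) (total_action (factor_action sv V \<rho>) (e \<alpha>) (u p))))"
    by (intro has_pd_sum has_pd_scale_fun has_pd_total_action v)
  have "((\<lambda>t. fst (shift sg d p t) $ i) has_field_derivative fst d $ i) (at 0)" for i
    unfolding shift_def by (auto intro!: derivative_eq_intros)
  then have 2: "has_pd sg d (\<lambda>q. \<Sum>i\<in>UNIV. fscale (fst q $ i) (factor_action sv V \<rho> i \<mu>' (u q))) p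
      (\<Sum>i\<in>UNIV. fscale (fst p $ i) (factor_action sv V \<rho> i \<mu>' v) + fscale (fst d $ i) (factor_action sv V \<rho> i \<mu>' (u p)))"
    by (intro has_pd_sum has_pd_scale_fun has_pd_factor_action v)
  from has_pd_add[OF 2 1] show ?thesis
    by (simp only: dyn_coeff_def sum.distrib add_ac)
qed

end

end

theorem theorem2p1:
  fixes sg :: "complex \<Rightarrow> 'g::ab_group_add \<Rightarrow> 'g"
    and br :: "'g \<Rightarrow> 'g \<Rightarrow> 'g"
    and form :: "'g \<Rightarrow> 'g \<Rightarrow> complex"
    and H :: "'g set"
    and e :: "('g \<Rightarrow> complex) \<Rightarrow> 'g"
    and S \<Delta> \<Delta>pos :: "('g \<Rightarrow> complex) set"
    and hs :: "'r::finite \<Rightarrow> 'g"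
    and sv :: "complex \<Rightarrow> 'v::ab_group_add \<Rightarrow> 'v"
    and V :: "'n::finite \<Rightarrow> 'v set"
    and \<rho> :: "'n \<Rightarrow> 'g \<Rightarrow> 'v \<Rightarrow> 'v"
    and \<kappa> :: complex
  assumes "simple_lie_algebra sg br"
    and "invariant_form sg br form"
    and "root_decomposition sg br H e"
    and "\<Delta> = roots sg br H"
    and "\<And>\<alpha>. \<alpha> \<in> \<Delta> \<Longrightarrow> form (e \<alpha>) (e (- \<alpha>)) = 1"
    and "simple_root_system \<Delta> S"
    and "\<Delta>pos = positive_roots \<Delta> S"
    and "orthonormal_basis sg form H hs"
    and "vector_space sv"
    and "\<And>i. highest_weight_module sg br H e \<Delta>pos sv (V i) (\<rho> i)"
    and "\<kappa> \<noteq> 0"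
  shows "compatible sg hs H sv V (regular_domain H \<Delta>)
    (range (kz_operator (factor_action sv V \<rho>) hs \<Delta> e \<kappa>) \<union>
     dynamical_operator sg (factor_action sv V \<rho>) \<Delta>pos e \<kappa> ` H)"
proof -
  interpret simple_lie_algebra sg br by (rule assms(1))
  interpret M: metric_lie_algebra sg br form
    by unfold_locales (rule assms(2))
  note dec = assms(3,4) and norm = assms(5) and onb = assms(8)
  have modules: "lie_module sg br sv (V i) (\<rho> i)" for i
    using assms(10)[of i] by (simp add: highest_weight_module_def)
  obtain P :: "(('n \<Rightarrow> 'v) \<Rightarrow> complex) fop" where P: "\<And>F. app P F \<in> tensor_space sv V"
      "\<And>F. F \<in> tensor_space sv V \<Longrightarrow> app P F = F"
    using tensor_projection[of sv V] by blast
  define T where "T = tensor_space sv V"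
  let ?act = "factor_action sv V \<rho>"
  interpret G: graded_lie_algebra sg br form H "root_index \<Delta>" "root_basis hs e" root_dual root_weight
    by (rule M.root_graded[OF dec norm onb])
  interpret L: lie_actions sg br form H "root_index \<Delta>" "root_basis hs e" root_dual root_weight
      sc_fop "\<lambda>i y. faop sv V \<rho> i y * P"
    using modules G.graded_lie_algebra_axioms P by (rule lie_actions_faop)
  have pos: "\<alpha> \<in> \<Delta>" if "\<alpha> \<in> \<Delta>pos" for \<alpha>
    using that by (simp add: assms(7) positive_roots_def)
  have neg: "- \<alpha> \<in> \<Delta>" if "\<alpha> \<in> \<Delta>" for \<alpha>
    using M.neg_root[OF dec that] .

  have act_T: "?act i y F \<in> T" if "F \<in> T" for i y F
    using factor_action_closed[OF modules] that by (simp add: T_def)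
  have sum_T: "(\<Sum>i\<in>A. f i) \<in> T" if "\<And>i. i \<in> A \<Longrightarrow> f i \<in> T" for A and f :: "'i \<Rightarrow> ('n, 'v) tensor"
    using that unfolding T_def by (rule fsc.subspace_sum[OF tensor_subspace])
  have app_act: "app (faop sv V \<rho> i y * P) F = ?act i y F" if "F \<in> T" for i y F
    using that by (simp add: app_times app_faop[OF modules] P T_def)
  have app_total: "app (L.total y) F = total_action ?act y F" if "F \<in> T" for y F
    using that by (simp add: L.total_def total_action_def app_sum app_act)
  have total_T: "total_action ?act y F \<in> T" if "F \<in> T" for y F
    unfolding total_action_def by (intro sum_T act_T that)
  have app_Om: "app (L.Om i j) F = Omega ?act hs \<Delta> e i j F" if "F \<in> T" for i j F
    using that G.finite_I
    by (simp add: L.Om_def Omega_def app_plus app_sum app_times[of "faop _ _ _ _ _ * P"] app_act act_T sum.Plus)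
  have app_kz: "app (L.kz (($) z) \<mu> i) F = kz_coeff ?act hs \<Delta> e i (z, \<mu>) F" if "F \<in> T" for z \<mu> i F
    using that by (simp add: L.kz_def kz_coeff_def app_plus app_sum app_sc app_act app_Om)
  \<comment> \<open>Twice \<open>e (- \<alpha>) * e \<alpha>\<close> is the sum of the products in
    both orders minus the bracket of \<open>e \<alpha>\<close> with \<open>e (- \<alpha>)\<close>;
    \<open>cartan\<close> collects these brackets.\<close>
  define cartan where "cartan = (\<lambda>\<mu> \<mu>'. \<Sum>\<alpha>\<in>\<Delta>pos. sg (\<alpha> \<mu>' / \<alpha> \<mu>) (br (e \<alpha>) (e (- \<alpha>))))"
  have cartan: "cartan \<mu> \<mu>' \<in> H" for \<mu> \<mu>'
    unfolding cartan_def
  proof (intro subspace_sum subspace_scale M.subspace_cartan[OF dec] G.centralizer_H)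
    fix \<alpha> h assume "\<alpha> \<in> \<Delta>pos" "h \<in> H"
    then have "br h (e \<alpha>) = sg (\<alpha> h) (e \<alpha>)" "br h (e (- \<alpha>)) = sg (- \<alpha> h) (e (- \<alpha>))"
      using M.root_vector[OF dec pos] M.root_vector[OF dec neg[OF pos]] by auto
    then show "br h (br (e \<alpha>) (e (- \<alpha>))) = 0"
      by (simp add: M.br_derivation M.br_scale_left M.br_scale_right M.br_minus_right)
  qed
  have casimir: "sc_fop (1 / 2) (L.tot.casimir (G.wq \<mu> \<mu>') - L.total (cartan \<mu> \<mu>')) =
      (\<Sum>\<alpha>\<in>\<Delta>pos. sc_fop (\<alpha> \<mu>' / \<alpha> \<mu>) (L.total (e (- \<alpha>)) * L.total (e \<alpha>)))" for \<mu> \<mu>'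
  proof -
    have "L.tot.casimir (G.wq \<mu> \<mu>') =
        (\<Sum>\<alpha>\<in>\<Delta>. sc_fop (\<alpha> \<mu>' / \<alpha> \<mu>) (L.total (e \<alpha>) * L.total (e (- \<alpha>))))"
      using G.finite_I by (simp add: L.tot.casimir_def L.tot.X_def G.wq_def sum.Plus)
    also have "\<dots> = (\<Sum>\<alpha>\<in>\<Delta>pos. sc_fop (\<alpha> \<mu>' / \<alpha> \<mu>) (L.total (e \<alpha>) * L.total (e (- \<alpha>)))
        + sc_fop (\<alpha> \<mu>' / \<alpha> \<mu>) (L.total (e (- \<alpha>)) * L.total (e \<alpha>)))"
      using M.root_nonzero[OF dec] unfolding assms(7)
      by (subst sum_positive_roots[OF assms(6) M.finite_roots[OF dec] _ neg]) auto
    also have "\<dots> = (\<Sum>\<alpha>\<in>\<Delta>pos. sc_fop (\<alpha> \<mu>' / \<alpha> \<mu>) (L.total (br (e \<alpha>) (e (- \<alpha>))))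
        + sc_fop 2 (sc_fop (\<alpha> \<mu>' / \<alpha> \<mu>) (L.total (e (- \<alpha>)) * L.total (e \<alpha>))))"
    proof (intro sum.cong refl)
      fix \<alpha>
      have "sc_fop 2 y = y + y" for y :: "(('n \<Rightarrow> 'v) \<Rightarrow> complex) fop"
        using L.R.scale_left_distrib[of 1 1 y] by simp
      then show "sc_fop (\<alpha> \<mu>' / \<alpha> \<mu>) (L.total (e \<alpha>) * L.total (e (- \<alpha>)))
          + sc_fop (\<alpha> \<mu>' / \<alpha> \<mu>) (L.total (e (- \<alpha>)) * L.total (e \<alpha>)) =
        sc_fop (\<alpha> \<mu>' / \<alpha> \<mu>) (L.total (br (e \<alpha>) (e (- \<alpha>))))
          + sc_fop 2 (sc_fop (\<alpha> \<mu>' / \<alpha> \<mu>) (L.total (e (- \<alpha>)) * L.total (e \<alpha>)))"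
        by (simp only: L.tot.rep_bracket[symmetric] comm_def L.R.scale_right_diff_distrib) simp
    qed
    also have "\<dots> = L.total (cartan \<mu> \<mu>')
        + sc_fop 2 (\<Sum>\<alpha>\<in>\<Delta>pos. sc_fop (\<alpha> \<mu>' / \<alpha> \<mu>) (L.total (e (- \<alpha>)) * L.total (e \<alpha>)))"
      by (simp only: cartan_def L.tot.rep_sum L.tot.rep_scale sum.distrib L.R.scale_sum_right)
    finally show ?thesis by simp
  qed
  have app_dyn: "app (L.dyn (($) z) \<mu> \<mu>' (cartan \<mu> \<mu>')) F = dyn_coeff ?act \<Delta>pos e \<mu>' (z, \<mu>) F"
    if "F \<in> T" for z \<mu> \<mu>' F
    using that unfolding L.dyn_def casimir
    by (simp add: dyn_coeff_def app_plus app_sum app_sc app_act app_times[of "L.total _"] app_total total_T)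
  have add_T: "F + G \<in> T" if "F \<in> T" "G \<in> T" for F G
    using that unfolding T_def by (rule fsc.subspace_add[OF tensor_subspace])
  have scale_T: "fscale c F \<in> T" if "F \<in> T" for c F
    using that unfolding T_def by (rule fsc.subspace_scale[OF tensor_subspace])
  have kz_T: "kz_coeff ?act hs \<Delta> e i q F \<in> T" if "F \<in> T" for q i F
    unfolding kz_coeff_def Omega_def by (intro add_T sum_T scale_T act_T that)
  have dyn_T: "dyn_coeff ?act \<Delta>pos e \<mu>' q F \<in> T" if "F \<in> T" for q \<mu>' F
    unfolding dyn_coeff_def by (intro add_T sum_T scale_T act_T total_T that)
  have swap: "app K (app K' F) = app K' (app K F)" if "comm K K' = 0" for K K' and F :: "('n, 'v) tensor"
    using that by (simp add: comm_eq_0_iff flip: app_times)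

  have main: "dop sg \<kappa> d A (dop sg \<kappa> d' A' u) p = dop sg \<kappa> d' A' (dop sg \<kappa> d A u) p"
    if W: "open_domain sg hs H W" "W \<subseteq> regular_domain H \<Delta>" and u: "holomorphic_tensor sg hs sv V W u"
      and p: "p \<in> W"
      and ops: "(\<exists>i. d = (axis i 1, 0) \<and> A = kz_coeff ?act hs \<Delta> e i) \<or> (\<exists>\<mu>'\<in>H. d = (0, \<mu>') \<and> A = dyn_coeff ?act \<Delta>pos e \<mu>')"
        "(\<exists>i. d' = (axis i 1, 0) \<and> A' = kz_coeff ?act hs \<Delta> e i) \<or> (\<exists>\<mu>'\<in>H. d' = (0, \<mu>') \<and> A' = dyn_coeff ?act \<Delta>pos e \<mu>')"
    for W u p d d' A A'
  proof -
    obtain z \<mu> where p_eq: "p = (z, \<mu>)" by (cases p)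
    have z: "z $ i \<noteq> z $ j" if "i \<noteq> j" for i j
      using W(2) p that by (auto simp: p_eq regular_domain_def)
    have \<mu>: "\<mu> \<in> H" "\<alpha> \<mu> \<noteq> 0" if "\<alpha> \<in> \<Delta>" for \<alpha>
      using W(2) p that by (auto simp: p_eq regular_domain_def)
    have \<mu>H: "\<mu> \<in> H" using W(2) p by (auto simp: p_eq regular_domain_def)
    have reg: "G.regular \<mu>"
      using \<mu> \<mu>H by (auto simp: G.regular_def)
    have uT: "u p \<in> T" using u p by (simp add: holomorphic_tensor_def T_def)
    have H0: "0 \<in> H" using subspace_0[OF M.subspace_cartan[OF dec]] .
    have \<alpha>0: "\<alpha> 0 = 0" if "\<alpha> \<in> \<Delta>" for \<alpha>
      using M.root_linear[OF dec that] H0 unfolding linear_on_def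
      by (metis scale_zero_left mult_zero_left)
    have act0: "?act i 0 (u p) = 0" for i
      using faop_scale[where V = V and F = "u p" and i = i and c = 0 and y = 0, OF modules] uT
      by (simp add: app_faop[OF modules] app_sc app_zero T_def)
    have dkz: "has_pd sg d (\<lambda>q. kz_coeff ?act hs \<Delta> e i q (u q)) p
        (kz_coeff ?act hs \<Delta> e i p v + (?act i (snd d) (u p) +
        (\<Sum>j\<in>UNIV - {i}. fscale (- (fst d $ i - fst d $ j) / (z $ i - z $ j) ^ 2) (Omega ?act hs \<Delta> e i j (u p)))))"
      if "has_pd sg d u p v" "snd d \<in> H" for d v i
      using M.has_pd_kz_coeff[OF onb W(1) u p that(2) modules that(1), of i] z by (simp add: p_eq)
    have ddyn: "has_pd sg d (\<lambda>q. dyn_coeff ?act \<Delta>pos e \<mu>' q (u q)) p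
        (dyn_coeff ?act \<Delta>pos e \<mu>' p v + ((\<Sum>i\<in>UNIV. fscale (fst d $ i) (?act i \<mu>' (u p))) +
        (\<Sum>\<alpha>\<in>\<Delta>pos. fscale (- (\<alpha> \<mu>' * \<alpha> (snd d)) / \<alpha> \<mu> ^ 2)
          (total_action ?act (e (- \<alpha>)) (total_action ?act (e \<alpha>) (u p))))))"
      if "has_pd sg d u p v" "snd d \<in> H" for d v \<mu>'
      using M.has_pd_dyn_coeff[OF onb W(1) u p that(2) modules that(1)] \<mu> pos M.root_linear[OF dec]
      by (simp add: p_eq)
    note dop = M.dop_commute[OF onb W(1) u p _ _ linear_coeff(1) linear_coeff(1)]
      M.dop_commute[OF onb W(1) u p _ _ linear_coeff(1) linear_coeff(2)]
      M.dop_commute[OF onb W(1) u p _ _ linear_coeff(2) linear_coeff(2)]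
    have kz_kz: "dop sg \<kappa> (axis i 1, 0) (kz_coeff ?act hs \<Delta> e i) (dop sg \<kappa> (axis k 1, 0) (kz_coeff ?act hs \<Delta> e k) u) p =
        dop sg \<kappa> (axis k 1, 0) (kz_coeff ?act hs \<Delta> e k) (dop sg \<kappa> (axis i 1, 0) (kz_coeff ?act hs \<Delta> e i) u) p" for i k
    proof (cases "i = k")
      case False
      \<comment> \<open>Moving \<open>z $ k\<close> affects only the denominator with
        \<open>j = k\<close>.\<close>
      have cross: "(\<Sum>j\<in>UNIV - {i}. fscale (- (axis k 1 $ i - axis k 1 $ j) / (z $ i - z $ j) ^ 2) (Omega ?act hs \<Delta> e i j (u p))) =
          fscale (1 / (z $ i - z $ k) ^ 2) (Omega ?act hs \<Delta> e i k (u p))" if "i \<noteq> k" for i k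
      proof -
        have "(\<Sum>j\<in>UNIV - {i}. fscale (- (axis k 1 $ i - axis k 1 $ j) / (z $ i - z $ j) ^ 2) (Omega ?act hs \<Delta> e i j (u p))) =
            (\<Sum>j\<in>UNIV - {i}. if j = k then fscale (1 / (z $ i - z $ k) ^ 2) (Omega ?act hs \<Delta> e i k (u p)) else 0)"
          using that by (intro sum.cong refl) (auto simp: axis_def)
        then show ?thesis using that by simp
      qed
      have sym: "Omega ?act hs \<Delta> e k i (u p) = Omega ?act hs \<Delta> e i k (u p)"
        using L.Om_sym[OF False] app_Om[OF uT] by metis
      show ?thesis
      proof (rule dop(1)[where R = "fscale (1 / (z $ i - z $ k) ^ 2) (Omega ?act hs \<Delta> e i k (u p))"])
        show "has_pd sg (axis k 1, 0) (\<lambda>q. kz_coeff ?act hs \<Delta> e i q (u q)) p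
            (kz_coeff ?act hs \<Delta> e i p v + fscale (1 / (z $ i - z $ k) ^ 2) (Omega ?act hs \<Delta> e i k (u p)))"
          if "has_pd sg (axis k 1, 0) u p v" for v
          using dkz[OF that, of i] H0 by (simp only: fst_conv snd_conv cross[OF False] act0 add_0_left)
        show "has_pd sg (axis i 1, 0) (\<lambda>q. kz_coeff ?act hs \<Delta> e k q (u q)) p
            (kz_coeff ?act hs \<Delta> e k p v + fscale (1 / (z $ i - z $ k) ^ 2) (Omega ?act hs \<Delta> e i k (u p)))"
          if "has_pd sg (axis i 1, 0) u p v" for v
          using dkz[OF that, of k] H0
          by (simp only: fst_conv snd_conv cross[OF False[symmetric]] act0 add_0_left sym power2_commute[of "z $ k" "z $ i"])
        show "kz_coeff ?act hs \<Delta> e i p (kz_coeff ?act hs \<Delta> e k p (u p)) =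
            kz_coeff ?act hs \<Delta> e k p (kz_coeff ?act hs \<Delta> e i p (u p))"
          using swap[OF L.comm_kz_kz[of "($) z" \<mu> i k], of "u p"] z uT kz_T dyn_T
          by (simp add: app_kz p_eq)
      qed (use H0 in simp_all)
    qed simp
    have kz_dyn: "dop sg \<kappa> (axis i 1, 0) (kz_coeff ?act hs \<Delta> e i) (dop sg \<kappa> (0, \<mu>') (dyn_coeff ?act \<Delta>pos e \<mu>') u) p =
        dop sg \<kappa> (0, \<mu>') (dyn_coeff ?act \<Delta>pos e \<mu>') (dop sg \<kappa> (axis i 1, 0) (kz_coeff ?act hs \<Delta> e i) u) p"
      if \<mu>': "\<mu>' \<in> H" for i \<mu>'
    \<comment> \<open>The \<mu>'-derivative of the action of \<mu> on factor \<open>i\<close> equals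
      the derivative of the \<open>z\<close>-linear dynamical term in \<open>z $ i\<close>.\<close>
    proof (rule dop(2)[where R = "?act i \<mu>' (u p)"])
      show "has_pd sg (0, \<mu>') (\<lambda>q. kz_coeff ?act hs \<Delta> e i q (u q)) p (kz_coeff ?act hs \<Delta> e i p v + ?act i \<mu>' (u p))"
        if "has_pd sg (0, \<mu>') u p v" for v
        using dkz[OF that, of i] \<mu>' by simp
      have axis: "(\<Sum>k\<in>UNIV. fscale (axis i 1 $ k) (?act k \<mu>' (u p))) = ?act i \<mu>' (u p)"
      proof -
        have "(\<Sum>k\<in>UNIV. fscale (axis i 1 $ k) (?act k \<mu>' (u p))) = (\<Sum>k\<in>UNIV. if k = i then ?act i \<mu>' (u p) else 0)"
          by (intro sum.cong refl) (auto simp: axis_def)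
        then show ?thesis by simp
      qed
      show "has_pd sg (axis i 1, 0) (\<lambda>q. dyn_coeff ?act \<Delta>pos e \<mu>' q (u q)) p (dyn_coeff ?act \<Delta>pos e \<mu>' p v + ?act i \<mu>' (u p))"
        if "has_pd sg (axis i 1, 0) u p v" for v
        using ddyn[OF that, of \<mu>'] H0 by (simp add: axis \<alpha>0 pos)
      show "kz_coeff ?act hs \<Delta> e i p (dyn_coeff ?act \<Delta>pos e \<mu>' p (u p)) =
          dyn_coeff ?act \<Delta>pos e \<mu>' p (kz_coeff ?act hs \<Delta> e i p (u p))"
        using swap[OF L.comm_kz_dyn[of "($) z" \<mu> \<mu>' "cartan \<mu> \<mu>'" i], of "u p"] z reg \<mu>' cartan uT kz_T dyn_T
        by (simp add: app_kz app_dyn p_eq)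
    qed (use H0 \<mu>' in simp_all)
    have dyn_dyn: "dop sg \<kappa> (0, \<mu>') (dyn_coeff ?act \<Delta>pos e \<mu>') (dop sg \<kappa> (0, \<mu>'') (dyn_coeff ?act \<Delta>pos e \<mu>'') u) p =
        dop sg \<kappa> (0, \<mu>'') (dyn_coeff ?act \<Delta>pos e \<mu>'') (dop sg \<kappa> (0, \<mu>') (dyn_coeff ?act \<Delta>pos e \<mu>') u) p"
      if \<mu>': "\<mu>' \<in> H" "\<mu>'' \<in> H" for \<mu>' \<mu>''
    \<comment> \<open>Differentiating the quotients gives an expression symmetric in \<mu>' and
      \<mu>'', so it serves as \<open>R\<close> for both orders.\<close>
    proof (rule dop(3)[where R = "\<Sum>\<alpha>\<in>\<Delta>pos. fscale (- (\<alpha> \<mu>' * \<alpha> \<mu>'') / \<alpha> \<mu> ^ 2)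
          (total_action ?act (e (- \<alpha>)) (total_action ?act (e \<alpha>) (u p)))"])
      show "has_pd sg (0, \<mu>'') (\<lambda>q. dyn_coeff ?act \<Delta>pos e \<mu>' q (u q)) p (dyn_coeff ?act \<Delta>pos e \<mu>' p v +
          (\<Sum>\<alpha>\<in>\<Delta>pos. fscale (- (\<alpha> \<mu>' * \<alpha> \<mu>'') / \<alpha> \<mu> ^ 2) (total_action ?act (e (- \<alpha>)) (total_action ?act (e \<alpha>) (u p)))))"
        if "has_pd sg (0, \<mu>'') u p v" for v
        using ddyn[OF that, of \<mu>'] \<mu>' by simp
      show "has_pd sg (0, \<mu>') (\<lambda>q. dyn_coeff ?act \<Delta>pos e \<mu>'' q (u q)) p (dyn_coeff ?act \<Delta>pos e \<mu>'' p v +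
          (\<Sum>\<alpha>\<in>\<Delta>pos. fscale (- (\<alpha> \<mu>' * \<alpha> \<mu>'') / \<alpha> \<mu> ^ 2) (total_action ?act (e (- \<alpha>)) (total_action ?act (e \<alpha>) (u p)))))"
        if "has_pd sg (0, \<mu>') u p v" for v
        using ddyn[OF that, of \<mu>''] \<mu>' by (simp add: mult.commute)
      show "dyn_coeff ?act \<Delta>pos e \<mu>' p (dyn_coeff ?act \<Delta>pos e \<mu>'' p (u p)) =
          dyn_coeff ?act \<Delta>pos e \<mu>'' p (dyn_coeff ?act \<Delta>pos e \<mu>' p (u p))"
        using swap[OF L.comm_dyn_dyn[of \<mu> \<mu>' \<mu>'' "cartan \<mu> \<mu>'" "cartan \<mu> \<mu>''" "($) z"], of "u p"] reg \<mu>' cartan uT kz_T dyn_T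
        by (simp add: app_dyn p_eq)
    qed (use \<mu>' in simp_all)
    show ?thesis
      using ops kz_kz kz_dyn kz_dyn[symmetric] dyn_dyn by (elim disjE exE bexE conjE) simp_all
  qed
  show ?thesis
    unfolding compatible_def M.kz_operator_eq_dop[abs_def] M.dynamical_operator_eq_dop[abs_def]
    by (auto intro!: main)
qed

end
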